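(* Let $q\in\mathbb{C}$ with $0<|q|<1$ and let $\omega$ be a primitive third root of unity. Then $$X(q^9)-\frac{\omega \chi(\omega q)-\omega^2\chi(\omega^2 q)}{\omega - \omega^2}=\frac{\overline{J}_{1,4}}{\overline{J}_{3,12}}\cdot\frac{J_{18,30}J_{3}}{J_{6}}.$$
   Context: For a complex number $p$ with $0<|p|<1$ and $x\in\mathbb{C}^*=\mathbb{C}\setminus\{0\}$: $(x;p)_n=\prod_{i=0}^{n-1}(1-p^ix)$, $(x;p)_\infty=\prod_{i\ge0}(1-p^ix)$, and $j(x;p)=(x;p)_\infty(p/x;p)_\infty(p;p)_\infty=\sum_{n\in\mathbb{Z}}(-1)^np^{\binom n2}x^n$. For integers $a,m$ with $m\ge1$: $J_{a,m}=j(q^a;q^m)$, $\overline{J}_{a,m}=j(-q^a;q^m)$ and $J_m=J_{m,3m}=\prod_{i\ge1}(1-q^{mi})$. The tenth-order mock theta functions $X,\chi$ are, for $|q|<1$, $X(q)=\sum_{n\ge0}\frac{(-1)^nq^{n^2}}{(-q;q)_{2n}}$ and $\chi(q)=\sum_{n\ge0}\frac{(-1)^nq^{(n+1)^2}}{(-q;q)_{2n+1}}$. *)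

theory Defs
  imports "HOL-Analysis.Analysis"
begin

definition qpoch :: "complex \<Rightarrow> complex \<Rightarrow> nat \<Rightarrow> complex" where
  "qpoch x p n = (\<Prod>i<n. 1 - p ^ i * x)"

(* For norm p < 1 the product below converges in the sense of has_prod,
   which also allows finitely many vanishing factors. *)
definition qpoch_inf :: "complex \<Rightarrow> complex \<Rightarrow> complex" where
  "qpoch_inf x p = prodinf (\<lambda>i. 1 - p ^ i * x)"

definition jtheta :: "complex \<Rightarrow> complex \<Rightarrow> complex" where
  "jtheta x p = qpoch_inf x p * qpoch_inf (p / x) p * qpoch_inf p p"

(* The nome q, implicit in the usual notation, is the first argument;
   the indices are a (any integer) and m (meaningful for m >= 1). *)
definition theta_J :: "complex \<Rightarrow> int \<Rightarrow> int \<Rightarrow> complex" where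
  "theta_J q a m = jtheta (q powi a) (q powi m)"

definition theta_Jbar :: "complex \<Rightarrow> int \<Rightarrow> int \<Rightarrow> complex" where
  "theta_Jbar q a m = jtheta (- (q powi a)) (q powi m)"

definition eta_J :: "complex \<Rightarrow> int \<Rightarrow> complex" where
  "eta_J q m = theta_J q m (3 * m)"

definition mock_X :: "complex \<Rightarrow> complex" where
  "mock_X q = (\<Sum>n. (-1) ^ n * q ^ (n ^ 2) / qpoch (- q) q (2 * n))"

definition mock_chi :: "complex \<Rightarrow> complex" where
  "mock_chi q = (\<Sum>n. (-1) ^ n * q ^ ((n + 1) ^ 2) / qpoch (- q) q (2 * n + 1))"

definition primitive_unity_root :: "nat \<Rightarrow> complex \<Rightarrow> bool" where
  "primitive_unity_root n w \<longleftrightarrow> 0 < n \<and> w ^ n = 1 \<and> (\<forall>k. 0 < k \<and> k < n \<longrightarrow> w ^ k \<noteq> 1)"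

end

theory Submission
  imports Defs "HOL-Library.Nat_Bijection"
begin

text \<open>
  Let \<open>\<psi>(q) = j(-q; q^4)\<close>. A conjugate Bailey pair turns \<open>\<psi>(q) X(q)\<close> and \<open>\<psi>(q) \<chi>(q)\<close> into sums
  of \<open>q^(2 (r + s)^2 + b (r + s) + 2 r s)\<close> over integer pairs \<open>(r, s)\<close> of equal sign, negative
  pairs counting with weight -1. In the sum for \<open>\<chi>\<close> the exponents congruent to 1 modulo 3 are those with
  \<open>r\<close> and \<open>s\<close> both divisible by 3, and they reassemble to the sum for \<open>X(q^9)\<close>.

  A second evaluation of the sum for \<open>\<chi>\<close> uses a primitive cube root of unity: comparing second-order
  recurrences in \<open>N = r + s\<close> writes it as \<open>\<psi>(q)\<close> times an Appell-type series, none of whose exponents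
  is congruent to 1 modulo 3, plus a double sum that Kronecker's identity evaluates as a theta quotient. The
  relevant 3-dissection of that quotient is a change of variables in a binary theta series.

  Since \<open>\<psi>(w q) = \<psi>(q) + (w - 1) q \<psi>(q^9)\<close> for every primitive cube root of unity \<open>w\<close>, the two
  relations determine \<open>\<chi>(q) + \<chi>(w q) + \<chi>(w^2 q)\<close> and
  \<open>\<chi>(q) + w^2 \<chi>(w q) + w \<chi>(w^2 q)\<close>, whose difference gives the claim.
\<close>

subsection \<open>Bilateral sums and the Jacobi triple product\<close>

text \<open>The congruence argument controls \<chi> only after multiplication by \<psi>, and \<psi>
  itself changes under q -> w q. So it yields a single linear equation between two unknown
  combinations of \<chi>(q), \<chi>(w q), \<chi>(w^2 q); the Appell expansion serves to evaluate one
  of the two separately. For this, every prefactor in \<open>chi_appell\<close> is arranged to be a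
  function of q^3, so that it passes through the dissection unchanged. Exponents congruent to 1
  modulo 3 are extracted analytically, by weighting the values at q, w q, w^2 q with 1, w^2, w
  (\<open>dissect_term\<close>). The Appell expansion is proved diagonal by diagonal: for fixed N =
  r + s all its constituents obey recurrences N -> N + 2 with the common multiplier q^(10 N + 10),
  and the inhomogeneous parts balance. The cube root is what makes the remaining double sum
  tractable: Kronecker's identity in base p = q^10 is then applied at w q^8 and w^2 q^8, whose theta
  functions combine with j(q^8; p) into one theta function in base p^3.\<close>

definition tri :: "int \<Rightarrow> int" where
  "tri k = k * (k - 1) div 2"

lemma two_tri: "2 * tri k = k * (k - 1)"
  unfolding tri_def by simp

lemma tri_add: "tri (a + b) = tri a + tri b + a * b"
proof -
  have "2 * tri (a + b) = 2 * (tri a + tri b + a * b)"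
    unfolding distrib_left two_tri by algebra
  thus ?thesis by simp
qed

lemma tri_neg: "tri (- a) = tri a + a"
proof -
  have "2 * tri (- a) = 2 * (tri a + a)"
    unfolding distrib_left two_tri by algebra
  thus ?thesis by simp
qed

lemma tri_simps [simp]: "tri 0 = 0" "tri 1 = 0" "tri 2 = 1"
  by (simp_all add: tri_def)

lemma tri_mult: "tri (c * a) = c * c * tri a + a * tri c"
proof -
  have "2 * tri (c * a) = 2 * (c * c * tri a + a * tri c)"
    using two_tri[of a] two_tri[of c] two_tri[of "c * a"] by algebra
  thus ?thesis by simp
qed

section \<open>Reindexing and convergence of sums over the integers\<close>

lemma infsum_shift_int: "(\<Sum>\<^sub>\<infinity>r::int. f (r + c)) = (\<Sum>\<^sub>\<infinity>r. f r)"
  by (rule infsum_reindex_bij_witness[of _ "\<lambda>r. r - c" "\<lambda>r. r + c"]) auto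

lemma infsum_reflect_int: "(\<Sum>\<^sub>\<infinity>r::int. f (c - r)) = (\<Sum>\<^sub>\<infinity>r. f r)"
  by (rule infsum_reindex_bij_witness[of _ "\<lambda>r. c - r" "\<lambda>r. c - r"]) auto

lemma has_sum_shift_int: "((\<lambda>r::int. f (r + c)) has_sum s) UNIV \<longleftrightarrow> (f has_sum s) UNIV"
  by (rule has_sum_reindex_bij_witness[of _ "\<lambda>r. r - c" "\<lambda>r. r + c"]) auto

lemma has_sum_reflect_int: "((\<lambda>r::int. f (c - r)) has_sum s) UNIV \<longleftrightarrow> (f has_sum s) UNIV"
  by (rule has_sum_reindex_bij_witness[of _ "\<lambda>r. c - r" "\<lambda>r. c - r"]) auto

lemma summable_shift_int: "(\<lambda>r::int. f (r + c)) summable_on UNIV \<longleftrightarrow> f summable_on UNIV"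
  by (rule summable_on_reindex_bij_witness[of _ "\<lambda>r. r - c" "\<lambda>r. r + c"]) auto

lemma summable_reflect_int: "(\<lambda>r::int. f (c - r)) summable_on UNIV \<longleftrightarrow> f summable_on UNIV"
  by (rule summable_on_reindex_bij_witness[of _ "\<lambda>r. c - r" "\<lambda>r. c - r"]) auto

lemma summable_on_norm_bound:
  fixes f :: "'a \<Rightarrow> complex"
  assumes "g summable_on A" "\<And>x. x \<in> A \<Longrightarrow> norm (f x) \<le> g x"
  shows "f summable_on A"
  using Infinite_Sum.abs_summable_on_comparison_test'[OF assms] by (rule abs_summable_summable)

lemma summable_on_int_split:
  fixes f :: "int \<Rightarrow> real"
  assumes "(\<lambda>n. f (int n)) summable_on UNIV" "(\<lambda>n. f (- int n)) summable_on UNIV"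
  shows "f summable_on UNIV"
proof -
  have "f summable_on {0..} \<longleftrightarrow> (\<lambda>n. f (int n)) summable_on UNIV"
    by (rule summable_on_reindex_bij_witness[of _ int nat]) auto
  moreover have "f summable_on {..0} \<longleftrightarrow> (\<lambda>n. f (- int n)) summable_on UNIV"
    by (rule summable_on_reindex_bij_witness[of _ "\<lambda>n. - int n" "\<lambda>k. nat (- k)"]) auto
  ultimately have "f summable_on ({0..} \<union> {..0})"
    using assms by (intro summable_on_union) auto
  moreover have "{0..} \<union> {..0} = (UNIV :: int set)" by auto
  ultimately show ?thesis by simp
qed

lemma summable_nat_theta:
  fixes a c :: real
  assumes "a > 0" "0 < c" "c < 1"
  shows "summable (\<lambda>n. a ^ n * c powi tri (int n))"
proof -
  have "(\<lambda>n. a * c ^ n) \<longlonglongrightarrow> a * 0"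
    by (intro tendsto_intros LIMSEQ_realpow_zero) (use assms in auto)
  hence "eventually (\<lambda>n. a * c ^ n < 1/2) sequentially"
    by (rule order_tendstoD) auto
  then obtain N where N: "\<And>n. n \<ge> N \<Longrightarrow> a * c ^ n < 1/2"
    by (auto simp: eventually_sequentially)
  show ?thesis
  proof (rule summable_ratio_test[of "1/2" N])
    fix n assume "n \<ge> N"
    have "tri (int (Suc n)) = tri (int n) + int n"
      using tri_add[of "int n" 1] by (simp add: add.commute)
    hence "a ^ Suc n * c powi tri (int (Suc n)) = (a * c ^ n) * (a ^ n * c powi tri (int n))"
      using assms by (simp add: power_int_add)
    also have "norm \<dots> = (a * c ^ n) * norm (a ^ n * c powi tri (int n))"
      using assms by (simp add: abs_mult)
    also have "\<dots> \<le> 1/2 * norm (a ^ n * c powi tri (int n))"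
      using N[OF \<open>n \<ge> N\<close>] by (intro mult_right_mono) auto
    finally show "norm (a ^ Suc n * c powi tri (int (Suc n))) \<le> 1/2 * norm (a ^ n * c powi tri (int n))" .
  qed auto
qed

lemma summable_int_theta:
  fixes a c :: real
  assumes "a > 0" "0 < c" "c < 1"
  shows "(\<lambda>n::int. a powi n * c powi tri n) summable_on UNIV"
proof (rule summable_on_int_split)
  show "(\<lambda>n. a powi int n * c powi tri (int n)) summable_on UNIV"
    using summable_nat_theta[OF assms] assms
    by (intro summable_nonneg_imp_summable_on) auto
  have *: "a powi (- int n) * c powi tri (- int n) = (c / a) ^ n * c powi tri (int n)" for n
    using assms by (simp add: tri_neg power_int_add power_int_minus field_simps)
  show "(\<lambda>n. a powi (- int n) * c powi tri (- int n)) summable_on UNIV"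
    unfolding * using summable_nat_theta[of "c / a" c] assms
    by (intro summable_nonneg_imp_summable_on) auto
qed

lemma norm_powi: "norm (x powi n) = norm (x :: complex) powi n"
  by (cases "n \<ge> 0") (auto simp: power_int_def norm_power norm_inverse)

lemma summable_theta:
  fixes z q :: complex
  assumes "z \<noteq> 0" "q \<noteq> 0" "norm q < 1"
  shows "(\<lambda>n::int. z powi n * q powi tri n) summable_on UNIV"
  by (rule summable_on_norm_bound[OF summable_int_theta[of "norm z" "norm q"]])
     (use assms in \<open>auto simp: norm_mult norm_powi\<close>)

text \<open>Dominated convergence for unordered sums over a countable index type: the bijection
  \<open>d\<close> carries it to Tannery's theorem for series, and the domination by
  \<open>M\<close> guarantees that the series and the unordered sum agree.\<close>

lemma tannery:
  fixes f :: "'a \<Rightarrow> nat \<Rightarrow> complex" and d :: "nat \<Rightarrow> 'a"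
  assumes d: "bij d"
  assumes lim: "\<And>k. (\<lambda>n. f k n) \<longlonglongrightarrow> g k"
  assumes bd: "\<And>k n. norm (f k n) \<le> M k"
  assumes M: "M summable_on UNIV"
  shows "(\<lambda>n. \<Sum>\<^sub>\<infinity>k. f k n) \<longlonglongrightarrow> (\<Sum>\<^sub>\<infinity>k. g k)"
proof -
  have "(\<lambda>k. M (d k)) summable_on UNIV"
    using M by (subst summable_on_reindex_bij_betw[OF d])
  hence sM: "summable (\<lambda>k. M (d k))"
    by (rule summable_on_imp_summable)
  have 1: "(\<lambda>n. \<Sum>k. f (d k) n) \<longlonglongrightarrow> (\<Sum>k. g (d k))"
    using tannerys_theorem[of "\<lambda>k. f (d k)" "\<lambda>k. g (d k)" sequentially "\<lambda>k. M (d k)"]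
      lim bd sM by (auto intro: always_eventually)
  have 2: "(\<Sum>k. h (d k)) = (\<Sum>\<^sub>\<infinity>k. h k)" if "\<And>k. norm (h k) \<le> M k" for h :: "'a \<Rightarrow> complex"
  proof -
    have "h summable_on UNIV" by (rule summable_on_norm_bound[OF M]) (use that in auto)
    hence "(h has_sum (\<Sum>\<^sub>\<infinity>k. h k)) UNIV" by simp
    hence "((\<lambda>k. h (d k)) has_sum (\<Sum>\<^sub>\<infinity>k. h k)) UNIV"
      by (subst has_sum_reindex_bij_betw[OF d])
    thus ?thesis by (metis has_sum_imp_sums sums_unique)
  qed
  have 3: "norm (g k) \<le> M k" for k
    by (rule tendsto_upperbound[OF tendsto_norm[OF lim]]) (use bd in auto)
  show ?thesis using 1 unfolding 2[of g, OF 3] 2[of "\<lambda>k. f k _", OF bd] .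
qed

lemmas tannery_int = tannery[OF bij_int_decode]
lemmas tannery_nat = tannery[OF bij_id]

section \<open>Finite and infinite q-products\<close>

lemma qpoch_Suc: "qpoch x p (Suc n) = qpoch x p n * (1 - p ^ n * x)"
  by (simp add: qpoch_def)

lemma qpoch_0 [simp]: "qpoch x p 0 = 1"
  by (simp add: qpoch_def)

lemma qpoch_convergent:
  fixes p x :: complex
  assumes "norm p < 1"
  shows "convergent_prod (\<lambda>i. 1 - p ^ i * x)"
proof (intro abs_convergent_prod_imp_convergent_prod summable_imp_abs_convergent_prod)
  have "summable (\<lambda>i. norm p ^ i * norm x)"
    using assms by (intro summable_mult2 summable_geometric) auto
  thus "summable (\<lambda>i. norm (1 - p ^ i * x - 1))"
    by (simp add: norm_mult norm_power)
qed

lemma qpoch_LIMSEQ: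
  assumes "norm p < 1"
  shows "(\<lambda>n. qpoch x p n) \<longlonglongrightarrow> qpoch_inf x p"
  using convergent_prod_LIMSEQ[OF qpoch_convergent[OF assms, of x]]
  unfolding qpoch_def qpoch_inf_def LIMSEQ_lessThan_iff_atMost .

lemma qpoch_inf_nonzero:
  assumes "norm p < 1" "\<And>i. p ^ i * x \<noteq> 1"
  shows "qpoch_inf x p \<noteq> 0"
  unfolding qpoch_inf_def
  by (rule prodinf_nonzero[OF qpoch_convergent[OF assms(1)]]) (metis assms(2) eq_iff_diff_eq_0)

lemma norm_ne_one: "norm (x :: complex) < 1 \<Longrightarrow> p ^ i * x \<noteq> 1" if "norm p < 1"
proof
  assume "norm x < 1" "p ^ i * x = 1"
  moreover have "norm (p ^ i) \<le> 1" using that by (simp add: norm_power power_le_one)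
  ultimately show False
    by (metis mult_le_one norm_ge_zero norm_mult norm_one less_le_not_le mult_left_le_one_le)
qed

lemma qpoch_inf_nonzero': "norm p < 1 \<Longrightarrow> norm x < 1 \<Longrightarrow> qpoch_inf x p \<noteq> 0"
  by (rule qpoch_inf_nonzero) (auto simp: norm_ne_one)

lemma qpoch_nonzero: "norm p < 1 \<Longrightarrow> norm x < 1 \<Longrightarrow> qpoch x p n \<noteq> 0"
  unfolding qpoch_def using norm_ne_one[of p x] by (auto simp: prod_zero_iff)

text \<open>The convention \<open>1 / (q; q)_k = 0\<close> for negative \<open>k\<close> makes all finite sums below bilateral.\<close>

definition rq :: "complex \<Rightarrow> int \<Rightarrow> complex" where
  "rq q k = (if k < 0 then 0 else 1 / qpoch q q (nat k))"

text \<open>The convention for negative indices keeps this valid for every integer \<open>k\<close>: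
  at k = 0 the factor 1 - q^0 vanishes together with \<open>rq q (-1)\<close>. Bilateral sums can
  therefore be shifted without boundary terms.\<close>

lemma rq_rec:
  assumes "norm q < 1"
  shows "rq q (k - 1) = (1 - q powi k) * rq q k"
proof (cases "k > 0")
  case True
  then obtain n where n: "k = int (Suc n)" by (metis gr0_implies_Suc zero_less_imp_eq_int)
  have nz: "qpoch q q (Suc n) \<noteq> 0" using assms by (intro qpoch_nonzero)
  have eq: "qpoch q q (Suc n) = qpoch q q n * (1 - q ^ Suc n)"
    by (simp add: qpoch_Suc mult.commute)
  have p: "q powi k = q ^ Suc n" unfolding n by (rule power_int_of_nat)
  have k1: "k - 1 = int n" by (simp add: n)
  have "1 / qpoch q q n = (1 - q ^ Suc n) * (1 / qpoch q q (Suc n))"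
    using nz unfolding eq by (metis mult_eq_0_iff nonzero_divide_mult_cancel_right times_divide_eq_right mult.right_neutral)
  moreover have "rq q (k - 1) = 1 / qpoch q q n" unfolding k1 by (simp add: rq_def)
  moreover have "rq q k = 1 / qpoch q q (Suc n)" unfolding n by (simp add: rq_def del: of_nat_Suc)
  ultimately show ?thesis unfolding p by simp
next
  case False
  thus ?thesis by (cases "k = 0") (auto simp: rq_def)
qed

lemma rq_neg [simp]: "k < 0 \<Longrightarrow> rq q k = 0" by (simp add: rq_def)

lemma rq_LIMSEQ:
  assumes "norm q < 1"
  shows "(\<lambda>n. rq q (int n + k)) \<longlonglongrightarrow> 1 / qpoch_inf q q"
proof -
  have 0: "(\<lambda>n. 1 / qpoch q q n) \<longlonglongrightarrow> 1 / qpoch_inf q q"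
    by (intro tendsto_intros qpoch_LIMSEQ qpoch_inf_nonzero' assms)
  have "filterlim (\<lambda>n. nat (int n + k)) at_top sequentially"
    unfolding filterlim_at_top
  proof
    fix Z
    show "eventually (\<lambda>n. Z \<le> nat (int n + k)) sequentially"
      by (rule eventually_sequentiallyI[of "Z + nat (- k)"]) linarith
  qed
  from filterlim_compose[OF 0 this]
  have "(\<lambda>n. 1 / qpoch q q (nat (int n + k))) \<longlonglongrightarrow> 1 / qpoch_inf q q" .
  moreover have "eventually (\<lambda>n. rq q (int n + k) = 1 / qpoch q q (nat (int n + k))) sequentially"
    using eventually_ge_at_top[of "nat (-k)"] by eventually_elim (auto simp: rq_def)
  ultimately show ?thesis by (simp add: tendsto_cong)
qed

lemma rq_bounded:
  assumes "norm q < 1"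
  obtains C where "C > 0" "\<And>k. norm (rq q k) \<le> C"
proof -
  have "Bseq (\<lambda>n. rq q (int n + 0))"
    using rq_LIMSEQ[OF assms] convergentI convergent_imp_Bseq by blast
  then obtain C where C: "C > 0" "\<And>n. norm (rq q (int n)) \<le> C" by (auto simp: Bseq_def)
  have "norm (rq q k) \<le> C" for k
  proof (cases "k < 0")
    case True thus ?thesis using C by simp
  next
    case False thus ?thesis using C(2)[of "nat k"] by simp
  qed
  with C that show ?thesis by blast
qed

lemma powi_add: "x \<noteq> 0 \<Longrightarrow> x powi (a + b) = x powi a * x powi b" for x :: "'a :: field"
  by (simp add: power_int_add)

lemma powi_of_nat: "x powi (int n) = x ^ n" for x :: complex
  by simp

section \<open>The finite triple product and its limit\<close>

definition jtn :: "complex \<Rightarrow> complex \<Rightarrow> nat \<Rightarrow> int \<Rightarrow> complex" where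
  "jtn z q n r = (-z) powi r * q powi tri r * (rq q (int n - r) * rq q (int n + r))"

text \<open>The coefficients come from expanding (1 - z q^n)(1 - q^(n+1)/z), the ratio of
  consecutive product sides, and the shifts of \<open>r\<close> align the powers of z. After removal
  of the common factor A R1 R2 this is a polynomial identity in N = q^n, x = q^r, y = q^(-r) with x
  y = 1.\<close>

lemma jtn_step:
  assumes "z \<noteq> 0" "q \<noteq> 0" "norm q < 1"
  shows "(1 - q ^ (2*n+1)) * (1 - q ^ (2*n+2)) * jtn z q (Suc n) r =
    (1 + q ^ (2*n+1)) * jtn z q n r - z * q ^ n * jtn z q n (r - 1) - q ^ Suc n / z * jtn z q n (r + 1)"
proof -
  define N x y A where "N = q ^ n" "x = q powi r" "y = q powi (-r)" "A = (-z) powi r * q powi tri r"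
  note d = this
  have xy: "x * y = 1" using assms by (simp add: d power_int_minus)
  define R1 R2 where "R1 = rq q (int n + 1 - r)" "R2 = rq q (int n + 1 + r)"
  note dR = this
  have e: "q powi (int n + 1 - r) = N * q * y" "q powi (int n + 1 + r) = N * q * x"
    "q powi (int n + r) = N * x" "q powi (int n - r) = N * y"
    using assms by (simp_all add: d power_int_add power_int_diff power_int_minus field_simps)
  have r1: "rq q (int n - r) = (1 - N * q * y) * R1"
    using rq_rec[of q "int n + 1 - r"] assms e by (simp add: dR)
  have r2: "rq q (int n + r) = (1 - N * q * x) * R2"
    using rq_rec[of q "int n + 1 + r"] assms e by (simp add: dR algebra_simps)
  have r3: "rq q (int n - r - 1) = (1 - N * y) * ((1 - N * q * y) * R1)"
    using rq_rec[of q "int n - r"] assms e r1 by (simp add: dR)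
  have r4: "rq q (int n + r - 1) = (1 - N * x) * ((1 - N * q * x) * R2)"
    using rq_rec[of q "int n + r"] assms e r2 by (simp add: dR)
  have t1: "tri (r - 1) = tri r + (- r) + 1"
    using tri_add[of "r" "-1"] by (simp add: tri_neg[of 1, simplified])
  have t2: "tri (r + 1) = tri r + r" using tri_add[of r 1] by simp
  have a1: "(-z) powi (r - 1) * q powi tri (r - 1) = - (A * y * q) / z"
    unfolding t1 using assms by (simp add: d power_int_diff power_int_add power_int_minus field_simps)
  have a2: "(-z) powi (r + 1) * q powi tri (r + 1) = - (A * x * z)"
    unfolding t2 using assms by (simp add: d power_int_add)
  have i: "int n - (r - 1) = int n + 1 - r" "int n + (r - 1) = int n + r - 1"
    "int n - (r + 1) = int n - r - 1" "int n + (r + 1) = int n + 1 + r" by simp_all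
  have j1: "jtn z q n (r - 1) = - (A * y * q) / z * (R1 * ((1 - N * x) * ((1 - N * q * x) * R2)))"
    unfolding jtn_def a1 i r4 by (simp only: dR)
  have j2: "jtn z q n (r + 1) = - (A * x * z) * ((1 - N * y) * ((1 - N * q * y) * R1) * R2)"
    unfolding jtn_def a2 i r3 by (simp only: dR)
  have j0: "jtn z q n r = A * ((1 - N * q * y) * R1 * ((1 - N * q * x) * R2))"
    unfolding jtn_def r1 r2 by (simp add: d)
  have j3: "jtn z q (Suc n) r = A * (R1 * R2)"
    unfolding jtn_def by (simp add: d dR algebra_simps)
  have p: "q ^ (2*n+1) = N\<^sup>2 * q" "q ^ (2*n+2) = N\<^sup>2 * q\<^sup>2" "q ^ Suc n = N * q"
    by (simp_all add: d power_add power_mult power2_eq_square power_mult_distrib mult_ac)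
  have c: "z * N * (- (A * y * q) / z * B) = - (N * A * y * q * B)"
          "N * q / z * (- (A * x * z) * B) = - (N * A * x * q * B)" for B
    using assms by simp_all
  have h1: "(1 - N * q * y) * (1 - N * q * x) = 1 - N * q * (x + y) + N\<^sup>2 * q\<^sup>2"
    using xy by algebra
  have h2: "y * ((1 - N * x) * (1 - N * q * x)) = y - N * (1 + q) + N\<^sup>2 * q * x"
    using xy by algebra
  have h3: "x * ((1 - N * y) * (1 - N * q * y)) = x - N * (1 + q) + N\<^sup>2 * q * y"
    using xy by algebra
  have "(1 - N\<^sup>2 * q) * (1 - N\<^sup>2 * q\<^sup>2) =
     (1 + N\<^sup>2 * q) * (1 - N * q * (x + y) + N\<^sup>2 * q\<^sup>2)
     + N * q * (y - N * (1 + q) + N\<^sup>2 * q * x) + N * q * (x - N * (1 + q) + N\<^sup>2 * q * y)"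
    by (simp add: algebra_simps power2_eq_square)
  hence "(1 - N\<^sup>2 * q) * (1 - N\<^sup>2 * q\<^sup>2) * (A * R1 * R2) =
     ((1 + N\<^sup>2 * q) * ((1 - N * q * y) * (1 - N * q * x))
     + N * q * (y * ((1 - N * x) * (1 - N * q * x))) + N * q * (x * ((1 - N * y) * (1 - N * q * y)))) * (A * R1 * R2)"
    unfolding h1 h2 h3 by (simp only:)
  hence "(1 - N\<^sup>2 * q) * (1 - N\<^sup>2 * q\<^sup>2) * (A * (R1 * R2)) =
    (1 + N\<^sup>2 * q) * (A * ((1 - N * q * y) * R1 * ((1 - N * q * x) * R2)))
     + N * A * y * q * (R1 * ((1 - N * x) * ((1 - N * q * x) * R2)))
     + N * A * x * q * ((1 - N * y) * ((1 - N * q * y) * R1) * R2)"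
    unfolding distrib_right by (simp only: mult_ac)
  thus ?thesis unfolding j0 j1 j2 j3 p d(1)[symmetric] c by simp
qed

text \<open>When \<open>jtn_step\<close> is summed over all r, the shifted series have the same
  total as the unshifted one, so the right-hand side collapses to one new factor of the
  product.\<close>

lemma fin_jtp:
  assumes "z \<noteq> 0" "q \<noteq> 0" "norm q < 1"
  shows "(jtn z q n has_sum qpoch z q n * qpoch (q / z) q n * rq q (2 * int n)) UNIV"
proof (induction n)
  case 0
  show ?case
  proof (rule has_sum_finite_neutralI[of "{0}"])
    fix r :: int assume "r \<in> UNIV - {0}"
    thus "jtn z q 0 r = 0" by (auto simp: jtn_def rq_def)
  qed (auto simp: jtn_def rq_def)
next
  case (Suc n)
  let ?T = "qpoch z q n * qpoch (q / z) q n * rq q (2 * int n)"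
  let ?c = "(1 - q ^ (2*n+1)) * (1 - q ^ (2*n+2))"
  have s1: "((\<lambda>r. jtn z q n (r - 1)) has_sum ?T) UNIV"
    using Suc has_sum_shift_int[of "jtn z q n" "-1"] by simp
  have s2: "((\<lambda>r. jtn z q n (r + 1)) has_sum ?T) UNIV"
    using Suc has_sum_shift_int[of "jtn z q n" "1"] by simp
  have "((\<lambda>r. (1 + q ^ (2*n+1)) * jtn z q n r + (- (z * q ^ n)) * jtn z q n (r - 1)
      + (- (q ^ Suc n / z)) * jtn z q n (r + 1)) has_sum
      (1 + q ^ (2*n+1)) * ?T + (- (z * q ^ n)) * ?T + (- (q ^ Suc n / z)) * ?T) UNIV"
    by (intro has_sum_add has_sum_cmult_right Suc s1 s2)
  also have "(\<lambda>r. (1 + q ^ (2*n+1)) * jtn z q n r + (- (z * q ^ n)) * jtn z q n (r - 1)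
      + (- (q ^ Suc n / z)) * jtn z q n (r + 1)) = (\<lambda>r. ?c * jtn z q (Suc n) r)"
    using jtn_step[OF assms] by (simp add: fun_eq_iff)
  also have "(1 + q ^ (2*n+1)) * ?T + (- (z * q ^ n)) * ?T + (- (q ^ Suc n / z)) * ?T
    = (1 - q ^ n * z) * (1 - q ^ n * (q / z)) * ?T"
  proof -
    define w N where "w = q / z" "N = q ^ n"
    have "z * w = q" using assms by (simp add: w_N_def)
    hence "N\<^sup>2 * q = N * z * (N * w)" by (simp add: power2_eq_square mult_ac)
    hence "(1 - N * z) * (1 - N * w) = 1 + N\<^sup>2 * q - N * z - N * w" by (simp add: algebra_simps)
    moreover have "q ^ (2*n+1) = N\<^sup>2 * q" "q ^ Suc n / z = N * w"
      by (simp_all add: w_N_def power_add mult_2 power2_eq_square)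
    ultimately have "(1 - N * z) * (1 - N * w) = 1 + q ^ (2*n+1) - z * N - q ^ Suc n / z"
      by (simp only: mult.commute)
    hence "(1 - q ^ n * z) * (1 - q ^ n * (q / z)) = 1 + q ^ (2*n+1) - z * q ^ n - q ^ Suc n / z"
      by (simp only: w_N_def)
    thus ?thesis by (simp only: ring_distribs mult_minus_left) simp
  qed
  also have "?T = qpoch z q n * qpoch (q / z) q n * (?c * rq q (2 * int (Suc n)))"
  proof -
    have "rq q (2 * int n) = (1 - q powi (2 * int n + 1)) * rq q (2 * int n + 1)"
      using rq_rec[OF assms(3), of "2 * int n + 1"] by simp
    also have "rq q (2 * int n + 1) = (1 - q powi (2 * int n + 2)) * rq q (2 * int n + 2)"
    proof -
      have e: "2 * int n + 2 - 1 = 2 * int n + 1" by simp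
      show ?thesis using rq_rec[OF assms(3), of "2 * int n + 2"] unfolding e .
    qed
    finally have "rq q (2 * int n) = (1 - q powi int (2 * n + 1)) * ((1 - q powi int (2 * n + 2)) * rq q (2 * int (Suc n)))"
      by (simp add: algebra_simps)
    thus ?thesis unfolding power_int_of_nat by (simp only: mult_ac)
  qed
  finally have "((\<lambda>r. ?c * jtn z q (Suc n) r) has_sum ?c * (qpoch z q (Suc n) * qpoch (q / z) q (Suc n) * rq q (2 * int (Suc n)))) UNIV"
    by (simp only: qpoch_Suc mult_ac)
  moreover have "?c \<noteq> 0"
  proof -
    have "q ^ k \<noteq> 1" if "k > 0" for k
    proof
      assume "q ^ k = 1"
      hence "norm q ^ k = 1" by (metis norm_one norm_power)
      moreover have "norm q ^ k < 1" using assms that by (simp add: power_less_one_iff)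
      ultimately show False by simp
    qed
    from this[of "2*n+1"] this[of "2*n+2"] show ?thesis by simp
  qed
  ultimately show ?case by (simp only: has_sum_cmult_right_iff nonzero_mult_div_cancel_left not_False_eq_True)
qed

theorem jacobi_triple_product:
  assumes "z \<noteq> 0" "q \<noteq> 0" "norm q < 1"
  shows "((\<lambda>r. (-z) powi r * q powi tri r) has_sum jtheta z q) UNIV"
proof -
  obtain C where C: "C > 0" "\<And>k. norm (rq q k) \<le> C" using rq_bounded assms by blast
  have sm: "(\<lambda>r. C * C * (norm z powi r * norm q powi tri r)) summable_on UNIV"
    by (intro summable_on_cmult_right summable_int_theta) (use assms in auto)
  let ?Q = "qpoch_inf q q"
  have nz: "?Q \<noteq> 0" using assms by (intro qpoch_inf_nonzero')
  \<comment> \<open>For fixed r both reciprocal factors tend to 1 / \<open>?Q\<close>, so the series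
    side acquires 1 / \<open>?Q\<close> twice while the product side acquires it once; the surplus
    is the third factor of the theta function.\<close>
  have "(\<lambda>n. \<Sum>\<^sub>\<infinity>r. jtn z q n r) \<longlonglongrightarrow> (\<Sum>\<^sub>\<infinity>r. (-z) powi r * q powi tri r * (1 / ?Q * (1 / ?Q)))"
  proof (rule tannery_int[OF _ _ sm])
    fix r
    have "(\<lambda>n. (-z) powi r * q powi tri r * (rq q (int n + (- r)) * rq q (int n + r))) \<longlonglongrightarrow>
      (-z) powi r * q powi tri r * (1 / ?Q * (1 / ?Q))"
      by (intro tendsto_intros rq_LIMSEQ assms)
    thus "(\<lambda>n. jtn z q n r) \<longlonglongrightarrow> (-z) powi r * q powi tri r * (1 / ?Q * (1 / ?Q))"
      by (simp add: jtn_def)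
    fix n
    have "norm (rq q (int n - r)) * norm (rq q (int n + r)) \<le> C * C"
      using C by (intro mult_mono) (auto intro: less_imp_le)
    moreover have "0 \<le> norm z powi r * norm q powi tri r" by simp
    ultimately have "(norm z powi r * norm q powi tri r) * (norm (rq q (int n - r)) * norm (rq q (int n + r)))
      \<le> (norm z powi r * norm q powi tri r) * (C * C)"
      by (intro mult_left_mono)
    thus "norm (jtn z q n r) \<le> C * C * (norm z powi r * norm q powi tri r)"
      by (simp add: jtn_def norm_mult norm_powi mult_ac)
  qed
  moreover have "(\<lambda>n. \<Sum>\<^sub>\<infinity>r. jtn z q n r) = (\<lambda>n. qpoch z q n * qpoch (q / z) q n * rq q (int (2 * n) + 0))"
    using infsumI[OF fin_jtp[OF assms]] by (simp add: fun_eq_iff)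
  moreover have "(\<lambda>n. qpoch z q n * qpoch (q / z) q n * rq q (int (2 * n) + 0)) \<longlonglongrightarrow>
     qpoch_inf z q * qpoch_inf (q / z) q * (1 / ?Q)"
  proof (intro tendsto_intros qpoch_LIMSEQ assms)
    show "(\<lambda>n. rq q (int (2 * n) + 0)) \<longlonglongrightarrow> 1 / ?Q"
      using LIMSEQ_subseq_LIMSEQ[OF rq_LIMSEQ[OF assms(3), of 0], of "\<lambda>n. 2 * n"]
      by (simp add: strict_mono_def o_def)
  qed
  ultimately have "(\<Sum>\<^sub>\<infinity>r. (-z) powi r * q powi tri r * (1 / ?Q * (1 / ?Q))) = qpoch_inf z q * qpoch_inf (q / z) q * (1 / ?Q)"
    by (simp only: LIMSEQ_unique)
  moreover have su: "(\<lambda>r. (-z) powi r * q powi tri r) summable_on UNIV"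
    using summable_theta[of "-z" q] assms by simp
  ultimately have "(\<Sum>\<^sub>\<infinity>r. (-z) powi r * q powi tri r) * (1 / ?Q * (1 / ?Q)) = qpoch_inf z q * qpoch_inf (q / z) q * (1 / ?Q)"
    by (subst infsum_cmult_left'[symmetric])
  hence "(\<Sum>\<^sub>\<infinity>r. (-z) powi r * q powi tri r) = jtheta z q"
    using nz by (simp add: jtheta_def field_simps)
  thus ?thesis using su by (metis has_sum_infsum)
qed

subsection \<open>Infinite products\<close>

abbreviation euler :: "complex \<Rightarrow> complex" where
  "euler p \<equiv> qpoch_inf p p"

lemma qpoch_inf_head:
  assumes "norm p < 1"
  shows "qpoch_inf x p = (1 - x) * qpoch_inf (p * x) p"
proof -
  have "qpoch x p (Suc n) = (1 - x) * qpoch (p * x) p n" for n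
    unfolding qpoch_def by (subst prod.lessThan_Suc_shift) (simp add: mult_ac)
  hence "(\<lambda>n. qpoch x p (Suc n)) \<longlonglongrightarrow> (1 - x) * qpoch_inf (p * x) p"
    using qpoch_LIMSEQ[OF assms, of "p * x"] by (auto intro: tendsto_intros)
  moreover have "(\<lambda>n. qpoch x p (Suc n)) \<longlonglongrightarrow> qpoch_inf x p"
    using qpoch_LIMSEQ[OF assms, of x] by (rule LIMSEQ_Suc)
  ultimately show ?thesis using LIMSEQ_unique by blast
qed

lemma qpoch_inf_minus:
  assumes "norm p < 1"
  shows "qpoch_inf x p * qpoch_inf (- x) p = qpoch_inf (x\<^sup>2) (p\<^sup>2)"
proof -
  have "qpoch x p n * qpoch (- x) p n = qpoch (x\<^sup>2) (p\<^sup>2) n" for n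
    unfolding qpoch_def prod.distrib[symmetric]
    by (intro prod.cong refl) (simp add: algebra_simps power2_eq_square power_mult_distrib)
  hence "(\<lambda>n. qpoch (x\<^sup>2) (p\<^sup>2) n) \<longlonglongrightarrow> qpoch_inf x p * qpoch_inf (- x) p"
    using tendsto_mult[OF qpoch_LIMSEQ[OF assms, of x] qpoch_LIMSEQ[OF assms, of "-x"]] by simp
  moreover have "norm (p\<^sup>2) < 1" using assms by (simp add: norm_power power_less_one_iff)
  ultimately show ?thesis using LIMSEQ_unique qpoch_LIMSEQ by blast
qed

lemma qpoch_inf_cube:
  assumes "norm p < 1" "1 + w + w\<^sup>2 = 0"
  shows "qpoch_inf x p * qpoch_inf (w * x) p * qpoch_inf (w\<^sup>2 * x) p = qpoch_inf (x ^ 3) (p ^ 3)"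
proof -
  have *: "(1 - a * x) * (1 - a * (w * x)) * (1 - a * (w\<^sup>2 * x)) = 1 - a ^ 3 * x ^ 3" for a
    using assms(2) by algebra
  have "qpoch x p n * qpoch (w * x) p n * qpoch (w\<^sup>2 * x) p n = qpoch (x ^ 3) (p ^ 3) n" for n
    unfolding qpoch_def prod.distrib[symmetric] *
    by (intro prod.cong refl) (simp flip: power_mult add: mult.commute)
  hence "(\<lambda>n. qpoch (x ^ 3) (p ^ 3) n) \<longlonglongrightarrow> qpoch_inf x p * qpoch_inf (w * x) p * qpoch_inf (w\<^sup>2 * x) p"
    using tendsto_mult[OF tendsto_mult[OF qpoch_LIMSEQ[OF assms(1), of x] qpoch_LIMSEQ[OF assms(1), of "w*x"]]
      qpoch_LIMSEQ[OF assms(1), of "w\<^sup>2*x"]] by simp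
  moreover have "norm (p ^ 3) < 1" using assms by (simp add: norm_power power_less_one_iff)
  ultimately show ?thesis using LIMSEQ_unique qpoch_LIMSEQ by blast
qed

text \<open>The factors are grouped by the residue of their index modulo \<open>k\<close>.\<close>

lemma qpoch_inf_split:
  assumes "norm p < 1" "k > 0"
  shows "qpoch_inf x p = (\<Prod>i<k. qpoch_inf (x * p ^ i) (p ^ k))"
proof -
  have prod_split: "(\<Prod>i<a + b. f i) = (\<Prod>i<a. f i) * (\<Prod>i<b. f (a + i))"
    for a b and f :: "nat \<Rightarrow> complex"
    by (induction b) (auto simp: mult_ac)
  have "qpoch x p (k * n) = (\<Prod>i<k. qpoch (x * p ^ i) (p ^ k) n)" for n
  proof (induction n)
    case (Suc n)
    have "qpoch x p (k * Suc n) = qpoch x p (k * n + k)" by (simp add: add.commute)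
    also have "\<dots> = qpoch x p (k * n) * (\<Prod>i<k. 1 - p ^ (k * n + i) * x)"
      using prod_split[of "\<lambda>i. 1 - p ^ i * x" "k * n" k] by (simp add: qpoch_def)
    also have "\<dots> = (\<Prod>i<k. qpoch (x * p ^ i) (p ^ k) (Suc n))"
      unfolding Suc qpoch_Suc prod.distrib[symmetric]
      by (intro prod.cong refl) (simp add: power_add power_mult mult_ac)
    finally show ?case .
  qed simp
  moreover have "(\<lambda>n. \<Prod>i<k. qpoch (x * p ^ i) (p ^ k) n) \<longlonglongrightarrow> (\<Prod>i<k. qpoch_inf (x * p ^ i) (p ^ k))"
    by (intro tendsto_prod qpoch_LIMSEQ) (use assms in \<open>simp add: norm_power power_less_one_iff\<close>)
  moreover have "(\<lambda>n. qpoch x p (k * n)) \<longlonglongrightarrow> qpoch_inf x p"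
    using LIMSEQ_subseq_LIMSEQ[OF qpoch_LIMSEQ[OF assms(1), of x], of "\<lambda>n. k * n"] assms
    by (simp add: strict_mono_def o_def)
  ultimately show ?thesis using LIMSEQ_unique by auto
qed

section \<open>Functional equations and product formulas for theta functions\<close>

lemma jtheta_inverse: "p \<noteq> 0 \<Longrightarrow> x \<noteq> 0 \<Longrightarrow> jtheta (p / x) p = jtheta x p"
  by (simp add: jtheta_def)

lemma jtheta_shift:
  assumes "norm p < 1" "x \<noteq> 0" "p \<noteq> 0"
  shows "jtheta x p = - x * jtheta (p * x) p"
proof -
  have 1: "qpoch_inf (p / (p * x)) p = (1 - 1 / x) * qpoch_inf (p / x) p"
    using qpoch_inf_head[OF assms(1), of "1 / x"] assms by simp
  have 2: "1 - x = - x * (1 - 1 / x)" using assms by (simp add: field_simps)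
  show ?thesis unfolding jtheta_def 1 qpoch_inf_head[OF assms(1), of x] 2 by (simp only: mult_ac)
qed

text \<open>The three factors of the theta function are the three residue classes modulo 3 of
  exponents in \<open>euler y\<close>. This identifies \<open>eta_J\<close> with the Euler
  product.\<close>

lemma jtheta_3:
  assumes "y \<noteq> 0" "norm y < 1"
  shows "jtheta y (y ^ 3) = euler y"
proof -
  have "y ^ 3 / y = y * y" using assms by (simp add: power3_eq_cube)
  moreover have "euler y = qpoch_inf y (y ^ 3) * qpoch_inf (y * y) (y ^ 3) * qpoch_inf (y * y\<^sup>2) (y ^ 3)"
    using qpoch_inf_split[of y 3 y] assms by (simp add: numeral_3_eq_3 power2_eq_square)
  ultimately show ?thesis by (simp add: jtheta_def power3_eq_cube power2_eq_square mult_ac)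
qed

text \<open>The two theta functions cover the exponents congruent to 1, 4 and to 3, 2 modulo 5 once
  each and the multiples of 5 twice.\<close>

lemma jtheta_5:
  assumes "y \<noteq> 0" "norm y < 1"
  shows "jtheta y (y ^ 5) * jtheta (y ^ 3) (y ^ 5) = euler y * euler (y ^ 5)"
proof -
  have "y ^ 5 / y = y ^ 4" "y ^ 5 / y ^ 3 = y ^ 2"
    using assms by (simp_all add: eval_nat_numeral)
  moreover have "euler y = qpoch_inf y (y ^ 5) * qpoch_inf (y ^ 2) (y ^ 5) * qpoch_inf (y ^ 3) (y ^ 5)
     * qpoch_inf (y ^ 4) (y ^ 5) * qpoch_inf (y ^ 5) (y ^ 5)"
    using qpoch_inf_split[of y 5 y] assms by (simp add: eval_nat_numeral mult_ac)
  ultimately show ?thesis by (simp add: jtheta_def mult_ac)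
qed

text \<open>Products of 1 - y over the three cube-root translates of y give 1 - y^3, both for x and
  for p / x. In \<open>kap_sum\<close> it trades the theta functions at w x and w^2 x for one in
  base p^3.\<close>

lemma jtheta_cube:
  assumes "norm p < 1" "p \<noteq> 0" "x \<noteq> 0" "1 + w + w\<^sup>2 = 0"
  shows "jtheta x p * jtheta (w * x) p * jtheta (w\<^sup>2 * x) p * euler (p ^ 3) = jtheta (x ^ 3) (p ^ 3) * euler p ^ 3"
proof -
  have w3: "w ^ 3 = 1" "w \<noteq> 0" using assms(4) by algebra (use assms(4) in auto)
  hence "w * w\<^sup>2 = 1" by (simp add: power3_eq_cube power2_eq_square mult_ac)
  hence "p / (w * x) = w\<^sup>2 * (p / x)" "p / (w\<^sup>2 * x) = w * (p / x)"
    using assms w3 by (simp_all add: field_simps)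
  note e = this
  have "jtheta x p * jtheta (w * x) p * jtheta (w\<^sup>2 * x) p =
    (qpoch_inf x p * qpoch_inf (w * x) p * qpoch_inf (w\<^sup>2 * x) p) *
    (qpoch_inf (p / x) p * qpoch_inf (w * (p / x)) p * qpoch_inf (w\<^sup>2 * (p / x)) p) * euler p ^ 3"
    unfolding jtheta_def e by (simp only: power3_eq_cube mult_ac)
  thus ?thesis unfolding qpoch_inf_cube[OF assms(1,4)] jtheta_def
    by (simp add: power_divide)
qed

text \<open>Once 1 - w is split off, the remaining products start at w p, w^2 p and p, which are the
  three cube-root translates of p.\<close>

lemma jtheta_unity_root:
  assumes "norm p < 1" "p \<noteq> 0" "1 + w + w\<^sup>2 = 0"
  shows "jtheta w p = (1 - w) * euler (p ^ 3)"
proof -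
  have w3: "w ^ 3 = 1" "w \<noteq> 0" using assms(3) by algebra (use assms(3) in auto)
  hence wi: "p / w = w\<^sup>2 * p" by (simp add: field_simps eval_nat_numeral)
  show ?thesis unfolding jtheta_def wi
    using qpoch_inf_cube[OF assms(1,3), of p] qpoch_inf_head[OF assms(1), of w]
    by (simp add: mult_ac)
qed

subsection \<open>Sums over the cone of index pairs of equal sign\<close>

text \<open>The negative quadrant counts with sign -1; this makes the recurrence \<open>csum_rec\<close> hold for every integer \<open>N\<close>.\<close>

definition csum :: "(int \<Rightarrow> int \<Rightarrow> complex) \<Rightarrow> int \<Rightarrow> complex" where
  "csum c N = (if N \<ge> 0 then \<Sum>r\<in>{0..N}. c r (N - r) else - (\<Sum>r\<in>{N+1..-1}. c r (N - r)))"

lemma csum_small [simp]: "csum c 0 = c 0 0" "csum c (-1) = 0" "csum c 1 = c 0 1 + c 1 0"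
proof -
  have "{0..1::int} = {0, 1}" by auto
  thus "csum c 1 = c 0 1 + c 1 0" by (simp add: csum_def)
qed (simp_all add: csum_def)

lemma csum_cong: "(\<And>r s. r + s = N \<Longrightarrow> c r s = d r s) \<Longrightarrow> csum c N = csum d N"
  by (simp add: csum_def)

lemma csum_cmult: "csum (\<lambda>r s. x * c r s) N = x * csum c N"
  by (simp add: csum_def sum_distrib_left)

lemma csum_reflect: "csum c (-2 - N) = - csum (\<lambda>r s. c (-1 - r) (-1 - s)) N"
proof -
  have *: "(\<Sum>r\<in>{a..b}. f r) = (\<Sum>r\<in>{-1-b..-1-a}. f (-1 - r))" for a b :: int and f :: "int \<Rightarrow> complex"
    by (rule sum.reindex_bij_witness[of _ "\<lambda>r. -1 - r" "\<lambda>r. -1 - r"]) auto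
  consider "N \<ge> 0" | "N = -1" | "N \<le> -2" by linarith
  thus ?thesis
  proof cases
    case 1
    hence "csum c (-2 - N) = - (\<Sum>r\<in>{-1-N..-1}. c r (-2 - N - r))" by (simp add: csum_def)
    also have "\<dots> = - csum (\<lambda>r s. c (-1 - r) (-1 - s)) N"
      using 1 by (subst *) (simp add: csum_def algebra_simps)
    finally show ?thesis .
  next
    case 3
    hence "csum c (-2 - N) = (\<Sum>r\<in>{0..-2-N}. c r (-2 - N - r))" by (simp add: csum_def)
    also have "\<dots> = - csum (\<lambda>r s. c (-1 - r) (-1 - s)) N"
      using 3 by (subst *) (simp add: csum_def algebra_simps)
    finally show ?thesis .
  qed auto
qed

text \<open>The two ends of the diagonal are split off and the interior is shifted by (1, 1). At N =
  -2 both ends are the point (0, 0), and the negative quadrant, which contributes - c 0 0 there,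
  removes the double count.\<close>

lemma csum_rec: "csum c (N + 2) = c 0 (N + 2) + c (N + 2) 0 + csum (\<lambda>r s. c (r + 1) (s + 1)) N"
proof -
  have pos: "csum c (N + 2) = c 0 (N + 2) + c (N + 2) 0 + csum (\<lambda>r s. c (r + 1) (s + 1)) N"
    if "N \<ge> 0" for N c
  proof -
    have "{0..N+2} = insert 0 (insert (N+2) {1..N+1})" using that by auto
    hence "csum c (N + 2) = c 0 (N + 2) + c (N + 2) 0 + (\<Sum>r\<in>{1..N+1}. c r (N + 2 - r))"
      using that by (simp add: csum_def)
    also have "(\<Sum>r\<in>{1..N+1}. c r (N + 2 - r)) = (\<Sum>r\<in>{0..N}. c (r+1) (N - r + 1))"
      by (rule sum.reindex_bij_witness[of _ "\<lambda>r. r + 1" "\<lambda>r. r - 1"]) (auto simp: algebra_simps)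
    finally show ?thesis using that by (simp add: csum_def)
  qed
  consider "N \<ge> 0" | "N = -1" | "N = -2" | "N \<le> -3" by linarith
  thus ?thesis
  proof cases
    case 3
    have "{-1..-1::int} = {-1}" by auto
    thus ?thesis using 3 by (simp add: csum_def)
  next
    case 4
    hence "{N+1..-1} = insert (-1) (insert (N+1) {N+2..-2})" by auto
    hence "csum (\<lambda>r s. c (r + 1) (s + 1)) N = - (c 0 (N + 2) + c (N+2) 0 + (\<Sum>r\<in>{N+2..-2}. c (r+1) (N - r + 1)))"
      using 4 by (simp add: csum_def add.commute)
    also have "(\<Sum>r\<in>{N+2..-2}. c (r+1) (N - r + 1)) = (\<Sum>r\<in>{3+N..-1}. c r (N + 2 - r))"
      by (rule sum.reindex_bij_witness[of _ "\<lambda>r. r - 1" "\<lambda>r. r + 1"]) (auto simp: algebra_simps)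
    also have "\<dots> = - csum c (N + 2)" using 4 by (simp add: csum_def)
    finally show ?thesis by simp
  qed (use pos in auto)
qed

section \<open>Diagonal sums of q^(r s)\<close>

definition gs :: "complex \<Rightarrow> int \<Rightarrow> complex" where
  "gs q = csum (\<lambda>r s. q powi (r * s))"

lemma gs_rec:
  assumes "q \<noteq> 0"
  shows "gs q (m + 2) = 2 + q powi (m + 1) * gs q m"
proof -
  have "csum (\<lambda>r s. q powi ((r + 1) * (s + 1))) m = csum (\<lambda>r s. q powi (m + 1) * q powi (r * s)) m"
  proof (rule csum_cong)
    fix r s assume "r + s = m"
    hence "(r + 1) * (s + 1) = (m + 1) + r * s" by (auto simp: algebra_simps)
    thus "q powi ((r + 1) * (s + 1)) = q powi (m + 1) * q powi (r * s)"
      using powi_add[OF assms] by simp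
  qed
  thus ?thesis unfolding gs_def by (subst csum_rec) (simp add: csum_cmult)
qed

lemma gs_reflect:
  assumes "q \<noteq> 0"
  shows "gs q (-2 - m) = - (q powi (m + 1) * gs q m)"
proof -
  have "csum (\<lambda>r s. q powi ((-1 - r) * (-1 - s))) m = csum (\<lambda>r s. q powi (m + 1) * q powi (r * s)) m"
  proof (rule csum_cong)
    fix r s assume "r + s = m"
    hence "(-1 - r) * (-1 - s) = (m + 1) + r * s" by (auto simp: algebra_simps)
    thus "q powi ((-1 - r) * (-1 - s)) = q powi (m + 1) * q powi (r * s)"
      using powi_add[OF assms] by simp
  qed
  thus ?thesis unfolding gs_def by (subst csum_reflect) (simp add: csum_cmult)
qed

text \<open>On both quadrants r s is nonnegative, so each summand has norm at most 1 and only the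
  number of summands matters.\<close>

lemma gs_bound:
  assumes "norm q < 1"
  shows "norm (gs q m) \<le> \<bar>of_int m\<bar> + 1"
proof -
  have b: "norm (\<Sum>r\<in>A. q powi (r * (m - r))) \<le> of_nat (card A)" if "\<And>r. r \<in> A \<Longrightarrow> r * (m - r) \<ge> 0" for A
  proof -
    have "norm (q powi (r * (m - r))) \<le> 1" if "r \<in> A" for r
      using that \<open>\<And>r. r \<in> A \<Longrightarrow> r * (m - r) \<ge> 0\<close>[OF that] assms
      by (simp add: norm_powi power_int_le_one)
    thus ?thesis using sum_norm_bound[of A "\<lambda>r. q powi (r * (m - r))" 1] by simp
  qed
  show ?thesis
  proof (cases "m \<ge> 0")
    case True
    thus ?thesis using b[of "{0..m}"] by (simp add: gs_def csum_def)
  next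
    case False
    have "r * (m - r) \<ge> 0" if "r \<in> {m+1..-1}" for r
      using that by (intro mult_nonpos_nonpos) auto
    thus ?thesis using b[of "{m+1..-1}"] False by (simp add: gs_def csum_def)
  qed
qed

text \<open>Essentially the alpha-sequence of a Bailey pair, extended to negative indices. It is
  applied in base q^2, where its Gaussian factor becomes q^(m^2 + m); see
  \<open>cS_sq\<close>.\<close>

definition cS :: "complex \<Rightarrow> int \<Rightarrow> complex" where
  "cS q m = (-1) powi m * q powi tri (m + 1) * gs q m"

lemma minus_one_powi_add2: "(-1) powi (m + 2) = ((-1) powi m :: complex)"
  by (simp add: power_int_add)

lemma cS_rec:
  assumes "q \<noteq> 0"
  shows "cS q (m + 2) = 2 * ((-1) powi m * q powi tri (m + 3)) + q powi (3 * m + 4) * cS q m"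
proof -
  have "tri (m + 2 + 1) = tri (m + 3)" by (simp add: algebra_simps)
  moreover have "q powi tri (m + 3) * q powi (m + 1) = q powi (3 * m + 4) * q powi tri (m + 1)"
  proof -
    have "tri (m + 3) + (m + 1) = 3 * m + 4 + tri (m + 1)"
      using tri_add[of "m + 1" 2] by (simp add: algebra_simps)
    thus ?thesis using powi_add[OF assms] by metis
  qed
  ultimately show ?thesis
    unfolding cS_def gs_rec[OF assms] minus_one_powi_add2 by (simp add: algebra_simps)
qed

lemma cS_reflect:
  assumes "q \<noteq> 0"
  shows "cS q (-2 - m) = - (q powi (2 * m + 2) * cS q m)"
proof -
  have "tri (-2 - m + 1) = tri (m + 1) + (m + 1)" using tri_neg[of "m + 1"] by (simp add: algebra_simps)
  hence "q powi tri (-2 - m + 1) * q powi (m + 1) = q powi (2 * m + 2) * q powi tri (m + 1)"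
    using powi_add[OF assms, of "tri (m + 1) + (m + 1)" "m + 1"]
      powi_add[OF assms, of "2 * m + 2" "tri (m + 1)"] by (simp add: algebra_simps)
  moreover have "(-1) powi (-2 - m) = ((-1) powi m :: complex)"
  proof -
    have "-2 - m = - (m + 2)" by simp
    thus ?thesis using power_int_minus_one_minus[of "m + 2"] minus_one_powi_add2[of m] by metis
  qed
  ultimately show ?thesis
    unfolding cS_def gs_reflect[OF assms] by (simp add: algebra_simps)
qed

lemma cS_small: "q \<noteq> 0 \<Longrightarrow> cS q 0 = 1" "cS q (-1) = 0"
  by (simp_all add: cS_def gs_def)

section \<open>The Bailey pair belonging to \<open>cS\<close>\<close>

lemma rq_pair_summable:
  "(\<lambda>m. g m * (rq q (n - m) * rq q (n + m + j))) summable_on (UNIV :: int set)"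
proof (rule finite_nonzero_values_imp_summable_on)
  have "{m \<in> UNIV. g m * (rq q (n - m) * rq q (n + m + j)) \<noteq> 0} \<subseteq> {- n - j .. n}"
    by (auto simp: rq_def split: if_splits)
  thus "finite {m \<in> UNIV. g m * (rq q (n - m) * rq q (n + m + j)) \<noteq> 0}" by (rule finite_subset) auto
qed

text \<open>A telescoping certificate: the change of the kernel in n is a difference in m of step 2
  whose multiplier \<open>q powi (3 * m + 4)\<close> is the one in \<open>cS_rec\<close>. Summation
  against \<open>cS\<close> then leaves only the inhomogeneous term of that recurrence. In N = q^n,
  x = q^m, y = 1/x and q' = 1/q the claim is polynomial, modulo x y = 1 and q q' = 1.\<close>

lemma bailey_step:
  assumes "q \<noteq> 0" "norm q < 1"
  shows "(1 + q powi n) * (1 - q powi (2 * n + 1)) * ((1 - q powi (2 * m + 2)) * (rq q (n - m) * rq q (n + m + 2)))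
     - (1 - q powi (2 * m + 2)) * (rq q (n - 1 - m) * rq q (n - 1 + m + 2))
   = q powi n * (1 + q powi (- m)) * (rq q (n - m) * rq q (n + m))
     - q powi (3 * m + 4) * (q powi n * (1 + q powi (- (m + 2))) * (rq q (n - (m + 2)) * rq q (n + (m + 2))))"
proof -
  define N x y where "N = q powi n" "x = q powi m" "y = q powi (-m)"
  note d = this
  have xy: "x * y = 1" using assms by (simp add: d power_int_minus)
  define q' where "q' = inverse q"
  have qq: "q * q' = 1" using assms by (simp add: q'_def)
  define R1 R2 where "R1 = rq q (n - m)" "R2 = rq q (n + m + 2)"
  note dR = this
  have e: "q powi (2 * n + 1) = N\<^sup>2 * q" "q powi (2 * m + 2) = x\<^sup>2 * q\<^sup>2" "q powi (n - m) = N * y"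
     "q powi (n - m - 1) = N * y * q'" "q powi (n + m + 2) = N * x * q\<^sup>2" "q powi (n + m + 1) = N * x * q"
     "q powi (3 * m + 4) = x ^ 3 * q ^ 4" "q powi (- (m + 2)) = y * q'\<^sup>2"
    using assms by (simp_all add: d q'_def power_int_add power_int_diff power_int_minus field_simps
       power_int_mult mult.commute[of _ m] mult.commute[of _ n] eval_nat_numeral power_int_mult_distrib)
  have r1: "rq q (n - 1 - m) = (1 - N * y) * R1"
    using rq_rec[of q "n - m"] assms e by (simp add: dR algebra_simps)
  have r2: "rq q (n - (m + 2)) = (1 - N * y * q') * ((1 - N * y) * R1)"
  proof -
    have "rq q (n - (m + 2)) = (1 - q powi (n - m - 1)) * rq q (n - 1 - m)"
      using rq_rec[OF assms(2), of "n - m - 1"] by (simp add: algebra_simps)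
    thus ?thesis unfolding e r1 .
  qed
  have r3: "rq q (n - 1 + m + 2) = (1 - N * x * q\<^sup>2) * R2"
    using rq_rec[of q "n + m + 2"] assms e by (simp add: dR algebra_simps)
  have r4: "rq q (n + m) = (1 - N * x * q) * ((1 - N * x * q\<^sup>2) * R2)"
  proof -
    have "rq q (n + m) = (1 - q powi (n + m + 1)) * rq q (n + m + 1)"
      using rq_rec[OF assms(2), of "n + m + 1"] by simp
    moreover have "rq q (n + m + 1) = (1 - q powi (n + m + 2)) * R2"
    proof -
      have "n + m + 2 - 1 = n + m + 1" by simp
      thus ?thesis using rq_rec[OF assms(2), of "n + m + 2"] by (simp only: dR)
    qed
    ultimately show ?thesis unfolding e by simp
  qed
  have r5: "rq q (n + (m + 2)) = R2" by (simp add: dR algebra_simps)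
  have A1: "(1 - N * y) * (1 - N * x * q\<^sup>2) = 1 - N * (y + x * q\<^sup>2) + N\<^sup>2 * q\<^sup>2"
    using xy by algebra
  have A2: "(1 + y) * ((1 - N * x * q) * (1 - N * x * q\<^sup>2)) =
    1 + y - N * (q + q\<^sup>2) * (1 + x) + N\<^sup>2 * q ^ 3 * (x\<^sup>2 + x)"
    using xy by algebra
  have A3a: "x ^ 3 * (1 + y * q'\<^sup>2) = x ^ 3 + x\<^sup>2 * q'\<^sup>2" using xy by algebra
  have A3b: "q ^ 4 * (x ^ 3 + x\<^sup>2 * q'\<^sup>2) = q ^ 4 * x ^ 3 + q\<^sup>2 * x\<^sup>2" using qq by algebra
  have A3c: "(q ^ 4 * x ^ 3 + q\<^sup>2 * x\<^sup>2) * ((1 - N * y * q') * (1 - N * y)) =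
    q ^ 4 * x ^ 3 + q\<^sup>2 * x\<^sup>2 - N * ((q ^ 3 + q ^ 4) * x\<^sup>2 + (q + q\<^sup>2) * x) + N\<^sup>2 * (q ^ 3 * x + q)"
  proof -
    have "(q ^ 4 * x ^ 3 + q\<^sup>2 * x\<^sup>2) * (1 - N * y) = q ^ 4 * x ^ 3 + q\<^sup>2 * x\<^sup>2 - N * (q ^ 4 * x\<^sup>2 + q\<^sup>2 * x)"
      using xy by algebra
    moreover have "(q ^ 4 * x ^ 3 + q\<^sup>2 * x\<^sup>2 - N * (q ^ 4 * x\<^sup>2 + q\<^sup>2 * x)) * y =
       q ^ 4 * x\<^sup>2 + q\<^sup>2 * x - N * (q ^ 4 * x + q\<^sup>2)" using xy by algebra
    moreover have "(q ^ 4 * x\<^sup>2 + q\<^sup>2 * x - N * (q ^ 4 * x + q\<^sup>2)) * q' = q ^ 3 * x\<^sup>2 + q * x - N * (q ^ 3 * x + q)"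
      using qq by algebra
    ultimately show ?thesis by algebra
  qed
  have A3: "q ^ 4 * (x ^ 3 * (1 + y * q'\<^sup>2)) * ((1 - N * y * q') * (1 - N * y)) =
    q ^ 4 * x ^ 3 + q\<^sup>2 * x\<^sup>2 - N * ((q ^ 3 + q ^ 4) * x\<^sup>2 + (q + q\<^sup>2) * x) + N\<^sup>2 * (q ^ 3 * x + q)"
    unfolding A3a A3b A3c ..
  have A4: "x\<^sup>2 * y = x" using xy by algebra
  have main: "(1 + N) * (1 - N\<^sup>2 * q) * (1 - x\<^sup>2 * q\<^sup>2) - (1 - x\<^sup>2 * q\<^sup>2) * ((1 - N * y) * (1 - N * x * q\<^sup>2))
    = N * ((1 + y) * ((1 - N * x * q) * (1 - N * x * q\<^sup>2)))
     - N * (q ^ 4 * (x ^ 3 * (1 + y * q'\<^sup>2)) * ((1 - N * y * q') * (1 - N * y)))"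
  proof -
    have A5: "N * y * (1 - x\<^sup>2 * q\<^sup>2) = N * y - N * q\<^sup>2 * x"
    proof -
      have "N * y * (1 - x\<^sup>2 * q\<^sup>2) = N * y - N * q\<^sup>2 * (x\<^sup>2 * y)" by (simp add: algebra_simps)
      thus ?thesis unfolding A4 .
    qed
    have "(1 + N) * (1 - N\<^sup>2 * q) * (1 - x\<^sup>2 * q\<^sup>2) - (1 - x\<^sup>2 * q\<^sup>2) * (1 - N * (y + x * q\<^sup>2) + N\<^sup>2 * q\<^sup>2)
      = (1 + N) * (1 - N\<^sup>2 * q) * (1 - x\<^sup>2 * q\<^sup>2) - (1 - x\<^sup>2 * q\<^sup>2) * (1 - N * x * q\<^sup>2 + N\<^sup>2 * q\<^sup>2) + N * y * (1 - x\<^sup>2 * q\<^sup>2)"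
      by (simp add: algebra_simps)
    thus ?thesis unfolding A1 A2 A3 A5 by (simp add: algebra_simps eval_nat_numeral)
  qed
  have g1: "P * (S * (R1 * R2)) - S * (u * R1 * (v * R2)) = (P * S - S * (u * v)) * (R1 * R2)" for P S u v
    by (simp add: algebra_simps)
  have g2: "(N * (a * (b * c)) - N * (f * (g * h) * (d * e))) * (R1 * R2) =
    N * a * (R1 * (b * (c * R2))) - g * f * (N * h * (d * (e * R1) * R2))" for a b c d e f g h
    by (simp add: algebra_simps)
  have "(1 + N) * (1 - N\<^sup>2 * q) * ((1 - x\<^sup>2 * q\<^sup>2) * (R1 * R2))
     - (1 - x\<^sup>2 * q\<^sup>2) * ((1 - N * y) * R1 * ((1 - N * x * q\<^sup>2) * R2))
   = ((1 + N) * (1 - N\<^sup>2 * q) * (1 - x\<^sup>2 * q\<^sup>2) - (1 - x\<^sup>2 * q\<^sup>2) * ((1 - N * y) * (1 - N * x * q\<^sup>2))) * (R1 * R2)"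
    by (rule g1)
  also have "\<dots> = N * (1 + y) * (R1 * ((1 - N * x * q) * ((1 - N * x * q\<^sup>2) * R2)))
     - x ^ 3 * q ^ 4 * (N * (1 + y * q'\<^sup>2) * ((1 - N * y * q') * ((1 - N * y) * R1) * R2))"
    unfolding main by (rule g2)
  finally show ?thesis
    unfolding e r1 r2 r3 r4 r5 dR[symmetric] d[symmetric] .
qed

lemma powi_double: "x \<noteq> 0 \<Longrightarrow> x powi (2 * m) = (x powi m)\<^sup>2" for x :: complex
  using powi_add[of x m m] by (simp add: power2_eq_square)

lemma jtn_one:
  assumes "q \<noteq> 0" "norm q < 1" "n > 0"
  shows "((\<lambda>m. (-1) powi m * q powi tri m * (rq q (int n - m) * rq q (int n + m))) has_sum 0) UNIV"
proof -
  \<comment> \<open>At z = 1 the first factor of the product side is 1 - q^0.\<close>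
  have "qpoch 1 q n = 0" unfolding qpoch_def using assms by (auto intro!: bexI[of _ 0])
  hence "(jtn 1 q n has_sum 0) UNIV" using fin_jtp[OF _ assms(1,2), of 1 n] by simp
  thus ?thesis by (simp add: jtn_def[abs_def])
qed

lemma one_minus_powi_nonzero:
  fixes q :: complex
  assumes "norm q < 1" "q \<noteq> 0" "k \<noteq> 0"
  shows "1 - q powi k \<noteq> 0" "1 + q powi k \<noteq> 0"
proof -
  have *: "norm q powi k < 1" if "k > 0" for k
    using that assms by (simp add: power_int_def power_less_one_iff)
  have "norm (q powi k) \<noteq> 1"
  proof (cases "k > 0")
    case True thus ?thesis using *[of k] by (simp add: norm_powi)
  next
    case False thus ?thesis using *[of "- k"] assms by (auto simp: norm_powi power_int_minus)
  qed
  thus "1 - q powi k \<noteq> 0" "1 + q powi k \<noteq> 0"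
    by (auto simp: add_eq_0_iff dest: arg_cong[of _ _ norm])
qed

text \<open>The multiplier is (1 - q^(2n)) (1 - q^(2n+1)) / (1 - q^n), the ratio of consecutive
  values of (q; q)_n / (q; q)_(2n+1), taken as the previous one over the present one.\<close>

lemma bailey_sum_rec:
  assumes "q \<noteq> 0" "norm q < 1" "n > 0"
  defines "F \<equiv> \<lambda>n. \<Sum>\<^sub>\<infinity>m. cS q m * ((1 - q powi (2 * m + 2)) * (rq q (n - m) * rq q (n + m + 2)))"
  shows "(1 + q powi int n) * (1 - q powi (2 * int n + 1)) * F (int n) = F (int n - 1)"
proof -
  define k where "k = (\<lambda>n m. (1 - q powi (2 * m + 2)) * (rq q (n - m) * rq q (n + m + 2)))"
  define c where "c = (\<lambda>m. q powi int n * (1 + q powi (- m)) * (rq q (int n - m) * rq q (int n + m)))"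
  have sk: "(\<lambda>m. cS q m * k n m) summable_on UNIV" for n
    using rq_pair_summable[of "\<lambda>m. cS q m * (1 - q powi (2 * m + 2))" q n 2]
    by (simp add: k_def mult_ac)
  have sc: "(\<lambda>m. g m * c m) summable_on UNIV" for g
    using rq_pair_summable[of "\<lambda>m. g m * (q powi int n * (1 + q powi (- m)))" q "int n" 0]
    by (simp add: c_def mult_ac)
  have z1: "((\<lambda>m. (-1) powi m * q powi tri m * (rq q (int n - m) * rq q (int n + m))) has_sum 0) UNIV"
    by (rule jtn_one[OF assms(1-3)])
  \<comment> \<open>The reflection m -> -m turns \<open>tri m\<close> into
    \<open>tri (m + 1)\<close> and exchanges the two \<open>rq\<close> factors.\<close>
  have z2: "((\<lambda>m. (-1) powi m * q powi tri (m + 1) * (rq q (int n - m) * rq q (int n + m))) has_sum 0) UNIV"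
  proof -
    have "((\<lambda>m. (-1) powi (0 - m) * q powi tri (0 - m) * (rq q (int n - (0 - m)) * rq q (int n + (0 - m)))) has_sum 0) UNIV"
      using z1 by (subst has_sum_reflect_int)
    moreover have "tri (0 - m) = tri (m + 1)" for m using tri_neg[of m] tri_add[of m 1] by simp
    moreover have "(-1) powi (0 - m) = ((-1) powi m :: complex)" for m
      using power_int_minus_one_minus[of m] by simp
    ultimately show ?thesis by (simp add: mult_ac)
  qed
  have "((1 + q powi int n) * (1 - q powi (2 * int n + 1)) * F (int n)) - F (int n - 1)
    = (\<Sum>\<^sub>\<infinity>m. (1 + q powi int n) * (1 - q powi (2 * int n + 1)) * (cS q m * k (int n) m)) - (\<Sum>\<^sub>\<infinity>m. cS q m * k (int n - 1) m)"
    by (simp only: F_def k_def infsum_cmult_right')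
  also have "\<dots> = (\<Sum>\<^sub>\<infinity>m. (1 + q powi int n) * (1 - q powi (2 * int n + 1)) * (cS q m * k (int n) m) + - (cS q m * k (int n - 1) m))"
    by (subst infsum_add) (auto intro!: sk summable_on_cmult_right simp: summable_on_uminus infsum_uminus)
  also have "\<dots> = (\<Sum>\<^sub>\<infinity>m. cS q m * c m + - (q powi (3 * m + 4) * cS q m * c (m + 2)))"
  proof (rule infsum_cong)
    fix m
    have "(1 + q powi int n) * (1 - q powi (2 * int n + 1)) * k (int n) m - k (int n - 1) m = c m - q powi (3 * m + 4) * c (m + 2)"
      unfolding k_def c_def by (rule bailey_step[OF assms(1,2)])
    thus "(1 + q powi int n) * (1 - q powi (2 * int n + 1)) * (cS q m * k (int n) m) + - (cS q m * k (int n - 1) m)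
      = cS q m * c m + - (q powi (3 * m + 4) * cS q m * c (m + 2))" by algebra
  qed
  also have "\<dots> = (\<Sum>\<^sub>\<infinity>m. cS q m * c m) - (\<Sum>\<^sub>\<infinity>m. q powi (3 * m + 4) * cS q m * c (m + 2))"
  proof -
    have "(\<lambda>m. q powi (3 * m + 4) * cS q m * c (m + 2)) summable_on UNIV"
      using sc[of "\<lambda>m. q powi (3 * (m - 2) + 4) * cS q (m - 2)"]
        summable_shift_int[of "\<lambda>m. q powi (3 * (m - 2) + 4) * cS q (m - 2) * c m" 2] by simp
    thus ?thesis by (subst infsum_add) (auto intro!: sc simp: summable_on_uminus infsum_uminus)
  qed
  \<comment> \<open>Shifting m by 2 puts both sums against the same kernel \<open>c (m + 2)\<close>,
    so that \<open>cS_rec\<close> applies to the difference of their coefficients.\<close>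
  also have "(\<Sum>\<^sub>\<infinity>m. cS q m * c m) = (\<Sum>\<^sub>\<infinity>m. cS q (m + 2) * c (m + 2))"
    using infsum_shift_int[of "\<lambda>m. cS q m * c m" 2] by simp
  also have "\<dots> - (\<Sum>\<^sub>\<infinity>m. q powi (3 * m + 4) * cS q m * c (m + 2))
    = (\<Sum>\<^sub>\<infinity>m. cS q (m + 2) * c (m + 2) + - (q powi (3 * m + 4) * cS q m * c (m + 2)))"
  proof -
    have "(\<lambda>m. q powi (3 * m + 4) * cS q m * c (m + 2)) summable_on UNIV"
      using sc[of "\<lambda>m. q powi (3 * (m - 2) + 4) * cS q (m - 2)"]
        summable_shift_int[of "\<lambda>m. q powi (3 * (m - 2) + 4) * cS q (m - 2) * c m" 2] by simp
    moreover have "(\<lambda>m. cS q (m + 2) * c (m + 2)) summable_on UNIV"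
      using sc[of "cS q"] summable_shift_int[of "\<lambda>m. cS q m * c m" 2] by simp
    ultimately show ?thesis by (subst infsum_add) (auto simp: summable_on_uminus infsum_uminus)
  qed
  also have "\<dots> = (\<Sum>\<^sub>\<infinity>m. 2 * ((-1) powi m * q powi tri (m + 3)) * c (m + 2))"
    by (rule infsum_cong) (simp add: cS_rec[OF assms(1)] algebra_simps)
  also have "\<dots> = (\<Sum>\<^sub>\<infinity>m. 2 * ((-1) powi m * q powi tri (m + 1)) * c m)"
  proof -
    have e: "m + 2 + 1 = m + 3" for m :: int by simp
    show ?thesis
      using infsum_shift_int[of "\<lambda>m. 2 * ((-1) powi m * q powi tri (m + 1)) * c m" 2]
      unfolding minus_one_powi_add2 e .
  qed
  \<comment> \<open>The factor 1 + q^(-m) inside \<open>c\<close> splits the sum into multiples of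
    the vanishing sums \<open>z2\<close> and \<open>z1\<close>.\<close>
  also have "\<dots> = 0"
  proof (rule infsumI)
    have "((\<lambda>m. (2 * q powi int n) * ((-1) powi m * q powi tri (m + 1) * (rq q (int n - m) * rq q (int n + m)))
       + (2 * q powi int n) * ((-1) powi m * q powi tri m * (rq q (int n - m) * rq q (int n + m)))) has_sum
       (2 * q powi int n) * 0 + (2 * q powi int n) * 0) UNIV"
      by (intro has_sum_add has_sum_cmult_right z1 z2)
    moreover have "2 * ((-1) powi m * q powi tri (m + 1)) * c m =
       (2 * q powi int n) * ((-1) powi m * q powi tri (m + 1) * (rq q (int n - m) * rq q (int n + m)))
       + (2 * q powi int n) * ((-1) powi m * q powi tri m * (rq q (int n - m) * rq q (int n + m)))" for m
    proof -
      have "tri m = tri (m + 1) + (- m)" using tri_add[of m 1] by simp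
      hence e: "q powi tri m = q powi tri (m + 1) * q powi (- m)"
        using powi_add[OF assms(1)] by metis
      show ?thesis unfolding c_def e distrib_left distrib_right mult_1_left mult_1_right by (simp only: mult_ac)
    qed
    ultimately show "((\<lambda>m. 2 * ((-1) powi m * q powi tri (m + 1)) * c m) has_sum 0) UNIV"
      by simp
  qed
  finally show ?thesis by simp
qed

text \<open>By \<open>cS_reflect\<close> the summand is invariant under m -> -2 - m, and it vanishes
  at m = -1; each index m >= 0 is thus counted twice, whence the factor 2.\<close>

lemma bailey_sum:
  assumes "q \<noteq> 0" "norm q < 1"
  shows "(\<Sum>\<^sub>\<infinity>m. cS q m * ((1 - q powi (2 * m + 2)) * (rq q (int n - m) * rq q (int n + m + 2))))
    = 2 * (qpoch q q n * rq q (2 * int n + 1))"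
proof -
  define F where "F = (\<lambda>n. \<Sum>\<^sub>\<infinity>m. cS q m * ((1 - q powi (2 * m + 2)) * (rq q (n - m) * rq q (n + m + 2))))"
  have "F (int n) = 2 * (qpoch q q n * rq q (2 * int n + 1))"
  proof (induction n)
    case 0
    have "{-2..0::int} = {-2, -1, 0}" by auto
    have r0: "rq q 0 = 1" by (simp add: rq_def)
    have r1: "rq q 1 = (1 - q powi 2) * rq q 2" using rq_rec[OF assms(2), of 2] by simp
    have c2: "cS q (-2) = - (q powi 2)" using cS_reflect[OF assms(1), of 0] cS_small(1)[OF assms(1)] cS_small(2) by simp
    have "F 0 = (\<Sum>m\<in>{-2..0}. cS q m * ((1 - q powi (2 * m + 2)) * (rq q (0 - m) * rq q (0 + m + 2))))"
      unfolding F_def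
      by (rule infsumI, rule has_sum_finite_neutralI[of "{-2..0}"]) (auto simp: rq_def)
    also have "\<dots> = 2 * rq q 1"
      unfolding \<open>{-2..0::int} = {-2, -1, 0}\<close> using assms r0 r1 cS_small(1)[OF assms(1)] cS_small(2) c2
      by (simp add: r1 power_int_minus field_simps)
    finally show ?case by simp
  next
    case (Suc n)
    have "(1 + q powi int (Suc n)) * (1 - q powi (2 * int (Suc n) + 1)) * F (int (Suc n)) = F (int n)"
      using bailey_sum_rec[OF assms, of "Suc n"] by (simp add: F_def)
    also have "\<dots> = 2 * (qpoch q q n * ((1 - q powi (2 * int n + 2)) * ((1 - q powi (2 * int n + 3)) * rq q (2 * int n + 3))))"
    proof -
      have e: "2 * int n + 2 - 1 = 2 * int n + 1" "2 * int n + 3 - 1 = 2 * int n + 2" by simp_all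
      show ?thesis
        using Suc rq_rec[OF assms(2), of "2 * int n + 2"] rq_rec[OF assms(2), of "2 * int n + 3"] unfolding e by simp
    qed
    also have "q powi (2 * int n + 2) = (q powi int (Suc n))\<^sup>2"
      using powi_double[OF assms(1), of "int (Suc n)"] by (simp add: algebra_simps)
    also have "2 * (qpoch q q n * ((1 - (q powi int (Suc n))\<^sup>2) * ((1 - q powi (2 * int n + 3)) * rq q (2 * int n + 3))))
      = (1 + q powi int (Suc n)) * (1 - q powi (2 * int (Suc n) + 1)) * (2 * (qpoch q q n * (1 - q powi int (Suc n)) * rq q (2 * int (Suc n) + 1)))"
      by (simp add: power2_eq_square algebra_simps)
    also have "qpoch q q n * (1 - q powi int (Suc n)) = qpoch q q (Suc n)"
      unfolding powi_of_nat qpoch_Suc by (simp add: mult.commute)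
    finally have eq: "(1 + q powi int (Suc n)) * (1 - q powi (2 * int (Suc n) + 1)) * F (int (Suc n)) =
      (1 + q powi int (Suc n)) * (1 - q powi (2 * int (Suc n) + 1)) * (2 * (qpoch q q (Suc n) * rq q (2 * int (Suc n) + 1)))" .
    have "(1 + q powi int (Suc n)) * (1 - q powi (2 * int (Suc n) + 1)) \<noteq> 0"
      by (intro no_zero_divisors one_minus_powi_nonzero[OF assms(2,1)]) auto
    thus ?case using eq mult_left_cancel by blast
  qed
  thus ?thesis by (simp add: F_def)
qed

lemma powi_eqI: "x \<noteq> 0 \<Longrightarrow> a + b = c \<Longrightarrow> x powi a * x powi b = x powi c" for x :: complex
  using powi_add by metis

lemma powi_eqI_nat: "x \<noteq> 0 \<Longrightarrow> int n + b = c \<Longrightarrow> x ^ n * x powi b = x powi c" for x :: complex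
  using powi_eqI[of x "int n" b c] by simp

lemma infsum_half_sum:
  assumes "f summable_on (UNIV :: int set)"
    and "\<And>m. f m + f (-2 - m) = (2 :: complex) * g m"
  shows "(\<Sum>\<^sub>\<infinity>m. f m) = (\<Sum>\<^sub>\<infinity>m. g m)"
proof -
  have "(\<lambda>m. f (-2 - m)) summable_on UNIV" using assms(1) by (simp only: summable_reflect_int)
  hence "(\<Sum>\<^sub>\<infinity>m. f m + f (-2 - m)) = (\<Sum>\<^sub>\<infinity>m. f m) + (\<Sum>\<^sub>\<infinity>m. f (-2 - m))"
    by (intro infsum_add assms)
  also have "(\<Sum>\<^sub>\<infinity>m. f (-2 - m)) = (\<Sum>\<^sub>\<infinity>m. f m)" by (rule infsum_reflect_int)
  also have "(\<Sum>\<^sub>\<infinity>m. f m + f (-2 - m)) = 2 * (\<Sum>\<^sub>\<infinity>m. g m)"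
    unfolding assms(2) by (rule infsum_cmult_right')
  finally show ?thesis by simp
qed

text \<open>The kernel \<open>R\<close> is invariant under m -> -2 - m while \<open>cS\<close> is
  multiplied by - q^(2m+2). Averaging over this involution reduces the first two sums to
  \<open>bailey_sum\<close>. The third is the first minus q^(n+1) times the second, by one
  application of \<open>rq_rec\<close>.\<close>

lemma cS_sums:
  assumes "q \<noteq> 0" "norm q < 1"
  shows "(\<Sum>\<^sub>\<infinity>m. cS q m * (rq q (int n - m) * rq q (int n + m + 1))) = qpoch q q n * rq q (2 * int n + 1)" (is ?A)
    and "(\<Sum>\<^sub>\<infinity>m. q powi m * cS q m * (rq q (int n - m) * rq q (int n + m + 1))) = q ^ n * (qpoch q q n * rq q (2 * int n + 1))" (is ?B)
    and "(\<Sum>\<^sub>\<infinity>m. cS q m * (rq q (int n - m) * rq q (int n + m))) = qpoch q q n * rq q (2 * int n)" (is ?C)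
proof -
  define R where "R = (\<lambda>m. rq q (int n - m) * rq q (int n + m + 2))"
  have R: "R (-2 - m) = R m" for m by (simp add: R_def mult.commute algebra_simps)
  have r: "rq q (int n - m) * rq q (int n + m + 1) = (1 - q powi (int n + m + 2)) * R m" for m
  proof -
    have e: "int n + m + 2 - 1 = int n + m + 1" by simp
    show ?thesis using rq_rec[OF assms(2), of "int n + m + 2"] unfolding e R_def by simp
  qed
  have F: "(\<Sum>\<^sub>\<infinity>m. cS q m * ((1 - q powi (2 * m + 2)) * R m)) = 2 * (qpoch q q n * rq q (2 * int n + 1))"
    unfolding R_def by (rule bailey_sum[OF assms])
  have F': "(\<Sum>\<^sub>\<infinity>m. 1/2 * (cS q m * ((1 - q powi (2 * m + 2)) * R m))) = qpoch q q n * rq q (2 * int n + 1)"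
    unfolding infsum_cmult_right' F by simp
  have sR: "(\<lambda>m. g m * R m) summable_on UNIV" for g
    using rq_pair_summable[of g q "int n" 2] by (simp add: R_def)
  have e1: "q powi (2 * m + 2) * q powi (int n - m) = q powi (int n + m + 2)" for m
    using powi_add[OF assms(1), of "2 * m + 2" "int n - m"] by (simp add: algebra_simps)
  have e2: "q powi (-2 - m) * q powi (2 * m + 2) = q powi m" for m
    using powi_add[OF assms(1), of "-2 - m" "2 * m + 2"] by simp
  have e3: "q powi m * q powi (int n - m) = q ^ n" for m
    using powi_add[OF assms(1), of m "int n - m"] by simp
  have e4: "q powi m * q powi (int n + m + 2) = q ^ n * q powi (2 * m + 2)" for m
    using powi_add[OF assms(1), of m "int n + m + 2"] powi_add[OF assms(1), of "int n" "2 * m + 2"]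
    by (simp add: algebra_simps)
  show A: ?A
    unfolding r F'[symmetric]
  proof (rule infsum_half_sum)
    show "(\<lambda>m. cS q m * ((1 - q powi (int n + m + 2)) * R m)) summable_on UNIV"
      using sR[of "\<lambda>m. cS q m * (1 - q powi (int n + m + 2))"] by (simp add: mult_ac)
    fix m
    have i: "int n + (-2 - m) + 2 = int n - m" by simp
    show "cS q m * ((1 - q powi (int n + m + 2)) * R m) + cS q (-2 - m) * ((1 - q powi (int n + (-2 - m) + 2)) * R (-2 - m))
      = 2 * (1/2 * (cS q m * ((1 - q powi (2 * m + 2)) * R m)))"
      unfolding R i cS_reflect[OF assms(1)] e1[symmetric] by (simp add: algebra_simps)
  qed
  show B: ?B
    unfolding r F'[symmetric] infsum_cmult_right'[symmetric]
  proof (rule infsum_half_sum)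
    show "(\<lambda>m. q powi m * cS q m * ((1 - q powi (int n + m + 2)) * R m)) summable_on UNIV"
      using sR[of "\<lambda>m. q powi m * cS q m * (1 - q powi (int n + m + 2))"] by (simp add: mult_ac)
    fix m
    have i: "int n + (-2 - m) + 2 = int n - m" by simp
    have "q powi (-2 - m) * (- (q powi (2 * m + 2) * cS q m)) = - (q powi m * cS q m)"
      using e2[of m] by (metis mult.assoc mult_minus_right)
    hence "q powi (-2 - m) * cS q (-2 - m) * ((1 - q powi (int n + (-2 - m) + 2)) * R (-2 - m))
      = - (q powi m * cS q m) * ((1 - q powi (int n - m)) * R m)"
      unfolding R i cS_reflect[OF assms(1)] by simp
    also have "\<dots> = - (q powi m - q powi m * q powi (int n - m)) * (cS q m * R m)"
      by (simp add: algebra_simps)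
    also have "\<dots> = - (q powi m - q ^ n) * (cS q m * R m)" unfolding e3 ..
    finally have 1: "q powi (-2 - m) * cS q (-2 - m) * ((1 - q powi (int n + (-2 - m) + 2)) * R (-2 - m))
      = - (q powi m - q ^ n) * (cS q m * R m)" .
    have "q powi m * cS q m * ((1 - q powi (int n + m + 2)) * R m)
      = (q powi m - q powi m * q powi (int n + m + 2)) * (cS q m * R m)"
      by (simp add: algebra_simps)
    also have "\<dots> = (q powi m - q ^ n * q powi (2 * m + 2)) * (cS q m * R m)"
      unfolding e4 ..
    finally show "q powi m * cS q m * ((1 - q powi (int n + m + 2)) * R m)
        + q powi (-2 - m) * cS q (-2 - m) * ((1 - q powi (int n + (-2 - m) + 2)) * R (-2 - m))
      = 2 * (q ^ n * (1/2 * (cS q m * ((1 - q powi (2 * m + 2)) * R m))))"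
      unfolding 1 by (simp add: algebra_simps)
  qed
  let ?T = "\<lambda>m. rq q (int n - m) * rq q (int n + m + 1)"
  have sT: "(\<lambda>m. g m * ?T m) summable_on UNIV" for g
    by (rule rq_pair_summable)
  have "cS q m * (rq q (int n - m) * rq q (int n + m)) = cS q m * ?T m + (- (q ^ Suc n)) * (q powi m * cS q m * ?T m)" for m
  proof -
    have e: "int n + m + 1 - 1 = int n + m" by simp
    have "rq q (int n + m) = (1 - q powi (int n + m + 1)) * rq q (int n + m + 1)"
      using rq_rec[OF assms(2), of "int n + m + 1"] unfolding e .
    moreover have "q powi (int n + m + 1) = q ^ Suc n * q powi m"
      by (rule powi_eqI_nat[OF assms(1), symmetric]) simp
    ultimately have r: "rq q (int n + m) = (1 - q ^ Suc n * q powi m) * rq q (int n + m + 1)" by simp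
    show ?thesis unfolding r by (simp add: algebra_simps)
  qed
  hence "(\<Sum>\<^sub>\<infinity>m. cS q m * (rq q (int n - m) * rq q (int n + m))) =
     (\<Sum>\<^sub>\<infinity>m. cS q m * ?T m + (- (q ^ Suc n)) * (q powi m * cS q m * ?T m))" by simp
  also have "\<dots> = (\<Sum>\<^sub>\<infinity>m. cS q m * ?T m) + (- (q ^ Suc n)) * (\<Sum>\<^sub>\<infinity>m. q powi m * cS q m * ?T m)"
    unfolding infsum_cmult_right'[symmetric]
    by (rule infsum_add) (intro sT summable_on_cmult_right)+
  also have "\<dots> = qpoch q q n * ((1 - q powi (2 * int n + 1)) * rq q (2 * int n + 1))"
    unfolding A B
  proof -
    have "q powi (2 * int n + 1) = q ^ Suc n * q powi (int n)"
      by (rule powi_eqI_nat[OF assms(1), symmetric]) simp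
    thus "qpoch q q n * rq q (2 * int n + 1) + - (q ^ Suc n) * (q ^ n * (qpoch q q n * rq q (2 * int n + 1))) =
      qpoch q q n * ((1 - q powi (2 * int n + 1)) * rq q (2 * int n + 1))"
      by (simp add: algebra_simps)
  qed
  also have "(1 - q powi (2 * int n + 1)) * rq q (2 * int n + 1) = rq q (2 * int n)"
    using rq_rec[OF assms(2), of "2 * int n + 1"] by simp
  finally show ?C .
qed

subsection \<open>A conjugate Bailey pair\<close>

text \<open>The weights of Bailey's lemma in base q^2 for a = 1, with one free parameter equal to q
  and the other sent to infinity.\<close>

definition wt :: "complex \<Rightarrow> nat \<Rightarrow> complex" where
  "wt q n = qpoch q (q\<^sup>2) n * (-1) ^ n * q ^ (n\<^sup>2)"

lemma norm_sq_less_one: "norm (q :: complex) < 1 \<Longrightarrow> norm (q\<^sup>2) < 1"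
  by (simp add: norm_power power_less_one_iff)

lemma qpoch_bounded:
  assumes "norm p < 1"
  obtains C where "C > 0" "\<And>n. norm (qpoch x p n) \<le> C"
  using qpoch_LIMSEQ[OF assms, of x] convergentI convergent_imp_Bseq Bseq_def by metis

lemma wt_bounded:
  assumes "norm q < 1"
  obtains C where "C > 0" "\<And>n. norm (wt q n) \<le> C * norm q ^ (n\<^sup>2)"
proof -
  obtain C where C: "C > 0" "\<And>n. norm (qpoch q (q\<^sup>2) n) \<le> C"
    using qpoch_bounded[OF norm_sq_less_one[OF assms]] by blast
  have "norm (wt q n) \<le> C * norm q ^ (n\<^sup>2)" for n
    using C by (auto simp: wt_def norm_mult norm_power intro!: mult_right_mono)
  thus ?thesis using that C by blast
qed

lemma summable_power_sq:
  fixes c :: real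
  assumes "0 \<le> c" "c < 1"
  shows "(\<lambda>n::nat. c ^ (n\<^sup>2)) summable_on UNIV"
proof -
  have "summable (\<lambda>n. c ^ n)" using assms by (intro summable_geometric) auto
  hence "summable (\<lambda>n. c ^ (n\<^sup>2))"
  proof (rule summable_comparison_test[rotated], intro exI allI impI)
    fix n :: nat
    have "n \<le> n\<^sup>2" by (simp add: power2_eq_square)
    hence "c ^ (n\<^sup>2) \<le> c ^ n" using assms by (intro power_decreasing) auto
    thus "norm (c ^ (n\<^sup>2)) \<le> c ^ n" using assms by simp
  qed
  thus ?thesis using assms by (intro summable_nonneg_imp_summable_on) auto
qed

lemma wt_summable:
  assumes "norm q < 1" "\<And>n. norm (g n) \<le> B"
  shows "(\<lambda>n. wt q n * g n) summable_on UNIV"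
proof -
  obtain C where C: "C > 0" "\<And>n. norm (wt q n) \<le> C * norm q ^ (n\<^sup>2)" using wt_bounded assms by blast
  have "B \<ge> 0" using assms(2)[of 0] norm_ge_zero order_trans by blast
  have "(\<lambda>n. (C * B) * norm q ^ (n\<^sup>2)) summable_on UNIV"
    by (intro summable_on_cmult_right summable_power_sq) (use assms in auto)
  thus ?thesis
  proof (rule summable_on_norm_bound)
    fix n
    have "norm (wt q n) * norm (g n) \<le> (C * norm q ^ (n\<^sup>2)) * B"
      using C assms(2)[of n] \<open>B \<ge> 0\<close> by (intro mult_mono) auto
    thus "norm (wt q n * g n) \<le> C * B * norm q ^ n\<^sup>2" by (simp add: norm_mult mult_ac)
  qed
qed

lemma rq_pair_bounded:
  assumes "norm q < 1"
  obtains C where "C > 0" "\<And>i j. norm (rq q i * rq q j) \<le> C"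
proof -
  obtain C where C: "C > 0" "\<And>k. norm (rq q k) \<le> C" using rq_bounded assms by blast
  have "norm (rq q i * rq q j) \<le> C * C" for i j
    unfolding norm_mult using C by (intro mult_mono) (auto intro: less_imp_le)
  thus ?thesis using that[of "C * C"] C by auto
qed

definition Dc :: "complex \<Rightarrow> int \<Rightarrow> complex" where
  "Dc q r = (\<Sum>\<^sub>\<infinity>n. wt q n * (rq (q\<^sup>2) (int n - r) * rq (q\<^sup>2) (int n + r)))"

text \<open>The companion of \<open>Dc\<close> for a = q^2: with the same free parameters this
  choice of a produces the additional power q^(2n) and the shifted index n + r + 1.\<close>

definition Dc' :: "complex \<Rightarrow> int \<Rightarrow> complex" where
  "Dc' q r = (\<Sum>\<^sub>\<infinity>n. wt q n * (q ^ (2 * n) * (rq (q\<^sup>2) (int n - r) * rq (q\<^sup>2) (int n + r + 1))))"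

lemma Dc_summable:
  assumes "norm q < 1"
  shows "(\<lambda>n. wt q n * (rq (q\<^sup>2) (int n + i) * rq (q\<^sup>2) (int n + j))) summable_on UNIV"
proof -
  obtain C where "C > 0" "\<And>i j. norm (rq (q\<^sup>2) i * rq (q\<^sup>2) j) \<le> C"
    using rq_pair_bounded[OF norm_sq_less_one[OF assms]] by blast
  thus ?thesis by (intro wt_summable[OF assms]) auto
qed

lemma infsum_nat_head:
  fixes f :: "nat \<Rightarrow> complex"
  assumes "f summable_on UNIV"
  shows "(\<Sum>\<^sub>\<infinity>n. f n) = f 0 + (\<Sum>\<^sub>\<infinity>n. f (Suc n))"
proof -
  have "UNIV = insert 0 (range Suc)" by (metis UNIV_nat_eq)
  moreover have "f summable_on range Suc" by (rule summable_on_subset_banach[OF assms]) auto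
  moreover have "(\<Sum>\<^sub>\<infinity>n\<in>range Suc. f n) = (\<Sum>\<^sub>\<infinity>n. f (Suc n))"
    by (subst infsum_reindex) (auto simp: o_def)
  ultimately show ?thesis using infsum_insert[of f "range Suc" 0] by auto
qed

lemma summable_on_Suc:
  fixes f :: "nat \<Rightarrow> complex"
  assumes "f summable_on UNIV"
  shows "(\<lambda>n. f (Suc n)) summable_on UNIV"
  using summable_on_subset_banach[OF assms, of "range Suc"] summable_on_reindex[of Suc UNIV f]
  by (simp add: o_def)

lemma Dc_terms:
  assumes "q \<noteq> 0" "norm q < 1"
  fixes r :: int and n :: nat
  defines "A \<equiv> rq (q\<^sup>2) (int n - r)" and "B \<equiv> rq (q\<^sup>2) (int n + r + 1)"
  shows "rq (q\<^sup>2) (int n - r - 1) = (1 - q ^ (2 * n) * q powi (- 2 * r)) * A"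
    and "rq (q\<^sup>2) (int n + r) = (1 - q ^ (2 * n) * q powi (2 * r) * q\<^sup>2) * B"
proof -
  have e: "(q\<^sup>2) powi k = q powi (2 * k)" for k by (simp add: power_int_mult)
  have "q powi (2 * (int n - r)) = q ^ (2 * n) * q powi (- 2 * r)"
    by (rule powi_eqI_nat[OF assms(1), symmetric]) simp
  thus "rq (q\<^sup>2) (int n - r - 1) = (1 - q ^ (2 * n) * q powi (- 2 * r)) * A"
    using rq_rec[OF norm_sq_less_one[OF assms(2)], of "int n - r"] unfolding e by (simp add: A_def)
  have "q powi (2 * (int n + r + 1)) = q ^ (2 * n) * q powi (2 * r) * q\<^sup>2"
  proof -
    have "q powi (2 * (int n + r + 1)) = q ^ (2 * n + 2) * q powi (2 * r)"
      by (rule powi_eqI_nat[OF assms(1), symmetric]) simp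
    thus ?thesis by (simp only: power_add mult_ac)
  qed
  moreover have "int n + r + 1 - 1 = int n + r" by simp
  ultimately show "rq (q\<^sup>2) (int n + r) = (1 - q ^ (2 * n) * q powi (2 * r) * q\<^sup>2) * B"
    using rq_rec[OF norm_sq_less_one[OF assms(2)], of "int n + r + 1"] unfolding e by (simp add: B_def)
qed

lemma wt_Suc: "wt q (Suc n) = - (wt q n * (q ^ (2 * n) * q * (1 - q ^ (2 * n) * q)))"
proof -
  have "(Suc n)\<^sup>2 = n\<^sup>2 + 2 * n + 1" by (simp add: power2_eq_square)
  hence "q ^ ((Suc n)\<^sup>2) = q ^ (n\<^sup>2) * (q ^ (2 * n) * q)" by (simp add: power_add)
  thus ?thesis by (simp add: wt_def qpoch_Suc power_mult)
qed

text \<open>The combination of neighbouring sums telescopes in n, with \<open>G\<close> as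
  certificate. The boundary value \<open>G 0\<close> vanishes for every r, because one of the
  indices -r - 1 and r is negative.\<close>

lemma Dc_step:
  assumes "q \<noteq> 0" "norm q < 1"
  shows "Dc q (r + 1) = - (q powi (2 * r + 1) * Dc q r)"
proof -
  define u v where "u = q powi (2 * r)" "v = q powi (- 2 * r)"
  have uv: "u * v = 1" using powi_add[OF assms(1), of "2 * r" "- 2 * r"] by (simp add: u_v_def)
  define G where "G = (\<lambda>n. (1 + u * q) * (wt q n * (rq (q\<^sup>2) (int n - r - 1) * rq (q\<^sup>2) (int n + r))))"
  have sG: "G summable_on UNIV"
  proof -
    have i: "int n + (- r - 1) = int n - r - 1" for n by simp
    show ?thesis using Dc_summable[OF assms(2), of "- r - 1" r] unfolding i G_def by (intro summable_on_cmult_right)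
  qed
  have u1: "q powi (2 * r + 1) = u * q" using assms by (simp add: u_v_def power_int_add)
  have tm: "wt q n * (rq (q\<^sup>2) (int n - (r + 1)) * rq (q\<^sup>2) (int n + (r + 1)))
     + u * q * (wt q n * (rq (q\<^sup>2) (int n - r) * rq (q\<^sup>2) (int n + r))) = G n + - G (Suc n)" for n
  proof -
    define A B N where "A = rq (q\<^sup>2) (int n - r)" "B = rq (q\<^sup>2) (int n + r + 1)" "N = q ^ (2 * n)"
    note d = this
    have t: "rq (q\<^sup>2) (int n - r - 1) = (1 - N * v) * A" "rq (q\<^sup>2) (int n + r) = (1 - N * u * q\<^sup>2) * B"
      using Dc_terms[OF assms, of n r] by (simp_all add: d u_v_def)
    have i: "int n - (r + 1) = int n - r - 1" "int n + (r + 1) = int n + r + 1"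
       "int (Suc n) - r - 1 = int n - r" "int (Suc n) + r = int n + r + 1" by simp_all
    have w: "wt q (Suc n) = - (wt q n * (N * q * (1 - N * q)))" by (simp add: wt_Suc d)
    have "(1 - N * v) * (1 - N * u * q\<^sup>2) = 1 - N * (v + u * q\<^sup>2) + N\<^sup>2 * q\<^sup>2" using uv by algebra
    hence "(1 + u * q) * ((1 - N * v) * (1 - N * u * q\<^sup>2)) + (1 + u * q) * (N * q * (1 - N * q))
       = (1 - N * v) + u * q * (1 - N * u * q\<^sup>2)" using uv by algebra
    hence "(1 - N * v) * (wt q n * A * B) + u * q * (1 - N * u * q\<^sup>2) * (wt q n * A * B) =
       (1 + u * q) * ((1 - N * v) * (1 - N * u * q\<^sup>2)) * (wt q n * A * B) + (1 + u * q) * (N * q * (1 - N * q)) * (wt q n * A * B)"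
      by (metis distrib_right)
    thus ?thesis unfolding G_def i t w d(1,2)[symmetric] by (simp only: mult_ac mult_minus_left mult_minus_right minus_minus)
  qed
  have "Dc q (r + 1) + u * q * Dc q r = (\<Sum>\<^sub>\<infinity>n. G n + - G (Suc n))"
    unfolding tm[symmetric] Dc_def infsum_cmult_right'[symmetric]
  proof (rule infsum_add[symmetric])
    show "(\<lambda>n. wt q n * (rq (q\<^sup>2) (int n - (r + 1)) * rq (q\<^sup>2) (int n + (r + 1)))) summable_on UNIV"
      using Dc_summable[OF assms(2), of "- (r + 1)" "r + 1"] by (simp only: add_uminus_conv_diff)
    show "(\<lambda>n. u * q * (wt q n * (rq (q\<^sup>2) (int n - r) * rq (q\<^sup>2) (int n + r)))) summable_on UNIV"
      using Dc_summable[OF assms(2), of "- r" "r"] by (intro summable_on_cmult_right) simp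
  qed
  also have "\<dots> = (\<Sum>\<^sub>\<infinity>n. G n) - (\<Sum>\<^sub>\<infinity>n. G (Suc n))"
    using sG summable_on_Suc[OF sG] by (subst infsum_add) (auto simp: summable_on_uminus infsum_uminus)
  also have "\<dots> = G 0" using infsum_nat_head[OF sG] by simp
  also have "G 0 = 0"
  proof (cases "r \<ge> 0")
    case True thus ?thesis by (simp add: G_def)
  next
    case False thus ?thesis by (simp add: G_def)
  qed
  finally show ?thesis unfolding u1 by (simp add: add_eq_0_iff)
qed

lemma Dc_closed:
  assumes "q \<noteq> 0" "norm q < 1"
  shows "Dc q r = (-1) powi r * q powi (r * r) * Dc q 0"
proof (induction r rule: int_induct[where k = 0])
  case (step1 i)
  have "q powi ((i + 1) * (i + 1)) = q powi (2 * i + 1) * q powi (i * i)"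
    using powi_add[OF assms(1), of "2 * i + 1" "i * i"] by (simp add: algebra_simps)
  moreover have "(-1) powi (i + 1) = - ((-1) powi i :: complex)" by (simp add: power_int_add)
  ultimately show ?case unfolding Dc_step[OF assms] step1 by simp
next
  case (step2 i)
  have 1: "q powi (i * i) = q powi (2 * (i - 1) + 1) * q powi ((i - 1) * (i - 1))"
    using powi_add[OF assms(1), of "2 * (i - 1) + 1" "(i - 1) * (i - 1)"] by (simp add: algebra_simps)
  have 2: "(-1) powi i = - ((-1) powi (i - 1) :: complex)"
    using power_int_add[of "-1 :: complex" "i - 1" 1] by simp
  have "Dc q i = - (q powi (2 * (i - 1) + 1) * Dc q (i - 1))"
    using Dc_step[OF assms, of "i - 1"] by simp
  hence "q powi (2 * (i - 1) + 1) * Dc q (i - 1) = - Dc q i" by simp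
  also have "Dc q i = (-1) powi i * q powi (i * i) * Dc q 0" using step2 by simp
  also have "- \<dots> = q powi (2 * (i - 1) + 1) * ((-1) powi (i - 1) * q powi ((i - 1) * (i - 1)) * Dc q 0)"
    unfolding 1 2 by (simp only: mult_minus_left mult_minus_right minus_minus mult_ac)
  finally have "q powi (2 * (i - 1) + 1) * Dc q (i - 1) = q powi (2 * (i - 1) + 1) * ((-1) powi (i - 1) * q powi ((i - 1) * (i - 1)) * Dc q 0)" .
  moreover have "q powi (2 * (i - 1) + 1) \<noteq> 0" using assms by simp
  ultimately show ?case using mult_left_cancel by blast
qed simp

text \<open>By \<open>Dc_closed\<close> the quotient of \<open>Dc q r\<close> by (-1)^r q^(r^2) is
  the same for all r. Writing the summation index as r + k and letting r tend to infinity, only the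
  term k = 0 survives, and its limit is the constant.\<close>

lemma Dc_limit:
  assumes "q \<noteq> 0" "norm q < 1"
  shows "Dc q 0 = qpoch_inf q (q\<^sup>2) / euler (q\<^sup>2)"
proof -
  define f where "f = (\<lambda>k r. (-1) ^ k * q ^ (k\<^sup>2 + 2 * r * k) * qpoch q (q\<^sup>2) (r + k) * (rq (q\<^sup>2) (int k) * rq (q\<^sup>2) (int (2 * r) + int k)))"
  define g where "g = (\<lambda>k::nat. if k = 0 then qpoch_inf q (q\<^sup>2) / euler (q\<^sup>2) else 0)"
  note Q = norm_sq_less_one[OF assms(2)]
  have eq: "Dc q 0 = (\<Sum>\<^sub>\<infinity>k. f k r)" for r
  proof -
    have "Dc q (int r) = (\<Sum>\<^sub>\<infinity>n\<in>{r..}. wt q n * (rq (q\<^sup>2) (int n - int r) * rq (q\<^sup>2) (int n + int r)))"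
      unfolding Dc_def by (rule infsum_cong_neutral) auto
    also have "\<dots> = (\<Sum>\<^sub>\<infinity>k. wt q (r + k) * (rq (q\<^sup>2) (int k) * rq (q\<^sup>2) (int (2 * r) + int k)))"
      by (rule infsum_reindex_bij_witness[of _ "\<lambda>k. r + k" "\<lambda>n. n - r"]) (auto simp: algebra_simps)
    also have "\<dots> = (\<Sum>\<^sub>\<infinity>k. ((-1) ^ r * q ^ (r * r)) * f k r)"
    proof (rule infsum_cong)
      fix k
      have "(r + k)\<^sup>2 = r * r + (k\<^sup>2 + 2 * r * k)" by (simp add: power2_eq_square algebra_simps)
      thus "wt q (r + k) * (rq (q\<^sup>2) (int k) * rq (q\<^sup>2) (int (2 * r) + int k)) = ((-1) ^ r * q ^ (r * r)) * f k r"
        unfolding wt_def f_def by (simp only: power_add mult_ac)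
    qed
    also have "\<dots> = ((-1) ^ r * q ^ (r * r)) * (\<Sum>\<^sub>\<infinity>k. f k r)" by (rule infsum_cmult_right')
    finally have "((-1) ^ r * q ^ (r * r)) * Dc q 0 = ((-1) ^ r * q ^ (r * r)) * (\<Sum>\<^sub>\<infinity>k. f k r)"
      using Dc_closed[OF assms, of "int r"] by (simp flip: of_nat_mult)
    thus ?thesis using assms by simp
  qed
  obtain C1 where C1: "C1 > 0" "\<And>n. norm (qpoch q (q\<^sup>2) n) \<le> C1"
    using qpoch_bounded[OF Q] by blast
  obtain C2 where C2: "C2 > 0" "\<And>i j. norm (rq (q\<^sup>2) i * rq (q\<^sup>2) j) \<le> C2"
    using rq_pair_bounded[OF Q] by blast
  have fb: "norm (f k r) \<le> norm q ^ (k\<^sup>2 + 2 * r * k) * (C1 * C2)" for k r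
  proof -
    have "norm (f k r) = norm q ^ (k\<^sup>2 + 2 * r * k) * (norm (qpoch q (q\<^sup>2) (r + k)) * norm (rq (q\<^sup>2) (int k) * rq (q\<^sup>2) (int (2 * r) + int k)))"
      by (simp add: f_def norm_mult norm_power mult_ac)
    also have "\<dots> \<le> norm q ^ (k\<^sup>2 + 2 * r * k) * (C1 * C2)"
      using C1 C2 by (intro mult_left_mono mult_mono) (auto intro: less_imp_le)
    finally show ?thesis .
  qed
  have "(\<lambda>r. \<Sum>\<^sub>\<infinity>k. f k r) \<longlonglongrightarrow> (\<Sum>\<^sub>\<infinity>k. g k)"
  proof (rule tannery_nat)
    show "(\<lambda>k. norm q ^ (k\<^sup>2) * (C1 * C2)) summable_on UNIV"
      by (intro summable_on_cmult_left summable_power_sq) (use assms in auto)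
    fix k
    {
      fix r
      have "norm q ^ (k\<^sup>2 + 2 * r * k) \<le> norm q ^ (k\<^sup>2)" using assms by (intro power_decreasing) auto
      hence "norm q ^ (k\<^sup>2 + 2 * r * k) * (C1 * C2) \<le> norm q ^ (k\<^sup>2) * (C1 * C2)"
        using C1 C2 by (intro mult_right_mono) auto
      thus "norm (f k r) \<le> norm q ^ (k\<^sup>2) * (C1 * C2)" using fb[of k r] by linarith
    }
    show "(\<lambda>r. f k r) \<longlonglongrightarrow> g k"
    proof (cases "k = 0")
      case True
      have "(\<lambda>r. qpoch q (q\<^sup>2) r * rq (q\<^sup>2) (int (2 * r) + 0)) \<longlonglongrightarrow> qpoch_inf q (q\<^sup>2) * (1 / euler (q\<^sup>2))"
        using LIMSEQ_subseq_LIMSEQ[OF rq_LIMSEQ[OF Q, of 0], of "\<lambda>n. 2 * n"]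
        by (intro tendsto_mult qpoch_LIMSEQ Q) (simp add: strict_mono_def o_def)
      moreover have "f k = (\<lambda>r. qpoch q (q\<^sup>2) r * rq (q\<^sup>2) (int (2 * r) + 0))"
        using True by (simp add: f_def fun_eq_iff rq_def)
      ultimately show ?thesis using True by (simp add: g_def)
    next
      case False
      have "(\<lambda>r. norm q ^ r * (C1 * C2)) \<longlonglongrightarrow> 0 * (C1 * C2)"
        by (intro tendsto_intros LIMSEQ_realpow_zero) (use assms in auto)
      hence lim0: "(\<lambda>r. norm q ^ r * (C1 * C2)) \<longlonglongrightarrow> 0" by simp
      have "(\<lambda>r. f k r) \<longlonglongrightarrow> 0"
      proof (rule Lim_null_comparison[OF _ lim0], intro always_eventually allI)
        fix r
        have "r \<le> 2 * r * k" using False by (cases k) auto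
        hence "r \<le> k\<^sup>2 + 2 * r * k" by linarith
        hence "norm q ^ (k\<^sup>2 + 2 * r * k) \<le> norm q ^ r" using assms by (intro power_decreasing) auto
        hence "norm q ^ (k\<^sup>2 + 2 * r * k) * (C1 * C2) \<le> norm q ^ r * (C1 * C2)"
          using C1 C2 by (intro mult_right_mono) auto
        thus "norm (f k r) \<le> norm q ^ r * (C1 * C2)" using fb[of k r] by linarith
      qed
      thus ?thesis using False by (simp add: g_def)
    qed
  qed
  hence "(\<lambda>r::nat. Dc q 0) \<longlonglongrightarrow> (\<Sum>\<^sub>\<infinity>k. g k)" unfolding eq[symmetric] .
  hence "Dc q 0 = (\<Sum>\<^sub>\<infinity>k. g k)" using LIMSEQ_const_iff by blast
  also have "\<dots> = qpoch_inf q (q\<^sup>2) / euler (q\<^sup>2)"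
    by (rule infsumI, rule has_sum_finite_neutralI[of "{0}"]) (auto simp: g_def)
  finally show ?thesis .
qed

text \<open>Termwise, the difference of \<open>Dc q r\<close> and \<open>Dc q (r + 1)\<close> is a
  multiple of the summand of \<open>Dc'\<close>, and \<open>Dc_step\<close> evaluates the same
  difference. The common factor 1 + q^(2r+1) can be cancelled since 2r + 1 is odd, hence
  nonzero.\<close>

lemma Dc'_closed:
  assumes "q \<noteq> 0" "norm q < 1"
  shows "(1 - q powi (2 * r + 1)) * Dc' q r = (-1) powi r * q powi (r * r + 2 * r) * Dc q 0"
proof -
  define u v where "u = q powi (2 * r)" "v = q powi (- 2 * r)"
  have uv: "u * v = 1" using powi_add[OF assms(1), of "2 * r" "- 2 * r"] by (simp add: u_v_def)
  have u1: "q powi (2 * r + 1) = u * q" using assms by (simp add: u_v_def power_int_add)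
  have tm: "wt q n * (rq (q\<^sup>2) (int n - r) * rq (q\<^sup>2) (int n + r)) +
     - (wt q n * (rq (q\<^sup>2) (int n - (r + 1)) * rq (q\<^sup>2) (int n + (r + 1))))
     = v * (1 - u\<^sup>2 * q\<^sup>2) * (wt q n * (q ^ (2 * n) * (rq (q\<^sup>2) (int n - r) * rq (q\<^sup>2) (int n + r + 1))))" for n
  proof -
    define A B N where "A = rq (q\<^sup>2) (int n - r)" "B = rq (q\<^sup>2) (int n + r + 1)" "N = q ^ (2 * n)"
    note d = this
    have t: "rq (q\<^sup>2) (int n - r - 1) = (1 - N * v) * A" "rq (q\<^sup>2) (int n + r) = (1 - N * u * q\<^sup>2) * B"
      using Dc_terms[OF assms, of n r] by (simp_all add: d u_v_def)
    have i: "int n - (r + 1) = int n - r - 1" "int n + (r + 1) = int n + r + 1" by simp_all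
    have E: "v * (1 - u\<^sup>2 * q\<^sup>2) = v - u * q\<^sup>2" using uv by algebra
    show ?thesis unfolding i t d[symmetric] E by (simp add: algebra_simps)
  qed
  have "Dc q r - Dc q (r + 1) = v * (1 - u\<^sup>2 * q\<^sup>2) * Dc' q r"
    unfolding Dc'_def infsum_cmult_right'[symmetric] tm[symmetric] Dc_def
  proof -
    have s1: "(\<lambda>n. wt q n * (rq (q\<^sup>2) (int n - r) * rq (q\<^sup>2) (int n + r))) summable_on UNIV"
      using Dc_summable[OF assms(2), of "- r" "r"] by simp
    have s2: "(\<lambda>n. wt q n * (rq (q\<^sup>2) (int n - (r + 1)) * rq (q\<^sup>2) (int n + (r + 1)))) summable_on UNIV"
      using Dc_summable[OF assms(2), of "- (r + 1)" "r + 1"] by (simp only: add_uminus_conv_diff)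
    show "(\<Sum>\<^sub>\<infinity>n. wt q n * (rq (q\<^sup>2) (int n - r) * rq (q\<^sup>2) (int n + r))) -
      (\<Sum>\<^sub>\<infinity>n. wt q n * (rq (q\<^sup>2) (int n - (r + 1)) * rq (q\<^sup>2) (int n + (r + 1)))) =
      (\<Sum>\<^sub>\<infinity>n. wt q n * (rq (q\<^sup>2) (int n - r) * rq (q\<^sup>2) (int n + r)) +
     - (wt q n * (rq (q\<^sup>2) (int n - (r + 1)) * rq (q\<^sup>2) (int n + (r + 1)))))"
      using s1 s2 by (subst infsum_add) (auto simp: summable_on_uminus infsum_uminus)
  qed
  moreover have "Dc q r - Dc q (r + 1) = (1 + u * q) * Dc q r"
    unfolding Dc_step[OF assms] u1 by (simp add: algebra_simps)
  moreover have "v * (1 - u\<^sup>2 * q\<^sup>2) * Dc' q r = (1 + u * q) * (v * ((1 - u * q) * Dc' q r))"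
    by (simp add: algebra_simps power2_eq_square)
  ultimately have "(1 + u * q) * (v * ((1 - u * q) * Dc' q r)) = (1 + u * q) * Dc q r"
    by (simp only:)
  moreover have "1 + u * q \<noteq> 0"
  proof -
    have "2 * r + 1 \<noteq> 0" by presburger
    thus ?thesis using one_minus_powi_nonzero(2)[OF assms(2,1)] unfolding u1[symmetric] by blast
  qed
  ultimately have "v * ((1 - u * q) * Dc' q r) = Dc q r" by simp
  hence "(1 - u * q) * Dc' q r = u * Dc q r" using uv by (metis mult.assoc mult.left_commute mult_1)
  also have "\<dots> = (-1) powi r * (u * q powi (r * r)) * Dc q 0" unfolding Dc_closed[OF assms, of r] by simp
  also have "u * q powi (r * r) = q powi (r * r + 2 * r)"
    using powi_add[OF assms(1), of "r * r" "2 * r"] by (simp add: u_v_def)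
  finally show ?thesis unfolding u1 .
qed

subsection \<open>Hecke-type double sums\<close>

lemma summable_on_product:
  fixes g :: "'a \<Rightarrow> real" and h :: "'b \<Rightarrow> real"
  assumes "g summable_on A" "h summable_on B" "\<And>x. x \<in> A \<Longrightarrow> g x \<ge> 0" "\<And>y. y \<in> B \<Longrightarrow> h y \<ge> 0"
  shows "(\<lambda>(x, y). g x * h y) summable_on A \<times> B"
proof (rule summable_on_SigmaI[where g = "\<lambda>x. g x * infsum h B"])
  fix x assume "x \<in> A"
  have "(h has_sum infsum h B) B" using assms(2) by simp
  thus "((\<lambda>y. case (x, y) of (x, y) \<Rightarrow> g x * h y) has_sum g x * infsum h B) B"
    by (auto intro: has_sum_cmult_right)
qed (use assms in \<open>auto intro: summable_on_cmult_left\<close>)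

lemma summable_linear_theta:
  fixes a c :: real
  assumes "a > 0" "0 < c" "c < 1"
  shows "(\<lambda>m::int. (\<bar>of_int m\<bar> + 1) * (a powi m * c powi tri m)) summable_on UNIV"
proof (rule summable_on_comparison_test)
  \<comment> \<open>The linear factor is absorbed by |m| + 1 <= 2^|m| <= 2^m + 2^(-m), which leaves
    two ordinary theta series.\<close>
  show "(\<lambda>m::int. (2 * a) powi m * c powi tri m + (a / 2) powi m * c powi tri m) summable_on UNIV"
    by (intro summable_on_add summable_int_theta) (use assms in auto)
  fix m :: int
  have *: "real n + 1 \<le> 2 ^ n" for n by (induction n) auto
  have "\<bar>of_int m\<bar> + 1 \<le> (2::real) ^ nat \<bar>m\<bar>" using *[of "nat \<bar>m\<bar>"] by simp
  also have "\<dots> \<le> 2 powi m + (1/2) powi m"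
    by (cases "m \<ge> 0") (auto simp: power_int_def power_one_over inverse_eq_divide)
  finally have "(\<bar>of_int m\<bar> + 1) * (a powi m * c powi tri m) \<le> (2 powi m + (1/2) powi m) * (a powi m * c powi tri m)"
    using assms by (intro mult_right_mono) auto
  also have "\<dots> = (2 * a) powi m * c powi tri m + (a / 2) powi m * c powi tri m"
    by (simp add: power_int_mult_distrib power_int_divide_distrib algebra_simps power_int_1_left)
  finally show "(\<bar>of_int m\<bar> + 1) * (a powi m * c powi tri m) \<le> (2 * a) powi m * c powi tri m + (a / 2) powi m * c powi tri m" .
qed (use assms in auto)

lemma cS_norm_summable:
  assumes "q \<noteq> 0" "norm q < 1" "z \<noteq> 0"
  shows "(\<lambda>m. norm (z powi m * cS q m)) summable_on UNIV"
proof (rule summable_on_comparison_test)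
  show "(\<lambda>m::int. (\<bar>of_int m\<bar> + 1) * ((norm z * norm q) powi m * norm q powi tri m)) summable_on UNIV"
    by (rule summable_linear_theta) (use assms in auto)
  fix m
  have "tri (m + 1) = m + tri m" using tri_add[of m 1] by simp
  hence "norm (z powi m * cS q m) = (norm z * norm q) powi m * norm q powi tri m * norm (gs q m)"
    using assms by (simp add: cS_def norm_mult norm_powi power_int_add power_int_mult_distrib)
  also have "\<dots> \<le> (norm z * norm q) powi m * norm q powi tri m * (\<bar>of_int m\<bar> + 1)"
    by (intro mult_left_mono gs_bound assms) auto
  finally show "norm (z powi m * cS q m) \<le> (\<bar>of_int m\<bar> + 1) * ((norm z * norm q) powi m * norm q powi tri m)"
    by (simp only: mult_ac)
qed auto

lemma swap_sums:
  assumes "norm q < 1" "(\<lambda>m. norm (g m)) summable_on (UNIV :: int set)" "\<And>n m. norm (h n m) \<le> B"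
  shows "(\<Sum>\<^sub>\<infinity>n. \<Sum>\<^sub>\<infinity>m. wt q n * (g m * h n m)) = (\<Sum>\<^sub>\<infinity>m. g m * (\<Sum>\<^sub>\<infinity>n. wt q n * h n m))"
proof -
  obtain C where C: "C > 0" "\<And>n. norm (wt q n) \<le> C * norm q ^ (n\<^sup>2)" using wt_bounded assms by blast
  have "B \<ge> 0" using assms(3)[of 0 0] norm_ge_zero order_trans by blast
  have "(\<lambda>(n, m). (C * B * norm q ^ (n\<^sup>2)) * norm (g m)) summable_on UNIV \<times> UNIV"
    by (intro summable_on_product summable_on_cmult_right summable_power_sq) (use assms C \<open>B \<ge> 0\<close> in auto)
  hence "(\<lambda>(n, m). wt q n * (g m * h n m)) summable_on UNIV \<times> UNIV"
  proof (rule summable_on_norm_bound, clarify)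
    fix n m
    have "norm (wt q n) * norm (h n m) \<le> (C * norm q ^ (n\<^sup>2)) * B"
      using C assms(3)[of n m] \<open>B \<ge> 0\<close> by (intro mult_mono) auto
    hence "norm (wt q n) * norm (h n m) * norm (g m) \<le> (C * norm q ^ (n\<^sup>2)) * B * norm (g m)"
      by (intro mult_right_mono) auto
    thus "norm (wt q n * (g m * h n m)) \<le> C * B * norm q ^ n\<^sup>2 * norm (g m)"
      by (simp add: norm_mult mult_ac)
  qed
  hence "(\<Sum>\<^sub>\<infinity>n. \<Sum>\<^sub>\<infinity>m. wt q n * (g m * h n m)) = (\<Sum>\<^sub>\<infinity>m. \<Sum>\<^sub>\<infinity>n. wt q n * (g m * h n m))"
    by (rule infsum_swap_banach)
  also have "\<dots> = (\<Sum>\<^sub>\<infinity>m. g m * (\<Sum>\<^sub>\<infinity>n. wt q n * h n m))"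
    by (simp only: infsum_cmult_right'[symmetric] mult.left_commute)
  finally show ?thesis .
qed

text \<open>It follows from (-q; q)_k (q; q)_k = (q^2; q^2)_k and the parity splitting of (q;
  q)_(2k). The denominators of the mock theta functions become the factor (q; q^2)_n of
  \<open>wt\<close> times right-hand sides of \<open>cS_sums\<close> in base q^2.\<close>

lemma qpoch_double:
  assumes "norm q < 1" "q \<noteq> 0"
  shows "1 / qpoch (- q) q (2 * n) = qpoch q (q\<^sup>2) n * (qpoch (q\<^sup>2) (q\<^sup>2) n * rq (q\<^sup>2) (2 * int n))"
    and "1 / qpoch (- q) q (2 * n + 1) = qpoch q (q\<^sup>2) n * ((1 - q * q ^ (2 * n)) * (qpoch (q\<^sup>2) (q\<^sup>2) n * rq (q\<^sup>2) (2 * int n + 1)))"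
proof -
  have a: "qpoch (- q) q k * qpoch q q k = qpoch (q\<^sup>2) (q\<^sup>2) k" for k
    unfolding qpoch_def prod.distrib[symmetric]
    by (intro prod.cong refl) (simp add: algebra_simps power2_eq_square power_mult_distrib)
  have b: "qpoch q q (2 * k) = qpoch q (q\<^sup>2) k * qpoch (q\<^sup>2) (q\<^sup>2) k" for k
    by (induction k) (simp_all add: qpoch_Suc power_mult mult_ac power2_eq_square power_mult_distrib)
  have nz: "qpoch q q k \<noteq> 0" "qpoch (q\<^sup>2) (q\<^sup>2) k \<noteq> 0" "qpoch (- q) q k \<noteq> 0" for k
    using qpoch_nonzero[of q q k] qpoch_nonzero[of "q\<^sup>2" "q\<^sup>2" k] qpoch_nonzero[of q "-q" k]
      assms norm_sq_less_one[of q] by auto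
  have c: "1 / qpoch (- q) q k = qpoch q q k / qpoch (q\<^sup>2) (q\<^sup>2) k" for k
    using a[of k] nz by (simp add: field_simps)
  have r: "rq (q\<^sup>2) (int k) = 1 / qpoch (q\<^sup>2) (q\<^sup>2) k" for k by (simp add: rq_def)
  show "1 / qpoch (- q) q (2 * n) = qpoch q (q\<^sup>2) n * (qpoch (q\<^sup>2) (q\<^sup>2) n * rq (q\<^sup>2) (2 * int n))"
    unfolding c b using r[of "2 * n"] by simp
  have "qpoch q q (2 * n + 1) = qpoch q (q\<^sup>2) n * ((1 - q * q ^ (2 * n)) * qpoch (q\<^sup>2) (q\<^sup>2) n)"
  proof -
    have "qpoch q q (2 * n + 1) = qpoch q q (2 * n) * (1 - q ^ (2 * n) * q)"
      using qpoch_Suc[of q q "2 * n"] by simp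
    thus ?thesis unfolding b by (simp only: mult_ac)
  qed
  moreover have "rq (q\<^sup>2) (2 * int n + 1) = 1 / qpoch (q\<^sup>2) (q\<^sup>2) (2 * n + 1)"
    using r[of "2 * n + 1"] by (simp add: add.commute)
  ultimately show "1 / qpoch (- q) q (2 * n + 1) = qpoch q (q\<^sup>2) n * ((1 - q * q ^ (2 * n)) * (qpoch (q\<^sup>2) (q\<^sup>2) n * rq (q\<^sup>2) (2 * int n + 1)))"
    unfolding c by simp
qed

lemma cS_sq:
  assumes "q \<noteq> 0"
  shows "(-1) powi m * cS (q\<^sup>2) m = q powi (m * m + m) * gs (q\<^sup>2) m"
proof -
  have "2 * tri (m + 1) = m * m + m" using two_tri[of "m + 1"] by (simp add: algebra_simps)
  hence "(q\<^sup>2) powi tri (m + 1) = q powi (m * m + m)"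
    by (metis power_int_mult power_int_numeral)
  thus ?thesis by (simp add: cS_def flip: mult.assoc)
qed

definition hecke :: "complex \<Rightarrow> int \<Rightarrow> complex" where
  "hecke q b = (\<Sum>\<^sub>\<infinity>m. q powi (2 * m * m + b * m) * gs (q\<^sup>2) m)"

lemma suminf_eq_infsum:
  fixes f :: "nat \<Rightarrow> complex"
  assumes "f summable_on UNIV"
  shows "suminf f = infsum f UNIV"
  using assms by (metis has_sum_imp_sums has_sum_infsum sums_unique)

text \<open>Each term is \<open>wt\<close> times the third sum of \<open>cS_sums\<close>; after
  exchanging the summations the inner sum over n is \<open>Dc q m\<close>, and
  \<open>Dc_closed\<close> supplies the second Gaussian factor of the Hecke sum.\<close>

lemma mock_X_hecke_aux:
  assumes "q \<noteq> 0" "norm q < 1"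
  shows "mock_X q = Dc q 0 * hecke q 1"
proof -
  note Q = norm_sq_less_one[OF assms(2)]
  have Q0: "q\<^sup>2 \<noteq> 0" using assms by simp
  obtain B where B: "B > 0" "\<And>i j. norm (rq (q\<^sup>2) i * rq (q\<^sup>2) j) \<le> B"
    using rq_pair_bounded[OF Q] by blast
  have t: "(-1) ^ n * q ^ (n\<^sup>2) / qpoch (- q) q (2 * n)
     = wt q n * (qpoch (q\<^sup>2) (q\<^sup>2) n * rq (q\<^sup>2) (2 * int n))" for n
  proof -
    have "(-1) ^ n * q ^ (n\<^sup>2) / qpoch (- q) q (2 * n) = (-1) ^ n * q ^ (n\<^sup>2) * (1 / qpoch (- q) q (2 * n))"
      by simp
    thus ?thesis unfolding qpoch_double[OF assms(2,1)] wt_def by (simp only: mult_ac)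
  qed
  obtain C1 where C1: "C1 > 0" "\<And>n. norm (qpoch (q\<^sup>2) (q\<^sup>2) n) \<le> C1" using qpoch_bounded[OF Q] by blast
  obtain C2 where C2: "C2 > 0" "\<And>k. norm (rq (q\<^sup>2) k) \<le> C2" using rq_bounded[OF Q] by blast
  have "norm (qpoch (q\<^sup>2) (q\<^sup>2) n * rq (q\<^sup>2) (2 * int n)) \<le> C1 * C2" for n
    unfolding norm_mult using C1 C2 by (intro mult_mono) (auto intro: less_imp_le)
  hence "(\<lambda>n. wt q n * (qpoch (q\<^sup>2) (q\<^sup>2) n * rq (q\<^sup>2) (2 * int n))) summable_on UNIV"
    by (rule wt_summable[OF assms(2)])
  hence "mock_X q = (\<Sum>\<^sub>\<infinity>n. wt q n * (qpoch (q\<^sup>2) (q\<^sup>2) n * rq (q\<^sup>2) (2 * int n)))"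
    unfolding mock_X_def t by (rule suminf_eq_infsum)
  also have "\<dots> = (\<Sum>\<^sub>\<infinity>n. \<Sum>\<^sub>\<infinity>m. wt q n * (cS (q\<^sup>2) m * (rq (q\<^sup>2) (int n - m) * rq (q\<^sup>2) (int n + m))))"
    unfolding cS_sums(3)[OF Q0 Q, symmetric] infsum_cmult_right' ..
  also have "\<dots> = (\<Sum>\<^sub>\<infinity>m. cS (q\<^sup>2) m * Dc q m)"
    unfolding Dc_def using cS_norm_summable[OF Q0 Q, of 1] B
    by (intro swap_sums[OF assms(2)]) auto
  also have "\<dots> = (\<Sum>\<^sub>\<infinity>m. Dc q 0 * (q powi (2 * m * m + 1 * m) * gs (q\<^sup>2) m))"
  proof (rule infsum_cong)
    fix m
    have "cS (q\<^sup>2) m * Dc q m = q powi (m * m) * ((-1) powi m * cS (q\<^sup>2) m) * Dc q 0"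
      unfolding Dc_closed[OF assms, of m] by (simp only: mult_ac)
    also have "q powi (m * m) * ((-1) powi m * cS (q\<^sup>2) m) = (q powi (m * m) * q powi (m * m + m)) * gs (q\<^sup>2) m"
      unfolding cS_sq[OF assms(1)] by simp
    also have "q powi (m * m) * q powi (m * m + m) = q powi (2 * m * m + 1 * m)"
      by (rule powi_eqI[OF assms(1)]) simp
    finally show "cS (q\<^sup>2) m * Dc q m = Dc q 0 * (q powi (2 * m * m + 1 * m) * gs (q\<^sup>2) m)" by (simp only: mult_ac)
  qed
  finally show ?thesis unfolding hecke_def infsum_cmult_right' .
qed

text \<open>The factor 1 - q^(2n+1) is expanded by the first two sums of \<open>cS_sums\<close> and
  reappears as 1 - q^(2m+1) next to \<open>cS\<close>. This is exactly the factor that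
  \<open>Dc'_closed\<close> carries, so no denominator remains.\<close>

lemma mock_chi_hecke_aux:
  assumes "q \<noteq> 0" "norm q < 1"
  shows "mock_chi q = Dc q 0 * (q * hecke q 3)"
proof -
  note Q = norm_sq_less_one[OF assms(2)]
  have Q0: "q\<^sup>2 \<noteq> 0" using assms by simp
  obtain B where B: "B > 0" "\<And>i j. norm (rq (q\<^sup>2) i * rq (q\<^sup>2) j) \<le> B"
    using rq_pair_bounded[OF Q] by blast
  let ?b = "\<lambda>n. q ^ (2 * n) * ((1 - q * q ^ (2 * n)) * (qpoch (q\<^sup>2) (q\<^sup>2) n * rq (q\<^sup>2) (2 * int n + 1)))"
  have t: "(-1) ^ n * q ^ ((n + 1)\<^sup>2) / qpoch (- q) q (2 * n + 1) = wt q n * (q * ?b n)" for n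
  proof -
    have "(n + 1)\<^sup>2 = n\<^sup>2 + 2 * n + 1" by (simp add: power2_eq_square)
    hence "(-1) ^ n * q ^ ((n + 1)\<^sup>2) / qpoch (- q) q (2 * n + 1) = (-1) ^ n * (q ^ (n\<^sup>2) * q ^ (2 * n) * q) * (1 / qpoch (- q) q (2 * n + 1))"
      by (simp add: power_add)
    thus ?thesis unfolding qpoch_double[OF assms(2,1)] wt_def by (simp only: mult_ac)
  qed
  obtain C1 where C1: "C1 > 0" "\<And>n. norm (qpoch (q\<^sup>2) (q\<^sup>2) n) \<le> C1" using qpoch_bounded[OF Q] by blast
  obtain C2 where C2: "C2 > 0" "\<And>k. norm (rq (q\<^sup>2) k) \<le> C2" using rq_bounded[OF Q] by blast
  have q1: "norm (q ^ k) \<le> 1" for k using assms by (simp add: norm_power power_le_one)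
  have q2: "norm (1 - q * q ^ k) \<le> 2" for k
    using norm_triangle_ineq4[of 1 "q * q ^ k"] q1[of "Suc k"] by simp
  have "norm (q * ?b n) \<le> 1 * (1 * (2 * (C1 * C2)))" for n
    unfolding norm_mult using C1 C2 q1[of 1] q1[of "2 * n"] q2[of "2 * n"]
    by (intro mult_mono) (auto intro: less_imp_le simp: norm_power)
  hence "(\<lambda>n. wt q n * (q * ?b n)) summable_on UNIV"
    by (rule wt_summable[OF assms(2)])
  hence "mock_chi q = (\<Sum>\<^sub>\<infinity>n. wt q n * (q * ?b n))"
    unfolding mock_chi_def t by (rule suminf_eq_infsum)
  also have "\<dots> = q * (\<Sum>\<^sub>\<infinity>n. wt q n * ?b n)"
    by (simp only: infsum_cmult_right'[symmetric] mult.left_commute)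
  also have "(\<Sum>\<^sub>\<infinity>n. wt q n * ?b n) = (\<Sum>\<^sub>\<infinity>n. \<Sum>\<^sub>\<infinity>m. wt q n * ((1 - q powi (2 * m + 1)) * cS (q\<^sup>2) m * (q ^ (2 * n) * (rq (q\<^sup>2) (int n - m) * rq (q\<^sup>2) (int n + m + 1)))))"
  proof (rule infsum_cong)
    fix n
    let ?R = "\<lambda>m. rq (q\<^sup>2) (int n - m) * rq (q\<^sup>2) (int n + m + 1)"
    have s: "(\<lambda>m. g m * ?R m) summable_on UNIV" for g by (rule rq_pair_summable)
    have "(1 - q * q ^ (2 * n)) * (qpoch (q\<^sup>2) (q\<^sup>2) n * rq (q\<^sup>2) (2 * int n + 1)) =
       qpoch (q\<^sup>2) (q\<^sup>2) n * rq (q\<^sup>2) (2 * int n + 1) + (- q) * ((q\<^sup>2) ^ n * (qpoch (q\<^sup>2) (q\<^sup>2) n * rq (q\<^sup>2) (2 * int n + 1)))"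
    proof -
      have "(q\<^sup>2) ^ n = q ^ (2 * n)" by (simp add: power_mult)
      thus ?thesis by (simp only:) (simp add: algebra_simps)
    qed
    also have "\<dots> = (\<Sum>\<^sub>\<infinity>m. cS (q\<^sup>2) m * ?R m + (- q) * ((q\<^sup>2) powi m * cS (q\<^sup>2) m * ?R m))"
      unfolding cS_sums(2)[OF Q0 Q, symmetric]
      unfolding cS_sums(1)[OF Q0 Q, symmetric] infsum_cmult_right'[symmetric]
      by (rule infsum_add[symmetric]) (intro s summable_on_cmult_right)+
    also have "\<dots> = (\<Sum>\<^sub>\<infinity>m. (1 - q powi (2 * m + 1)) * cS (q\<^sup>2) m * ?R m)"
    proof (rule infsum_cong)
      fix m
      have "(q\<^sup>2) powi m = q powi (2 * m)" by (simp add: power_int_mult)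
      hence "q powi (2 * m + 1) = q * (q\<^sup>2) powi m" using assms by (simp add: power_int_add)
      thus "cS (q\<^sup>2) m * ?R m + (- q) * ((q\<^sup>2) powi m * cS (q\<^sup>2) m * ?R m) = (1 - q powi (2 * m + 1)) * cS (q\<^sup>2) m * ?R m"
        by (simp add: algebra_simps)
    qed
    finally have "(1 - q * q ^ (2 * n)) * (qpoch (q\<^sup>2) (q\<^sup>2) n * rq (q\<^sup>2) (2 * int n + 1)) = (\<Sum>\<^sub>\<infinity>m. (1 - q powi (2 * m + 1)) * cS (q\<^sup>2) m * ?R m)" .
    thus "wt q n * ?b n = (\<Sum>\<^sub>\<infinity>m. wt q n * ((1 - q powi (2 * m + 1)) * cS (q\<^sup>2) m * (q ^ (2 * n) * ?R m)))"
      by (simp only: infsum_cmult_right'[symmetric] mult.left_commute)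
  qed
  also have "\<dots> = (\<Sum>\<^sub>\<infinity>m. (1 - q powi (2 * m + 1)) * cS (q\<^sup>2) m * Dc' q m)"
    unfolding Dc'_def
  proof (rule swap_sums[OF assms(2)])
    show "norm (q ^ (2 * n) * (rq (q\<^sup>2) (int n - m) * rq (q\<^sup>2) (int n + m + 1))) \<le> 1 * B" for n m
      unfolding norm_mult[of "q ^ (2 * n)"] using B q1[of "2 * n"] by (intro mult_mono) auto
    have "(\<lambda>m. norm (1 powi m * cS (q\<^sup>2) m) + norm q * norm ((q\<^sup>2) powi m * cS (q\<^sup>2) m)) summable_on UNIV"
      by (intro summable_on_add summable_on_cmult_right cS_norm_summable Q Q0) (use assms in auto)
    thus "(\<lambda>m. norm ((1 - q powi (2 * m + 1)) * cS (q\<^sup>2) m)) summable_on UNIV"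
    proof (rule summable_on_comparison_test)
      fix m
      have "(q\<^sup>2) powi m = q powi (2 * m)" by (simp add: power_int_mult)
      hence e: "q powi (2 * m + 1) = q * (q\<^sup>2) powi m" using assms by (simp add: power_int_add)
      have "norm ((1 - q powi (2 * m + 1)) * cS (q\<^sup>2) m) = norm (1 powi m * cS (q\<^sup>2) m - q * ((q\<^sup>2) powi m * cS (q\<^sup>2) m))"
        unfolding e by (simp add: algebra_simps)
      also have "\<dots> \<le> norm (1 powi m * cS (q\<^sup>2) m) + norm (q * ((q\<^sup>2) powi m * cS (q\<^sup>2) m))"
        by (rule norm_triangle_ineq4)
      finally show "norm ((1 - q powi (2 * m + 1)) * cS (q\<^sup>2) m) \<le> norm (1 powi m * cS (q\<^sup>2) m) + norm q * norm ((q\<^sup>2) powi m * cS (q\<^sup>2) m)"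
        by (simp add: norm_mult)
    qed auto
  qed
  also have "\<dots> = (\<Sum>\<^sub>\<infinity>m. Dc q 0 * (q powi (2 * m * m + 3 * m) * gs (q\<^sup>2) m))"
  proof (rule infsum_cong)
    fix m
    have "(1 - q powi (2 * m + 1)) * cS (q\<^sup>2) m * Dc' q m = cS (q\<^sup>2) m * ((1 - q powi (2 * m + 1)) * Dc' q m)"
      by (simp only: mult_ac)
    also have "\<dots> = q powi (m * m + 2 * m) * ((-1) powi m * cS (q\<^sup>2) m) * Dc q 0"
      unfolding Dc'_closed[OF assms, of m] by (simp only: mult_ac)
    also have "q powi (m * m + 2 * m) * ((-1) powi m * cS (q\<^sup>2) m) = (q powi (m * m + 2 * m) * q powi (m * m + m)) * gs (q\<^sup>2) m"
      unfolding cS_sq[OF assms(1)] by simp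
    also have "q powi (m * m + 2 * m) * q powi (m * m + m) = q powi (2 * m * m + 3 * m)"
      by (rule powi_eqI[OF assms(1)]) simp
    finally show "(1 - q powi (2 * m + 1)) * cS (q\<^sup>2) m * Dc' q m = Dc q 0 * (q powi (2 * m * m + 3 * m) * gs (q\<^sup>2) m)" by (simp only: mult_ac)
  qed
  finally show ?thesis unfolding hecke_def infsum_cmult_right' by (simp only: mult_ac)
qed

section \<open>The theta function that clears the prefactor of the Hecke sums\<close>

definition psi :: "complex \<Rightarrow> complex" where
  "psi q = jtheta (- q) (q ^ 4)"

text \<open>Splitting the products by parity shows \<open>psi q\<close> to be (q^2; q^2) / (q; q^2),
  the reciprocal of the constant found in \<open>Dc_limit\<close>.\<close>

lemma psi_product:
  assumes "q \<noteq> 0" "norm q < 1"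
  shows "psi q * qpoch_inf q (q\<^sup>2) = euler (q\<^sup>2)"
proof -
  note Q = norm_sq_less_one[OF assms(2)]
  have prod2: "(\<Prod>i<2. f i) = f 0 * f (Suc 0)" for f :: "nat \<Rightarrow> complex" by (simp add: numeral_2_eq_2)
  have e4: "(q\<^sup>2)\<^sup>2 = q ^ 4" "q\<^sup>2 * q\<^sup>2 = q ^ 4" by (simp_all add: eval_nat_numeral)
  have "q ^ 4 / (- q) = (- q) * q\<^sup>2" using assms by (simp add: eval_nat_numeral)
  moreover have "qpoch_inf (- q) (q\<^sup>2) = qpoch_inf (- q) (q ^ 4) * qpoch_inf ((- q) * q\<^sup>2) (q ^ 4)"
    using qpoch_inf_split[OF Q, of 2 "- q"] unfolding prod2 e4 by simp
  moreover have "euler (q\<^sup>2) = qpoch_inf (q\<^sup>2) (q ^ 4) * qpoch_inf (q ^ 4) (q ^ 4)"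
    using qpoch_inf_split[OF Q, of 2 "q\<^sup>2"] unfolding prod2 by (simp add: e4)
  moreover have "qpoch_inf q (q\<^sup>2) * qpoch_inf (- q) (q\<^sup>2) = qpoch_inf (q\<^sup>2) (q ^ 4)"
    using qpoch_inf_minus[OF Q, of q] unfolding e4 .
  ultimately show ?thesis by (simp add: psi_def jtheta_def mult_ac)
qed

lemma qpoch_inf_odd_nonzero:
  assumes "norm q < 1"
  shows "qpoch_inf q (q\<^sup>2) \<noteq> 0" "euler (q\<^sup>2) \<noteq> 0"
  using qpoch_inf_nonzero'[OF norm_sq_less_one[OF assms]] assms norm_sq_less_one[OF assms] by auto

lemma psi_nonzero: "q \<noteq> 0 \<Longrightarrow> norm q < 1 \<Longrightarrow> psi q \<noteq> 0"
  using psi_product[of q] qpoch_inf_odd_nonzero(2)[of q] by auto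

lemma Dc_psi:
  assumes "q \<noteq> 0" "norm q < 1"
  shows "psi q * Dc q 0 = 1"
  using psi_product[OF assms] qpoch_inf_odd_nonzero[OF assms(2)] unfolding Dc_limit[OF assms] by simp

lemma mock_X_hecke:
  assumes "q \<noteq> 0" "norm q < 1"
  shows "psi q * mock_X q = hecke q 1"
  using mock_X_hecke_aux[OF assms] Dc_psi[OF assms] by (metis mult.assoc mult_1)

lemma mock_chi_hecke:
  assumes "q \<noteq> 0" "norm q < 1"
  shows "psi q * mock_chi q = q * hecke q 3"
  using mock_chi_hecke_aux[OF assms] Dc_psi[OF assms] by (metis mult.assoc mult_1)

subsection \<open>An Appell-type expansion of the double sum\<close>

lemma cube_root:
  assumes "1 + w + w\<^sup>2 = (0 :: complex)"
  shows "w ^ 3 = 1" "w \<noteq> 0" "w \<noteq> 1" "norm w = 1"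
proof -
  have "w ^ 3 - 1 = (w - 1) * (1 + w + w\<^sup>2)" by (simp add: algebra_simps eval_nat_numeral)
  thus w3: "w ^ 3 = 1" using assms by simp
  show "w \<noteq> 0" "w \<noteq> 1" using assms by auto
  have "norm w ^ 3 = 1" using w3 by (metis norm_one norm_power)
  thus "norm w = 1" using power_eq_imp_eq_base[of "norm w" 3 1] by simp
qed

lemma cube_root_powi:
  assumes "1 + w + w\<^sup>2 = (0 :: complex)" "3 dvd (i - j)"
  shows "w powi i = w powi j"
proof -
  obtain k where k: "i = 3 * k + j" using assms(2) by (metis dvd_def diff_add_cancel add.commute)
  show ?thesis unfolding k using cube_root[OF assms(1)]
    by (simp add: power_int_add power_int_mult)
qed

lemma root_filter:
  assumes "1 + w + w\<^sup>2 = (0 :: complex)"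
  shows "1 + w powi j + w powi (2 * j) = (if 3 dvd j then 3 else 0)"
proof -
  have "3 dvd j \<or> 3 dvd (j - 1) \<or> 3 dvd (j - 2)" by presburger
  then consider "3 dvd j" | "3 dvd (j - 1)" | "3 dvd (j - 2)" by blast
  thus ?thesis
  proof cases
    case 1
    hence "w powi j = w powi 0" "w powi (2 * j) = w powi 0" by (intro cube_root_powi[OF assms]; presburger)+
    thus ?thesis using 1 by simp
  next
    case 2
    hence "w powi j = w powi 1" "w powi (2 * j) = w powi 2" "\<not> 3 dvd j"
      by ((intro cube_root_powi[OF assms])?; presburger)+
    thus ?thesis using assms by simp
  next
    case 3
    hence "w powi j = w powi 2" "w powi (2 * j) = w powi 1" "\<not> 3 dvd j"
      by ((intro cube_root_powi[OF assms])?; presburger)+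
    thus ?thesis using assms by (simp add: add_ac)
  qed
qed

lemma minus_one_powi_one_minus: "(-1) powi (1 - r) = - ((-1) powi r :: complex)"
  using power_int_minus_one_diff_commute[of 1 r, where 'a = complex]
    power_int_add[of "-1 :: complex" "r - 1" 1] by simp

definition Gw :: "complex \<Rightarrow> int \<Rightarrow> complex" where
  "Gw w j = (w powi j - w powi (1 - j)) / (1 - w)"

lemma Gw_reflect: "Gw w (1 - j) = - Gw w j"
  by (simp add: Gw_def minus_divide_left)

lemma Gw_values:
  assumes "1 + w + w\<^sup>2 = 0"
  shows "Gw w 0 = 1" "3 dvd (j - 2) \<Longrightarrow> Gw w j = 0"
proof -
  show "Gw w 0 = 1" using cube_root[OF assms] by (simp add: Gw_def)
  assume "3 dvd (j - 2)"
  hence "w powi j = w powi (1 - j)" by (intro cube_root_powi[OF assms]) presburger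
  thus "Gw w j = 0" by (simp add: Gw_def)
qed

lemma Gw_bound:
  assumes "1 + w + w\<^sup>2 = 0"
  shows "norm (Gw w j) \<le> 2 / norm (1 - w)"
proof -
  have "norm (w powi j - w powi (1 - j)) \<le> 1 + 1"
    using norm_triangle_ineq4[of "w powi j" "w powi (1 - j)"] cube_root(4)[OF assms] by (simp add: norm_powi)
  thus ?thesis unfolding Gw_def norm_divide by (intro divide_right_mono) auto
qed

text \<open>
  If \<open>1 + w + w^2 = 0\<close>, then \<open>Gw w\<close> has period 3 and takes the values 1, -1, 0 at 0, 1, 2. In \<open>mk\<close> the
  half line is chosen so that \<open>(r - 1) * k\<close> is nonnegative, as in the geometric expansion of an Appell series.
\<close>

definition tm :: "complex \<Rightarrow> complex \<Rightarrow> int \<Rightarrow> int \<Rightarrow> complex" where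
  "tm w q r k = (-1) powi r * Gw w (r + k) * q powi (5 * tri r + 5 * ((r - 1) * k))"

definition mk :: "complex \<Rightarrow> complex \<Rightarrow> int \<Rightarrow> complex" where
  "mk w q k = (if k \<ge> 0 then \<Sum>\<^sub>\<infinity>r\<in>{1..}. tm w q r k else - (\<Sum>\<^sub>\<infinity>r\<in>{..0}. tm w q r k))"

definition tmb :: "complex \<Rightarrow> complex \<Rightarrow> int \<Rightarrow> real" where
  "tmb w q r = 2 / norm (1 - w) * norm q powi (5 * tri r)"

lemma tmb_summable:
  assumes "q \<noteq> 0" "norm q < 1"
  shows "tmb w q summable_on A"
proof -
  have "(\<lambda>r. 2 / norm (1 - w) * (1 powi r * (norm q ^ 5) powi tri r)) summable_on UNIV"
    by (intro summable_on_cmult_right summable_int_theta) (use assms in \<open>auto simp: power_less_one_iff\<close>)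
  hence "tmb w q summable_on UNIV"
    by (simp add: tmb_def[abs_def] power_int_power)
  thus ?thesis by (rule summable_on_subset_banach) auto
qed

lemma tmb_nonneg: "tmb w q r \<ge> 0" by (simp add: tmb_def)

lemma tm_bound:
  assumes "q \<noteq> 0" "norm q < 1" "1 + w + w\<^sup>2 = 0" "5 * ((r - 1) * k) \<ge> d"
  shows "norm (tm w q r k) \<le> tmb w q r * norm q powi d"
proof -
  have "norm (tm w q r k) = norm (Gw w (r + k)) * (norm q powi (5 * tri r) * norm q powi (5 * ((r - 1) * k)))"
    using assms by (simp add: tm_def norm_mult norm_powi power_int_add)
  also have "\<dots> \<le> 2 / norm (1 - w) * (norm q powi (5 * tri r) * norm q powi d)"
    using assms by (intro mult_mono Gw_bound mult_left_mono power_int_decreasing) auto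
  finally show ?thesis by (simp add: tmb_def)
qed

lemma tm_summable:
  assumes "q \<noteq> 0" "norm q < 1" "1 + w + w\<^sup>2 = 0" "\<And>r. r \<in> A \<Longrightarrow> (r - 1) * k \<ge> 0"
  shows "(\<lambda>r. tm w q r k) summable_on A"
proof (rule summable_on_norm_bound[OF tmb_summable[OF assms(1,2)]])
  fix r assume "r \<in> A"
  hence "5 * ((r - 1) * k) \<ge> 0" using assms(4)[of r] by simp
  from tm_bound[OF assms(1-3) this] show "norm (tm w q r k) \<le> tmb w q r" by simp
qed

lemma infsum_norm_le:
  assumes "g summable_on A" "\<And>x. x \<in> A \<Longrightarrow> norm (f x :: complex) \<le> g x"
  shows "norm (infsum f A) \<le> infsum g A"
proof -
  have a: "(\<lambda>x. norm (f x)) summable_on A"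
    using Infinite_Sum.abs_summable_on_comparison_test'[OF assms] .
  have "norm (infsum f A) \<le> infsum (\<lambda>x. norm (f x)) A"
    using norm_infsum_bound[of f A] a by simp
  also have "\<dots> \<le> infsum g A" by (rule infsum_mono[OF a assms(1)]) (rule assms(2))
  finally show ?thesis .
qed

text \<open>For k < 0 and r <= 0 one has (r - 1) k >= -k, which gains the power q^(-5k). The gain
  outweighs the growth of \<open>q powi k\<close> in \<open>appell\<close> on the negative
  side.\<close>

lemma mk_bound:
  assumes "q \<noteq> 0" "norm q < 1" "1 + w + w\<^sup>2 = 0"
  defines "M \<equiv> infsum (tmb w q) UNIV"
  shows "norm (mk w q k) \<le> M" "k < 0 \<Longrightarrow> norm (mk w q k) \<le> M * norm q powi (- 5 * k)"
proof -
  have Mle: "infsum (tmb w q) A \<le> M" for A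
    unfolding M_def by (rule infsum_mono2) (auto intro: tmb_summable[OF assms(1,2)] tmb_nonneg)
  have neg: "norm (mk w q k) \<le> M * norm q powi (- 5 * k)" if "k < 0"
  proof -
    have "norm (\<Sum>\<^sub>\<infinity>r\<in>{..0}. tm w q r k) \<le> (\<Sum>\<^sub>\<infinity>r\<in>{..0}. tmb w q r * norm q powi (- 5 * k))"
    proof (rule infsum_norm_le)
      show "(\<lambda>r. tmb w q r * norm q powi (- 5 * k)) summable_on {..0}"
        by (intro summable_on_cmult_left tmb_summable assms(1,2))
      fix r :: int assume "r \<in> {..0}"
      hence "r * k \<ge> 0" using that by (simp add: mult_nonpos_nonpos)
      hence "5 * ((r - 1) * k) \<ge> - 5 * k" by (simp add: algebra_simps)
      thus "norm (tm w q r k) \<le> tmb w q r * norm q powi (- 5 * k)" by (rule tm_bound[OF assms(1-3)])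
    qed
    also have "\<dots> = (\<Sum>\<^sub>\<infinity>r\<in>{..0}. tmb w q r) * norm q powi (- 5 * k)" by (rule infsum_cmult_left')
    also have "\<dots> \<le> M * norm q powi (- 5 * k)" by (intro mult_right_mono Mle) auto
    finally show ?thesis using that by (simp add: mk_def)
  qed
  thus "k < 0 \<Longrightarrow> norm (mk w q k) \<le> M * norm q powi (- 5 * k)" .
  show "norm (mk w q k) \<le> M"
  proof (cases "k < 0")
    case True
    have "norm q powi (- 5 * k) \<le> 1" using True assms by (intro power_int_le_one) auto
    moreover have "M \<ge> 0" unfolding M_def by (intro infsum_nonneg tmb_nonneg)
    ultimately have "M * norm q powi (- 5 * k) \<le> M" by (simp add: mult_left_le)
    thus ?thesis using neg[OF True] by linarith
  next
    case False
    have "norm (\<Sum>\<^sub>\<infinity>r\<in>{1..}. tm w q r k) \<le> (\<Sum>\<^sub>\<infinity>r\<in>{1..}. tmb w q r)"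
    proof (rule infsum_norm_le[OF tmb_summable[OF assms(1,2)]])
      fix r :: int assume "r \<in> {1..}"
      hence "5 * ((r - 1) * k) \<ge> 0" using False by simp
      from tm_bound[OF assms(1-3) this] show "norm (tm w q r k) \<le> tmb w q r" by simp
    qed
    also have "\<dots> \<le> M" by (rule Mle)
    finally show ?thesis using False by (simp add: mk_def)
  qed
qed

text \<open>The move (r, k) -> (r - 1, k + 1) preserves r + k and hence the periodic coefficient;
  only the sign and the power of q change.\<close>

lemma tm_shift:
  assumes "q \<noteq> 0"
  shows "tm w q r k = - (q powi (5 * k + 5) * tm w q (r - 1) (k + 1))"
proof -
  have "tri r = tri (r - 1) + (r - 1)" using tri_add[of "r - 1" 1] by simp
  hence "5 * k + 5 + (5 * tri (r - 1) + 5 * ((r - 1 - 1) * (k + 1))) = 5 * tri r + 5 * ((r - 1) * k)"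
    by (simp add: algebra_simps)
  hence "q powi (5 * k + 5) * q powi (5 * tri (r - 1) + 5 * ((r - 1 - 1) * (k + 1))) = q powi (5 * tri r + 5 * ((r - 1) * k))"
    by (rule powi_eqI[OF assms])
  moreover have "(-1) powi r = - ((-1) powi (r - 1) :: complex)"
    using power_int_add[of "-1 :: complex" "r - 1" 1] by simp
  moreover have "r - 1 + (k + 1) = r + k" by simp
  ultimately show ?thesis unfolding tm_def by (simp add: mult_ac)
qed

lemma infsum_remove_head:
  fixes f :: "int \<Rightarrow> complex"
  assumes "f summable_on {a..}"
  shows "(\<Sum>\<^sub>\<infinity>r\<in>{a..}. f r) = f a + (\<Sum>\<^sub>\<infinity>r\<in>{a..}. f (r + 1))"
proof -
  have "{a..} = insert a {a+1..}" by auto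
  moreover have "f summable_on {a+1..}" by (rule summable_on_subset_banach[OF assms]) auto
  moreover have "(\<Sum>\<^sub>\<infinity>r\<in>{a+1..}. f r) = (\<Sum>\<^sub>\<infinity>r\<in>{a..}. f (r + 1))"
    by (rule infsum_reindex_bij_witness[of _ "\<lambda>r. r + 1" "\<lambda>r. r - 1"]) auto
  ultimately show ?thesis using infsum_insert[of f "{a+1..}" a] by auto
qed

lemma infsum_remove_last:
  fixes f :: "int \<Rightarrow> complex"
  assumes "f summable_on {..a}"
  shows "(\<Sum>\<^sub>\<infinity>r\<in>{..a}. f r) = f a + (\<Sum>\<^sub>\<infinity>r\<in>{..a}. f (r - 1))"
proof -
  have "{..a} = insert a {..a-1}" by auto
  moreover have "f summable_on {..a-1}" by (rule summable_on_subset_banach[OF assms]) auto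
  moreover have "(\<Sum>\<^sub>\<infinity>r\<in>{..a-1}. f r) = (\<Sum>\<^sub>\<infinity>r\<in>{..a}. f (r - 1))"
    by (rule infsum_reindex_bij_witness[of _ "\<lambda>r. r - 1" "\<lambda>r. r + 1"]) auto
  ultimately show ?thesis using infsum_insert[of f "{..a-1}" a] by auto
qed

text \<open>At k = 0 the terms combine the triple-product series at w and w^2 in base q^5, and
  \<open>jtheta_unity_root\<close> makes both of these multiples of (q^15; q^15). The involution r
  -> 1 - r fixes the terms, so each half line carries half of the total.\<close>

lemma tm_total:
  assumes "q \<noteq> 0" "norm q < 1" "1 + w + w\<^sup>2 = 0"
  shows "(\<Sum>\<^sub>\<infinity>r. tm w q r 0) = 2 * euler (q ^ 15)"
    and "mk w q 0 = euler (q ^ 15)"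
    and "(\<Sum>\<^sub>\<infinity>r\<in>{..0}. tm w q r 0) = euler (q ^ 15)"
proof -
  note w = cube_root[OF assms(3)]
  have wi: "w\<^sup>2 = w powi (-1)" "inverse w = w\<^sup>2"
    using w by (simp_all add: field_simps eval_nat_numeral)
  have w2: "1 + w\<^sup>2 + (w\<^sup>2)\<^sup>2 = 0" using assms(3) by algebra
  have p: "norm (q ^ 5) < 1" "q ^ 5 \<noteq> 0" using assms by (auto simp: norm_power power_less_one_iff)
  have p3: "(q ^ 5) ^ 3 = q ^ 15" by (simp flip: power_mult)
  have h1: "((\<lambda>r. (-w) powi r * (q ^ 5) powi tri r) has_sum (1 - w) * euler (q ^ 15)) UNIV"
    using jacobi_triple_product[OF w(2) p(2,1)] jtheta_unity_root[OF p assms(3)] p3 by simp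
  have h2: "((\<lambda>r. (-(w\<^sup>2)) powi r * (q ^ 5) powi tri r) has_sum (1 - w\<^sup>2) * euler (q ^ 15)) UNIV"
    using jacobi_triple_product[OF _ p(2,1), of "w\<^sup>2"] jtheta_unity_root[OF p w2] p3 w(2) by simp
  define u where "u = 1 / (1 - w)"
  have u: "u * (1 - w) = 1" using w(3) by (simp add: u_def)
  have "((\<lambda>r. u * ((-w) powi r * (q ^ 5) powi tri r) + (- w * u) * ((-(w\<^sup>2)) powi r * (q ^ 5) powi tri r)) has_sum
      u * ((1 - w) * euler (q ^ 15)) + (- w * u) * ((1 - w\<^sup>2) * euler (q ^ 15))) UNIV"
    by (intro has_sum_add has_sum_cmult_right h1 h2)
  also have "(\<lambda>r. u * ((-w) powi r * (q ^ 5) powi tri r) + (- w * u) * ((-(w\<^sup>2)) powi r * (q ^ 5) powi tri r)) = (\<lambda>r. tm w q r 0)"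
  proof
    fix r
    have a: "(-w) powi r = (-1) powi r * w powi r"
      using power_int_mult_distrib[of "-1" w r] by simp
    have b: "(-(w\<^sup>2)) powi r = (-1) powi r * (w\<^sup>2) powi r"
      using power_int_mult_distrib[of "-1" "w\<^sup>2" r] by simp
    have "(w\<^sup>2) powi r = w powi (- r)" unfolding wi(1) by (simp only: power_int_mult[symmetric]) simp
    hence c: "(w\<^sup>2) powi r * w = w powi (1 - r)"
      using powi_eqI[OF w(2), of "- r" 1 "1 - r"] by simp
    have d: "(q ^ 5) powi tri r = q powi (5 * tri r)" by (simp add: power_int_power)
    have "u * ((-w) powi r * (q ^ 5) powi tri r) + (- w * u) * ((-(w\<^sup>2)) powi r * (q ^ 5) powi tri r)
      = (-1) powi r * ((w powi r - (w\<^sup>2) powi r * w) * u) * q powi (5 * tri r)"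
      unfolding a b d by (simp add: algebra_simps)
    thus "u * ((-w) powi r * (q ^ 5) powi tri r) + (- w * u) * ((-(w\<^sup>2)) powi r * (q ^ 5) powi tri r) = tm w q r 0"
      unfolding c by (simp add: tm_def Gw_def u_def)
  qed
  also have "u * ((1 - w) * euler (q ^ 15)) + (- w * u) * ((1 - w\<^sup>2) * euler (q ^ 15)) = 2 * euler (q ^ 15)"
  proof -
    have "- w * (1 - w\<^sup>2) = 1 - w" using w(1) by (simp add: algebra_simps eval_nat_numeral)
    hence "(- w * u) * ((1 - w\<^sup>2) * euler (q ^ 15)) = u * (1 - w) * euler (q ^ 15)"
      by (metis mult.assoc mult.commute)
    thus ?thesis using u by (simp flip: mult.assoc)
  qed
  finally have "((\<lambda>r. tm w q r 0) has_sum 2 * euler (q ^ 15)) UNIV" .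
  thus T: "(\<Sum>\<^sub>\<infinity>r. tm w q r 0) = 2 * euler (q ^ 15)" by (rule infsumI)
  have sm: "(\<lambda>r. tm w q r 0) summable_on A" for A
    by (rule tm_summable[OF assms]) auto
  have "(\<Sum>\<^sub>\<infinity>r\<in>{..0}. tm w q r 0) = (\<Sum>\<^sub>\<infinity>r\<in>{1..}. tm w q r 0)"
  proof (rule infsum_reindex_bij_witness[of _ "\<lambda>r. 1 - r" "\<lambda>r. 1 - r"])
    fix r :: int
    have "tri (1 - r) = tri r" using tri_add[of 1 "-r"] tri_neg[of r] by simp
    moreover have "(-1) powi (1 - r) = - ((-1) powi r :: complex)" by (rule minus_one_powi_one_minus)
    ultimately show "tm w q (1 - r) 0 = tm w q r 0" using Gw_reflect[of w r] by (simp add: tm_def)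
  qed auto
  moreover have "(\<Sum>\<^sub>\<infinity>r\<in>{..0} \<union> {1..}. tm w q r 0) = (\<Sum>\<^sub>\<infinity>r\<in>{..0}. tm w q r 0) + (\<Sum>\<^sub>\<infinity>r\<in>{1..}. tm w q r 0)"
    by (rule infsum_Un_disjoint) (auto intro: sm)
  moreover have "{..0} \<union> {1..} = (UNIV :: int set)" by auto
  ultimately show "mk w q 0 = euler (q ^ 15)" "(\<Sum>\<^sub>\<infinity>r\<in>{..0}. tm w q r 0) = euler (q ^ 15)"
    using T by (simp_all add: mk_def)
qed

text \<open>By \<open>tm_shift\<close> the half line moves by one place, and the term gained or lost
  is the \<open>Gw\<close> contribution. Between k = -1 and k + 1 = 0 the definition passes from r
  <= 0 to r >= 1; the full bilateral sum of \<open>tm_total\<close> compensates for the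
  switch.\<close>

lemma mk_rec:
  assumes "q \<noteq> 0" "norm q < 1" "1 + w + w\<^sup>2 = 0"
  shows "mk w q k = - Gw w (k + 1) - q powi (5 * k + 5) * mk w q (k + 1) + (if k = -1 then 2 * euler (q ^ 15) else 0)"
proof -
  consider "k \<ge> 0" | "k = -1" | "k \<le> -2" by linarith
  thus ?thesis
  proof cases
    case 1
    have "mk w q k = tm w q 1 k + (\<Sum>\<^sub>\<infinity>r\<in>{1..}. tm w q (r + 1) k)"
      unfolding mk_def using 1 by (simp, intro infsum_remove_head tm_summable[OF assms]) auto
    also have "(\<Sum>\<^sub>\<infinity>r\<in>{1..}. tm w q (r + 1) k) = (\<Sum>\<^sub>\<infinity>r\<in>{1..}. (- (q powi (5 * k + 5))) * tm w q r (k + 1))"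
      by (rule infsum_cong) (subst tm_shift[OF assms(1)], simp)
    also have "\<dots> = (- (q powi (5 * k + 5))) * mk w q (k + 1)"
      using 1 by (simp only: infsum_cmult_right') (simp add: mk_def)
    also have "tm w q 1 k = - Gw w (k + 1)" by (simp add: tm_def add.commute)
    finally show ?thesis using 1 by simp
  next
    case 3
    have "(\<Sum>\<^sub>\<infinity>r\<in>{..0}. tm w q r (k + 1)) = tm w q 0 (k + 1) + (\<Sum>\<^sub>\<infinity>r\<in>{..0}. tm w q (r - 1) (k + 1))"
      using 3 by (intro infsum_remove_last tm_summable[OF assms]) (auto intro: mult_nonpos_nonpos)
    hence "mk w q (k + 1) = - tm w q 0 (k + 1) - (\<Sum>\<^sub>\<infinity>r\<in>{..0}. tm w q (r - 1) (k + 1))"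
      using 3 by (simp add: mk_def)
    hence "q powi (5 * k + 5) * mk w q (k + 1) = - (q powi (5 * k + 5) * tm w q 0 (k + 1))
       - q powi (5 * k + 5) * (\<Sum>\<^sub>\<infinity>r\<in>{..0}. tm w q (r - 1) (k + 1))"
      by (simp only: right_diff_distrib mult_minus_right)
    moreover have "mk w q k = q powi (5 * k + 5) * (\<Sum>\<^sub>\<infinity>r\<in>{..0}. tm w q (r - 1) (k + 1))"
    proof -
      have "(\<Sum>\<^sub>\<infinity>r\<in>{..0}. tm w q r k) = (\<Sum>\<^sub>\<infinity>r\<in>{..0}. (- (q powi (5 * k + 5))) * tm w q (r - 1) (k + 1))"
        by (rule infsum_cong) (subst tm_shift[OF assms(1)], simp)
      also have "\<dots> = (- (q powi (5 * k + 5))) * (\<Sum>\<^sub>\<infinity>r\<in>{..0}. tm w q (r - 1) (k + 1))"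
        by (rule infsum_cmult_right')
      finally show ?thesis using 3 by (simp add: mk_def)
    qed
    moreover have "q powi (5 * k + 5) * tm w q 0 (k + 1) = Gw w (k + 1)"
    proof -
      have "q powi (5 * k + 5) * q powi (5 * ((0 - 1) * (k + 1))) = q powi 0"
        by (rule powi_eqI[OF assms(1)]) simp
      thus ?thesis by (simp add: tm_def mult_ac)
    qed
    ultimately show ?thesis using 3 by simp
  next
    case 2
    have "(\<Sum>\<^sub>\<infinity>r\<in>{..0}. tm w q r (-1)) = (\<Sum>\<^sub>\<infinity>r\<in>{..0}. (- 1) * tm w q (r - 1) 0)"
      by (rule infsum_cong) (subst tm_shift[OF assms(1)], simp)
    also have "\<dots> = (- 1) * (\<Sum>\<^sub>\<infinity>r\<in>{..0}. tm w q (r - 1) 0)"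
      by (rule infsum_cmult_right')
    also have "(\<Sum>\<^sub>\<infinity>r\<in>{..0}. tm w q (r - 1) 0) = euler (q ^ 15) - 1"
    proof -
      have "(\<Sum>\<^sub>\<infinity>r\<in>{..0}. tm w q r 0) = tm w q 0 0 + (\<Sum>\<^sub>\<infinity>r\<in>{..0}. tm w q (r - 1) 0)"
        by (intro infsum_remove_last tm_summable[OF assms]) auto
      moreover have "tm w q 0 0 = 1" using Gw_values(1)[OF assms(3)] by (simp add: tm_def)
      ultimately show ?thesis using tm_total(3)[OF assms] by (simp add: algebra_simps)
    qed
    finally show ?thesis using 2 tm_total(2)[OF assms] Gw_values(1)[OF assms(3)] by (simp add: mk_def[of w q "-1"])
  qed
qed

text \<open>The involution r -> 1 - r exchanges the two half lines. The value at k = 0 is the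
  nonzero Euler product of \<open>tm_total\<close> and stands outside this antisymmetry.\<close>

lemma mk_reflect:
  assumes "q \<noteq> 0" "norm q < 1" "1 + w + w\<^sup>2 = 0" "k \<noteq> 0"
  shows "mk w q (- k) = - (q powi (5 * k) * mk w q k)"
proof -
  have pos: "mk w q (- k) = - (q powi (5 * k) * mk w q k)" if "k > 0" for k
  proof -
    have "(\<Sum>\<^sub>\<infinity>r\<in>{..0}. tm w q r (- k)) = (\<Sum>\<^sub>\<infinity>r\<in>{1..}. q powi (5 * k) * tm w q r k)"
    proof (rule infsum_reindex_bij_witness[of _ "\<lambda>r. 1 - r" "\<lambda>r. 1 - r"])
      fix r :: int
      have r0: "tri (1 - s) = tri s" for s using tri_add[of 1 "-s"] tri_neg[of s] by simp
      have "q powi (5 * k) * q powi (5 * tri (1 - r) + 5 * ((1 - r - 1) * k)) = q powi (5 * tri r + 5 * ((r - 1) * (- k)))"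
        by (rule powi_eqI[OF assms(1)]) (simp add: r0 algebra_simps)
      moreover have "(-1) powi (1 - r) = - ((-1) powi r :: complex)" by (rule minus_one_powi_one_minus)
      moreover have "Gw w (1 - r + k) = - Gw w (r + - k)" using Gw_reflect[of w "r + - k"] by (simp add: algebra_simps)
      ultimately show "q powi (5 * k) * tm w q (1 - r) k = tm w q r (- k)"
        unfolding tm_def by (simp add: mult_ac)
    qed auto
    also have "\<dots> = q powi (5 * k) * mk w q k"
      using that by (simp only: infsum_cmult_right') (simp add: mk_def)
    finally show ?thesis using that by (simp add: mk_def)
  qed
  show ?thesis
  proof (cases "k > 0")
    case False
    hence "mk w q k = - (q powi (5 * (- k)) * mk w q (- k))" using pos[of "- k"] assms(4) by simp
    moreover have "q powi (5 * k) * q powi (5 * (- k)) = q powi 0" by (rule powi_eqI[OF assms(1)]) simp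
    ultimately show ?thesis by (metis minus_minus mult.assoc mult_1 mult_minus_right power_int_0_right)
  qed (rule pos)
qed

text \<open>In the product of \<open>psi q / q\<close> and \<open>appell w q\<close>, the theta
  exponent \<open>tri u + 2 * u\<close> is taken at u = 2 N + k; up to the factor q^(3N) this
  collects the terms with given N. See \<open>zN_sum\<close>.\<close>

definition zN :: "complex \<Rightarrow> complex \<Rightarrow> int \<Rightarrow> complex" where
  "zN w q N = (\<Sum>\<^sub>\<infinity>k. (-1) powi k * q powi (2 * (N * N) + 2 * (N * k) + tri k + 3 * k) * mk w q k)"

lemma zN_summable:
  assumes "q \<noteq> 0" "norm q < 1" "1 + w + w\<^sup>2 = 0"
  shows "(\<lambda>k. (-1) powi k * q powi (2 * (N * N) + 2 * (N * k) + tri k + 3 * k) * mk w q k) summable_on UNIV"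
proof -
  define M where "M = infsum (tmb w q) UNIV"
  have "(\<lambda>k. (M * norm q powi (2 * (N * N))) * ((norm q powi (2 * N + 3)) powi k * norm q powi tri k)) summable_on UNIV"
    by (intro summable_on_cmult_right summable_int_theta) (use assms in auto)
  thus ?thesis
  proof (rule summable_on_norm_bound)
    fix k
    have "norm ((-1) powi k * q powi (2 * (N * N) + 2 * (N * k) + tri k + 3 * k) * mk w q k) =
       norm q powi (2 * (N * N) + 2 * (N * k) + tri k + 3 * k) * norm (mk w q k)"
      by (simp add: norm_mult norm_powi)
    also have "\<dots> \<le> norm q powi (2 * (N * N) + 2 * (N * k) + tri k + 3 * k) * M"
      using mk_bound(1)[OF assms] by (intro mult_left_mono) (auto simp: M_def)
    also have "norm q powi (2 * (N * N) + 2 * (N * k) + tri k + 3 * k) = norm q powi (2 * (N * N)) * ((norm q powi (2 * N + 3)) powi k * norm q powi tri k)"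
    proof -
      have "2 * (N * N) + 2 * (N * k) + tri k + 3 * k = 2 * (N * N) + ((2 * N + 3) * k + tri k)" by (simp add: algebra_simps)
      moreover have nz: "norm q \<noteq> 0" using assms by simp
      ultimately show ?thesis by (simp only: power_int_mult[symmetric] powi_add[OF nz, symmetric])
    qed
    finally show "norm ((-1) powi k * q powi (2 * (N * N) + 2 * (N * k) + tri k + 3 * k) * mk w q k) \<le>
      (M * norm q powi (2 * (N * N))) * ((norm q powi (2 * N + 3)) powi k * norm q powi tri k)"
      by (simp only: mult_ac)
  qed
qed

definition tau :: "complex \<Rightarrow> int \<Rightarrow> complex" where
  "tau w t = w powi t + w powi (- t)"

lemma jtheta_shift3:
  assumes "norm q < 1" "x \<noteq> 0" "q \<noteq> 0"
  shows "jtheta x q = - (q ^ 3 * x ^ 3) * jtheta (q ^ 3 * x) q"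
proof -
  have "jtheta x q = - x * (- (q * x) * (- (q * (q * x)) * jtheta (q * (q * (q * x))) q))"
    using jtheta_shift[OF assms] jtheta_shift[OF assms(1), of "q * x"] jtheta_shift[OF assms(1), of "q * (q * x)"] assms
    by simp
  thus ?thesis by (simp add: eval_nat_numeral mult_ac)
qed

text \<open>The extra 3 u in the exponent moves the argument from w to q^3 w; returning through
  three quasi-periods costs the factor - q^(-3), because w^3 = 1.\<close>

lemma theta_root_sum:
  assumes "q \<noteq> 0" "norm q < 1" "1 + w + w\<^sup>2 = 0"
  shows "((\<lambda>u. (-1) powi u * w powi u * q powi (tri u + 3 * u)) has_sum - (q powi (-3)) * ((1 - w) * euler (q ^ 3))) UNIV"
proof -
  note w = cube_root[OF assms(3)]
  have "(- (q ^ 3 * w)) powi u * q powi tri u = (-1) powi u * w powi u * q powi (tri u + 3 * u)" for u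
  proof -
    have "(- (q ^ 3 * w)) powi u = (-1) powi u * ((q ^ 3) powi u * w powi u)"
      using power_int_mult_distrib[of "-1" "q ^ 3 * w" u] power_int_mult_distrib[of "q ^ 3" w u] by simp
    moreover have "(q ^ 3) powi u = q powi (3 * u)" by (simp add: power_int_power)
    ultimately show ?thesis using powi_add[OF assms(1), of "tri u" "3 * u"] by simp
  qed
  moreover have "jtheta (q ^ 3 * w) q = - (q powi (-3)) * ((1 - w) * euler (q ^ 3))"
    using jtheta_shift3[OF assms(2) w(2) assms(1)] w(1) jtheta_unity_root[OF assms(2,1,3)] assms(1)
    by (simp add: power_int_minus field_simps)
  ultimately show ?thesis using jacobi_triple_product[of "q ^ 3 * w" q] assms w by simp
qed

lemma Gw_theta_sum:
  assumes "q \<noteq> 0" "norm q < 1" "1 + w + w\<^sup>2 = 0"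
  shows "((\<lambda>u. (-1) powi u * Gw w (u + t) * q powi (tri u + 3 * u)) has_sum - (q powi (-3)) * euler (q ^ 3) * tau w t) UNIV"
proof -
  note w = cube_root[OF assms(3)]
  have w2: "1 + w\<^sup>2 + (w\<^sup>2)\<^sup>2 = 0" using assms(3) by algebra
  have wi: "w\<^sup>2 = w powi (-1)" using w by (simp add: field_simps eval_nat_numeral)
  define v where "v = 1 / (1 - w)"
  have v: "v * (1 - w) = 1" using w(3) by (simp add: v_def)
  have "((\<lambda>u. (v * w powi t) * ((-1) powi u * w powi u * q powi (tri u + 3 * u))
      + (- v * w powi (1 - t)) * ((-1) powi u * (w\<^sup>2) powi u * q powi (tri u + 3 * u))) has_sum
      (v * w powi t) * (- (q powi (-3)) * ((1 - w) * euler (q ^ 3))) + (- v * w powi (1 - t)) * (- (q powi (-3)) * ((1 - w\<^sup>2) * euler (q ^ 3)))) UNIV"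
    by (intro has_sum_add has_sum_cmult_right theta_root_sum assms w2)
  also have "(\<lambda>u. (v * w powi t) * ((-1) powi u * w powi u * q powi (tri u + 3 * u))
      + (- v * w powi (1 - t)) * ((-1) powi u * (w\<^sup>2) powi u * q powi (tri u + 3 * u)))
     = (\<lambda>u. (-1) powi u * Gw w (u + t) * q powi (tri u + 3 * u))"
  proof
    fix u
    have "(w\<^sup>2) powi u = w powi (- u)" unfolding wi by (simp only: power_int_mult[symmetric]) simp
    hence "w powi (1 - t) * (w\<^sup>2) powi u = w powi (1 - (u + t))"
      using powi_eqI[OF w(2), of "1 - t" "- u" "1 - (u + t)"] by simp
    moreover have "w powi t * w powi u = w powi (u + t)" by (rule powi_eqI[OF w(2)]) simp
    ultimately have G: "Gw w (u + t) = (w powi t * w powi u - w powi (1 - t) * (w\<^sup>2) powi u) * v"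
      by (simp add: Gw_def v_def)
    show "(v * w powi t) * ((-1) powi u * w powi u * q powi (tri u + 3 * u))
      + (- v * w powi (1 - t)) * ((-1) powi u * (w\<^sup>2) powi u * q powi (tri u + 3 * u))
      = (-1) powi u * Gw w (u + t) * q powi (tri u + 3 * u)" unfolding G by (simp add: algebra_simps)
  qed
  also have "(v * w powi t) * (- (q powi (-3)) * ((1 - w) * euler (q ^ 3))) + (- v * w powi (1 - t)) * (- (q powi (-3)) * ((1 - w\<^sup>2) * euler (q ^ 3)))
     = - (q powi (-3)) * euler (q ^ 3) * tau w t"
  proof -
    have "w powi (1 - t) * (1 - w\<^sup>2) = - (1 - w) * w powi (- t)"
    proof -
      have "w powi (1 - t) = w * w powi (- t)" using powi_eqI[OF w(2), of 1 "- t" "1 - t"] by simp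
      moreover have "w * (1 - w\<^sup>2) = - (1 - w)" using w(1) by (simp add: algebra_simps eval_nat_numeral)
      ultimately show ?thesis by (metis mult.assoc mult.commute)
    qed
    note e = this
    have "(- v * w powi (1 - t)) * (- (q powi (-3)) * ((1 - w\<^sup>2) * euler (q ^ 3)))
      = v * q powi (-3) * euler (q ^ 3) * (w powi (1 - t) * (1 - w\<^sup>2))"
      by (simp only: mult_minus_left mult_minus_right minus_minus mult_ac)
    also have "\<dots> = - (q powi (-3)) * euler (q ^ 3) * (v * (1 - w) * w powi (- t))"
      unfolding e by (simp only: mult_minus_left mult_minus_right minus_minus mult_ac)
    finally have A: "(- v * w powi (1 - t)) * (- (q powi (-3)) * ((1 - w\<^sup>2) * euler (q ^ 3)))
      = - (q powi (-3)) * euler (q ^ 3) * (v * (1 - w) * w powi (- t))" .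
    have B: "(v * w powi t) * (- (q powi (-3)) * ((1 - w) * euler (q ^ 3)))
      = - (q powi (-3)) * euler (q ^ 3) * (v * (1 - w) * w powi t)" by (simp only: mult_ac)
    show ?thesis unfolding A B v tau_def by (simp add: algebra_simps)
  qed
  finally show ?thesis .
qed

lemma zN_has_sum:
  assumes "q \<noteq> 0" "norm q < 1" "1 + w + w\<^sup>2 = 0"
  shows "((\<lambda>k. (-1) powi k * q powi (2 * (N * N) + 2 * (N * k) + tri k + 3 * k) * mk w q k) has_sum zN w q N) UNIV"
  unfolding zN_def by (rule has_sum_infsum[OF zN_summable[OF assms]])

lemma tau_period:
  assumes "1 + w + w\<^sup>2 = 0" "3 dvd (i - j)"
  shows "tau w i = tau w j"
proof -
  have "3 dvd (- i - - j)" using assms(2) by presburger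
  thus ?thesis unfolding tau_def using cube_root_powi[OF assms] cube_root_powi[OF assms(1)] by metis
qed

text \<open>Inserting \<open>mk_rec\<close> splits the series into three: the \<open>Gw\<close> part
  is a complete theta series in u = k + 2 N, the part with \<open>mk w q (k + 1)\<close> is a
  multiple of \<open>zN w q (N + 2)\<close> after a shift, and the exceptional term sits at k =
  -1.\<close>

lemma zN_rec:
  assumes "q \<noteq> 0" "norm q < 1" "1 + w + w\<^sup>2 = 0"
  shows "zN w q N = q powi (-10 * N - 10) * zN w q (N + 2) + q powi (-5 * N - 3) * euler (q ^ 3) * tau w (N + 1)
     - 2 * euler (q ^ 15) * q powi (2 * (N * N) - 2 * N - 2)"
proof -
  let ?e = "\<lambda>N k. 2 * (N * N) + 2 * (N * k) + tri k + 3 * k"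
  let ?C = "- (2 * euler (q ^ 15) * q powi (2 * (N * N) - 2 * N - 2))"
  have hB: "((\<lambda>k. q powi (-10 * N - 10) * ((-1) powi (k + 1) * q powi ?e (N + 2) (k + 1) * mk w q (k + 1))) has_sum
     q powi (-10 * N - 10) * zN w q (N + 2)) UNIV"
    using zN_has_sum[OF assms, of "N + 2"]
      has_sum_shift_int[of "\<lambda>k. (-1) powi k * q powi ?e (N + 2) k * mk w q k" 1]
    by (intro has_sum_cmult_right) simp
  have hA: "((\<lambda>k. (- (q powi (-5 * N))) * ((-1) powi (k + 2 * N) * Gw w (k + 2 * N + (1 - 2 * N)) * q powi (tri (k + 2 * N) + 3 * (k + 2 * N)))) has_sum
    (- (q powi (-5 * N))) * (- (q powi (-3)) * euler (q ^ 3) * tau w (1 - 2 * N))) UNIV"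
    using Gw_theta_sum[OF assms, of "1 - 2 * N"]
      has_sum_shift_int[of "\<lambda>u. (-1) powi u * Gw w (u + (1 - 2 * N)) * q powi (tri u + 3 * u)" "2 * N"]
    by (intro has_sum_cmult_right) simp
  have hC: "((\<lambda>k. if k = -1 then ?C else 0) has_sum ?C) UNIV"
    by (rule has_sum_finite_neutralI[of "{-1}"]) auto
  have eq: "(-1) powi k * q powi ?e N k * mk w q k =
    (- (q powi (-5 * N))) * ((-1) powi (k + 2 * N) * Gw w (k + 2 * N + (1 - 2 * N)) * q powi (tri (k + 2 * N) + 3 * (k + 2 * N))) +
    q powi (-10 * N - 10) * ((-1) powi (k + 1) * q powi ?e (N + 2) (k + 1) * mk w q (k + 1)) + (if k = -1 then ?C else 0)" for k
  proof -
    have t2N: "tri (2 * N) = 2 * (N * N) - N" using tri_add[of N N] two_tri[of N] by (simp add: algebra_simps)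
    hence t2N': "tri (N * 2) = 2 * (N * N) - N" by (simp add: mult.commute)
    have m: "(-1) powi (k + 2 * N) = ((-1) powi k :: complex)" by (simp add: power_int_add power_int_mult)
    have m1: "(-1) powi (k + 1) = - ((-1) powi k :: complex)" by (simp add: power_int_add)
    have a: "q powi (-5 * N) * q powi (tri (k + 2 * N) + 3 * (k + 2 * N)) = q powi ?e N k"
      by (rule powi_eqI[OF assms(1)]) (simp add: tri_add t2N t2N' algebra_simps)
    have b: "q powi (-10 * N - 10) * q powi ?e (N + 2) (k + 1) = q powi ?e N k * q powi (5 * k + 5)"
    proof -
      have "q powi (-10 * N - 10) * q powi ?e (N + 2) (k + 1) = q powi (?e N k + (5 * k + 5))"
        by (rule powi_eqI[OF assms(1)]) (simp add: tri_add algebra_simps)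
      also have "\<dots> = q powi ?e N k * q powi (5 * k + 5)" by (rule powi_add[OF assms(1)])
      finally show ?thesis .
    qed
    have c: "(-1) powi k * q powi ?e N k * (if k = -1 then 2 * euler (q ^ 15) else 0) = (if k = -1 then ?C else 0)"
    proof (cases "k = -1")
      case True
      have "tri (-1) = 1" using tri_neg[of 1] by simp
      hence "?e N (-1) = 2 * (N * N) - 2 * N - 2" by simp
      thus ?thesis using True by simp
    qed simp
    have "(-1) powi k * q powi ?e N k * mk w q k =
       - ((-1) powi k * q powi ?e N k * Gw w (k + 1)) - (-1) powi k * (q powi ?e N k * q powi (5 * k + 5)) * mk w q (k + 1)
       + (-1) powi k * q powi ?e N k * (if k = -1 then 2 * euler (q ^ 15) else 0)"
      unfolding mk_rec[OF assms, of k] by (simp only: distrib_left right_diff_distrib mult_minus_left mult_minus_right mult_ac)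
    also have "\<dots> = - ((-1) powi k * (q powi (-5 * N) * q powi (tri (k + 2 * N) + 3 * (k + 2 * N))) * Gw w (k + 1))
       - (-1) powi k * (q powi (-10 * N - 10) * q powi ?e (N + 2) (k + 1)) * mk w q (k + 1) + (if k = -1 then ?C else 0)"
      unfolding a b c ..
    also have "k + 1 = k + 2 * N + (1 - 2 * N)" by simp
    finally show ?thesis unfolding m m1 by (simp add: mult_ac)
  qed
  have "((\<lambda>k. (-1) powi k * q powi ?e N k * mk w q k) has_sum
    (- (q powi (-5 * N))) * (- (q powi (-3)) * euler (q ^ 3) * tau w (1 - 2 * N)) + q powi (-10 * N - 10) * zN w q (N + 2) + ?C) UNIV"
    unfolding eq by (intro has_sum_add hA hB hC)
  hence "zN w q N = (- (q powi (-5 * N))) * (- (q powi (-3)) * euler (q ^ 3) * tau w (1 - 2 * N)) + q powi (-10 * N - 10) * zN w q (N + 2) + ?C"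
    using zN_has_sum[OF assms, of N] has_sum_unique by blast
  also have "tau w (1 - 2 * N) = tau w (N + 1)" by (rule tau_period[OF assms(3)]) presburger
  also have "(- (q powi (-5 * N))) * (- (q powi (-3)) * euler (q ^ 3) * tau w (N + 1)) = q powi (-5 * N - 3) * euler (q ^ 3) * tau w (N + 1)"
    using powi_add[OF assms(1), of "-5 * N" "-3"] by simp
  finally show ?thesis by simp
qed

text \<open>The term k of one series cancels the term -k of the other by \<open>mk_reflect\<close>;
  only the two terms with k = 0 remain.\<close>

lemma zN_reflect:
  assumes "q \<noteq> 0" "norm q < 1" "1 + w + w\<^sup>2 = 0"
  shows "zN w q N + zN w q (- N) = 2 * euler (q ^ 15) * q powi (2 * (N * N))"
proof -
  let ?f = "\<lambda>N k. (-1) powi k * q powi (2 * (N * N) + 2 * (N * k) + tri k + 3 * k) * mk w q k"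
  have "((\<lambda>k. ?f N k + ?f (- N) (0 - k)) has_sum zN w q N + zN w q (- N)) UNIV"
    using zN_has_sum[OF assms, of N] zN_has_sum[OF assms, of "- N"] has_sum_reflect_int[of "?f (- N)" 0]
    by (intro has_sum_add) simp_all
  moreover have "((\<lambda>k. ?f N k + ?f (- N) (0 - k)) has_sum 2 * euler (q ^ 15) * q powi (2 * (N * N))) UNIV"
  proof (rule has_sum_finite_neutralI[of "{0}"])
    fix k :: int assume "k \<in> UNIV - {0}"
    hence k: "k \<noteq> 0" by simp
    have "q powi (2 * (- N * - N) + 2 * (- N * (0 - k)) + tri (0 - k) + 3 * (0 - k)) * q powi (5 * k)
      = q powi (2 * (N * N) + 2 * (N * k) + tri k + 3 * k)"
      by (rule powi_eqI[OF assms(1)]) (simp add: tri_neg)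
    moreover have "(-1) powi (0 - k) = ((-1) powi k :: complex)" using power_int_minus_one_minus[of k] by simp
    ultimately show "?f N k + ?f (- N) (0 - k) = 0"
      using mk_reflect[OF assms k] by (simp add: mult_ac)
  qed (use tm_total(2)[OF assms] in simp_all)
  ultimately show ?thesis using has_sum_unique by blast
qed

section \<open>Comparison of recurrences along the diagonals\<close>

definition hN :: "complex \<Rightarrow> int \<Rightarrow> complex" where
  "hN q N = q powi (2 * (N * N)) * gs (q\<^sup>2) N"

lemma hN_rec:
  assumes "q \<noteq> 0"
  shows "hN q (N + 2) = 2 * q powi (2 * ((N + 2) * (N + 2))) + q powi (10 * N + 10) * hN q N"
proof -
  have "(q\<^sup>2) powi (N + 1) = q powi (2 * (N + 1))" by (simp only: power_int_mult power_int_numeral)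
  moreover have "q powi (2 * ((N + 2) * (N + 2))) * q powi (2 * (N + 1)) = q powi (10 * N + 10) * q powi (2 * (N * N))"
  proof -
    have "2 * ((N + 2) * (N + 2)) + 2 * (N + 1) = (10 * N + 10) + 2 * (N * N)" by (simp add: algebra_simps)
    thus ?thesis using powi_add[OF assms] by metis
  qed
  ultimately show ?thesis using gs_rec[of "q\<^sup>2" N] assms unfolding hN_def by (simp add: algebra_simps)
qed

text \<open>The correction whose recurrence produces the \<open>tau\<close> terms of
  \<open>zN_rec\<close>. Weighted with q^(3N) it turns into a Kronecker double sum in base q^10; see
  \<open>kap_sum\<close>.\<close>

definition kap :: "complex \<Rightarrow> complex \<Rightarrow> int \<Rightarrow> complex" where
  "kap w q = csum (\<lambda>r s. w powi (r - s) * q powi (5 * (r + s) + 10 * (r * s)))"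

lemma kap_rec:
  assumes "q \<noteq> 0"
  shows "kap w q (N + 2) = q powi (5 * N + 10) * tau w (N + 2) + q powi (10 * N + 20) * kap w q N"
proof -
  have "csum (\<lambda>r s. w powi (r + 1 - (s + 1)) * q powi (5 * (r + 1 + (s + 1)) + 10 * ((r + 1) * (s + 1)))) N
    = csum (\<lambda>r s. q powi (10 * N + 20) * (w powi (r - s) * q powi (5 * (r + s) + 10 * (r * s)))) N"
  proof (rule csum_cong)
    fix r s assume "r + s = N"
    hence "5 * (r + 1 + (s + 1)) + 10 * ((r + 1) * (s + 1)) = (10 * N + 20) + (5 * (r + s) + 10 * (r * s))" by (auto simp: algebra_simps)
    thus "w powi (r + 1 - (s + 1)) * q powi (5 * (r + 1 + (s + 1)) + 10 * ((r + 1) * (s + 1)))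
       = q powi (10 * N + 20) * (w powi (r - s) * q powi (5 * (r + s) + 10 * (r * s)))"
      using powi_add[OF assms] by (simp add: mult_ac)
  qed
  also have "\<dots> = q powi (10 * N + 20) * kap w q N"
    unfolding kap_def by (rule csum_cmult)
  finally have A: "csum (\<lambda>r s. w powi (r + 1 - (s + 1)) * q powi (5 * (r + 1 + (s + 1)) + 10 * ((r + 1) * (s + 1)))) N
    = q powi (10 * N + 20) * kap w q N" .
  have "kap w q (N + 2) = w powi (0 - (N + 2)) * q powi (5 * (0 + (N + 2)) + 10 * (0 * (N + 2)))
    + w powi (N + 2 - 0) * q powi (5 * (N + 2 + 0) + 10 * ((N + 2) * 0)) + q powi (10 * N + 20) * kap w q N"
    unfolding A[symmetric] unfolding kap_def by (rule csum_rec)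
  moreover have "5 * (0 + (N + 2)) + 10 * (0 * (N + 2)) = 5 * N + 10" "5 * (N + 2 + 0) + 10 * ((N + 2) * 0) = 5 * N + 10"
    "0 - (N + 2) = - (N + 2)" "N + 2 - 0 = N + 2" by simp_all
  ultimately show ?thesis by (simp only: tau_def distrib_left mult_ac add_ac)
qed

text \<open>All three quantities satisfy recurrences with multiplier q^(10 N + 10): the
  inhomogeneous term of \<open>hN\<close> matches the Euler term of \<open>zN_rec\<close>, and the
  \<open>tau\<close> terms of \<open>zN\<close> and \<open>kap\<close> cancel. The difference
  \<open>v\<close> obeys the homogeneous recurrence, so it is enough that it vanishes at 0 and
  1.\<close>

theorem hecke_coefficients:
  assumes "q \<noteq> 0" "norm q < 1" "1 + w + w\<^sup>2 = 0"
  shows "euler (q ^ 15) * hN q N = zN w q N + q\<^sup>2 * euler (q ^ 3) * kap w q (N - 1)"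
proof -
  define E E3 where "E = euler (q ^ 15)" "E3 = euler (q ^ 3)"
  define v where "v = (\<lambda>N. E * hN q N - zN w q N - q\<^sup>2 * E3 * kap w q (N - 1))"
  have rec: "v (N + 2) = q powi (10 * N + 10) * v N" for N
  proof -
    have c: "q powi (10 * N + 10) * q powi (-10 * N - 10) = 1" using powi_eqI[OF assms(1), of "10 * N + 10" "-10 * N - 10" 0] by simp
    have d: "q powi (10 * N + 10) * q powi (-5 * N - 3) = q powi (5 * N + 7)"
      by (rule powi_eqI[OF assms(1)]) simp
    have e: "q powi (10 * N + 10) * q powi (2 * (N * N) - 2 * N - 2) = q powi (2 * ((N + 2) * (N + 2)))"
      by (rule powi_eqI[OF assms(1)]) (simp add: algebra_simps)
    have f: "q\<^sup>2 * q powi (5 * (N - 1) + 10) = q powi (5 * N + 7)"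
      using powi_eqI[OF assms(1), of 2 "5 * (N - 1) + 10" "5 * N + 7"] by simp
    have "q powi (10 * N + 10) * zN w q N =
       (q powi (10 * N + 10) * q powi (-10 * N - 10)) * zN w q (N + 2) + (q powi (10 * N + 10) * q powi (-5 * N - 3)) * E3 * tau w (N + 1)
       - 2 * E * (q powi (10 * N + 10) * q powi (2 * (N * N) - 2 * N - 2))"
      unfolding zN_rec[OF assms, of N] E_E3_def by (simp only: distrib_left right_diff_distrib mult_ac)
    hence z: "q powi (10 * N + 10) * zN w q N = zN w q (N + 2) + q powi (5 * N + 7) * E3 * tau w (N + 1) - 2 * E * q powi (2 * ((N + 2) * (N + 2)))"
      unfolding c d e by simp
    have "kap w q (N - 1 + 2) = q powi (5 * (N - 1) + 10) * tau w (N - 1 + 2) + q powi (10 * (N - 1) + 20) * kap w q (N - 1)"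
      by (rule kap_rec[OF assms(1)])
    moreover have "N - 1 + 2 = N + 2 - 1" "N + 2 - 1 = N + 1" "10 * (N - 1) + 20 = 10 * N + 10" by simp_all
    ultimately have k: "kap w q (N + 2 - 1) = q powi (5 * (N - 1) + 10) * tau w (N + 1) + q powi (10 * N + 10) * kap w q (N - 1)"
      by (simp only:)
    have k: "q\<^sup>2 * E3 * kap w q (N + 2 - 1) = q powi (5 * N + 7) * E3 * tau w (N + 1) + q powi (10 * N + 10) * (q\<^sup>2 * E3 * kap w q (N - 1))"
      unfolding k f[symmetric] by (simp add: algebra_simps)
    have "v (N + 2) = E * (2 * q powi (2 * ((N + 2) * (N + 2))) + q powi (10 * N + 10) * hN q N) - zN w q (N + 2)
      - (q powi (5 * N + 7) * E3 * tau w (N + 1) + q powi (10 * N + 10) * (q\<^sup>2 * E3 * kap w q (N - 1)))"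
      unfolding v_def hN_rec[OF assms(1)] k ..
    also have "\<dots> = q powi (10 * N + 10) * (E * hN q N) - (q powi (10 * N + 10) * zN w q N) - q powi (10 * N + 10) * (q\<^sup>2 * E3 * kap w q (N - 1))"
      unfolding z by (simp add: algebra_simps)
    finally show ?thesis unfolding v_def by (simp add: right_diff_distrib)
  qed
  have z0: "zN w q 0 = E" using zN_reflect[OF assms, of 0] by (simp add: E_E3_def)
  have h0: "hN q 0 = 1" by (simp add: hN_def gs_def)
  have k0: "kap w q (-1) = 0" "kap w q 0 = 1" by (simp_all add: kap_def)
  have v0: "v 0 = 0" by (simp add: v_def z0 h0 k0)
  have h1: "hN q 1 = 2 * q\<^sup>2" by (simp add: hN_def gs_def)
  \<comment> \<open>The value at 1 is not visible from the series; it is solved from two linear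
    equations in \<open>zN w q 1\<close> and \<open>zN w q (-1)\<close>, namely the reflection at N
    = 1 and the recurrence at N = -1.\<close>
  have "zN w q 1 + zN w q (-1) = 2 * E * q\<^sup>2" using zN_reflect[OF assms, of 1] by (simp add: E_E3_def)
  moreover have "zN w q (-1) = zN w q 1 + 2 * (q\<^sup>2 * E3) - 2 * (E * q\<^sup>2)"
    using zN_rec[OF assms, of "-1"] by (simp add: E_E3_def tau_def)
  ultimately have "2 * zN w q 1 = 2 * (2 * E * q\<^sup>2 - q\<^sup>2 * E3)" by (simp add: algebra_simps)
  hence "zN w q 1 = 2 * E * q\<^sup>2 - q\<^sup>2 * E3" by (metis mult_left_cancel zero_neq_numeral)
  hence v1: "v 1 = 0" by (simp add: v_def h1 k0)
  \<comment> \<open>The recurrence has step 2, so two neighbouring values are carried along; its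
    multiplier is nonzero, which permits the downward direction.\<close>
  have "v N = 0 \<and> v (N + 1) = 0"
  proof (induction N rule: int_induct[where k = 0])
    case base thus ?case using v0 v1 by simp
  next
    case (step1 i) thus ?case using rec[of i] by (simp add: add.assoc)
  next
    case (step2 i)
    have "v (i + 1) = q powi (10 * (i - 1) + 10) * v (i - 1)" using rec[of "i - 1"] by (simp add: algebra_simps)
    hence "v (i - 1) = 0" using step2 assms(1) by simp
    thus ?case using step2 by simp
  qed
  thus ?thesis by (simp add: v_def E_E3_def algebra_simps)
qed

section \<open>Summation over the diagonals\<close>

definition appell :: "complex \<Rightarrow> complex \<Rightarrow> complex" where
  "appell w q = (\<Sum>\<^sub>\<infinity>k. (-1) powi k * q powi k * mk w q k)"

lemma appell_bound:
  assumes "q \<noteq> 0" "norm q < 1" "1 + w + w\<^sup>2 = 0"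
  shows "norm ((-1) powi k * q powi k * mk w q k) \<le> infsum (tmb w q) UNIV * norm q ^ nat \<bar>k\<bar>"
proof -
  let ?M = "infsum (tmb w q) UNIV"
  have M: "?M \<ge> 0" by (intro infsum_nonneg tmb_nonneg)
  have n: "norm ((-1) powi k * q powi k * mk w q k) = norm q powi k * norm (mk w q k)"
    by (simp add: norm_mult norm_powi)
  show ?thesis
  proof (cases "k < 0")
    case False
    have "norm q powi k * norm (mk w q k) \<le> norm q powi k * ?M"
      by (intro mult_left_mono mk_bound(1)[OF assms]) auto
    thus ?thesis unfolding n using False by (simp add: power_int_def mult.commute)
  next
    case True
    have "norm q powi k * norm (mk w q k) \<le> norm q powi k * (?M * norm q powi (- 5 * k))"
      by (intro mult_left_mono mk_bound(2)[OF assms True]) auto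
    also have "\<dots> = ?M * (norm q powi k * norm q powi (- 5 * k))" by simp
    also have "norm q powi k * norm q powi (- 5 * k) = norm q powi (- 4 * k)"
      using powi_add[of "norm q" k "- 5 * k"] assms by simp
    also have "norm q powi (- 4 * k) \<le> norm q powi (- k)"
      using True assms by (intro power_int_decreasing) auto
    finally show ?thesis unfolding n using True M by (simp add: power_int_def mult_left_mono)
  qed
qed

lemma summable_power_abs:
  fixes c :: real
  assumes "0 \<le> c" "c < 1"
  shows "(\<lambda>k::int. c ^ nat \<bar>k\<bar>) summable_on UNIV"
  by (rule summable_on_int_split) (use assms in \<open>auto intro!: summable_nonneg_imp_summable_on summable_geometric\<close>)

lemma appell_summable:
  assumes "q \<noteq> 0" "norm q < 1" "1 + w + w\<^sup>2 = 0"
  shows "(\<lambda>k. (-1) powi k * q powi k * mk w q k) summable_on UNIV"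
  by (rule summable_on_norm_bound[OF summable_on_cmult_right[OF summable_power_abs] appell_bound[OF assms]])
     (use assms in auto)

lemma psi_has_sum:
  assumes "q \<noteq> 0" "norm q < 1"
  shows "((\<lambda>n. q powi (2 * (n * n) + n)) has_sum psi q) UNIV"
proof -
  have "norm (q ^ 4) < 1" using assms by (simp add: norm_power power_less_one_iff)
  hence "((\<lambda>r. (- (- q)) powi r * (q ^ 4) powi tri r) has_sum psi q) UNIV"
    unfolding psi_def using assms by (intro jacobi_triple_product) auto
  also have "(\<lambda>r. (- (- q)) powi r * (q ^ 4) powi tri r) = (\<lambda>r. q powi (2 * ((0 - r) * (0 - r)) + (0 - r)))"
  proof
    fix r
    have "q powi r * q powi (4 * tri r) = q powi (2 * ((0 - r) * (0 - r)) + (0 - r))"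
      by (rule powi_eqI[OF assms(1)]) (use two_tri[of r] in \<open>simp add: algebra_simps\<close>)
    thus "(- (- q)) powi r * (q ^ 4) powi tri r = q powi (2 * ((0 - r) * (0 - r)) + (0 - r))"
      by (simp add: power_int_power)
  qed
  finally show ?thesis by (subst (asm) has_sum_reflect_int[of "\<lambda>n. q powi (2 * (n * n) + n)"])
qed

text \<open>As u runs through a single parity class, \<open>tri u + 2 * u\<close> takes each
  exponent 2 n^2 + n - 1 once. Both parity classes therefore give the same series, and the value
  does not depend on \<open>k\<close>.\<close>

lemma psi_half_sum:
  assumes "q \<noteq> 0" "norm q < 1"
  shows "((\<lambda>N. q powi (tri (2 * N + k) + 2 * (2 * N + k))) has_sum psi q / q) UNIV"
proof -
  have t2: "tri (2 * n) = 2 * (n * n) - n" for n using tri_add[of n n] two_tri[of n] by (simp add: algebra_simps)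
  have h: "((\<lambda>n. q powi (2 * (n * n) + n - 1)) has_sum psi q / q) UNIV"
    using has_sum_divide_const[OF psi_has_sum[OF assms], of q] assms by (simp add: power_int_diff)
  show ?thesis
  proof (cases "even k")
    case True
    then obtain c where k: "k = 2 * c" by blast
    have "((\<lambda>N. q powi (2 * ((- 1 - c - N) * (- 1 - c - N)) + (- 1 - c - N) - 1)) has_sum psi q / q) UNIV"
      using h by (subst has_sum_reflect_int[of "\<lambda>n. q powi (2 * (n * n) + n - 1)" "- 1 - c"])
    moreover have "2 * ((- 1 - c - N) * (- 1 - c - N)) + (- 1 - c - N) - 1 = tri (2 * N + k) + 2 * (2 * N + k)" for N
      using t2[of "N + c"] by (simp add: k algebra_simps)
    ultimately show ?thesis by simp
  next
    case False
    then obtain c where k: "k = 2 * c + 1" by (rule oddE)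
    have "((\<lambda>N. q powi (2 * ((N + (c + 1)) * (N + (c + 1))) + (N + (c + 1)) - 1)) has_sum psi q / q) UNIV"
      using h by (subst has_sum_shift_int[of "\<lambda>n. q powi (2 * (n * n) + n - 1)" "c + 1"])
    moreover have "2 * ((N + (c + 1)) * (N + (c + 1))) + (N + (c + 1)) - 1 = tri (2 * N + k) + 2 * (2 * N + k)" for N
    proof -
      have "tri (2 * N + k) = tri (2 * (N + c)) + 2 * (N + c)"
        using tri_add[of "2 * (N + c)" 1] by (simp add: k algebra_simps)
      thus ?thesis using t2[of "N + c"] by (simp add: k algebra_simps)
    qed
    ultimately show ?thesis by simp
  qed
qed

text \<open>An absolutely convergent double series is summed in two orders: over k first it yields
  q^(3N) times \<open>zN\<close>, over N first each k contributes the same factor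
  \<open>psi q / q\<close> by \<open>psi_half_sum\<close>.\<close>

lemma zN_sum:
  assumes "q \<noteq> 0" "norm q < 1" "1 + w + w\<^sup>2 = 0"
  shows "((\<lambda>N. q powi (3 * N) * zN w q N) has_sum psi q / q * appell w q) UNIV"
proof -
  define a where "a = (\<lambda>k. (-1) powi k * q powi k * mk w q k)"
  define F where "F = (\<lambda>(u, k). q powi (tri u + 2 * u) * a k)"
  have sF: "F summable_on UNIV \<times> UNIV"
  proof (rule summable_on_norm_bound)
    let ?M = "infsum (tmb w q) UNIV"
    have M: "?M \<ge> 0" by (intro infsum_nonneg tmb_nonneg)
    show "(\<lambda>(u, k). ((norm q ^ 2) powi u * norm q powi tri u) * (?M * norm q ^ nat \<bar>k\<bar>)) summable_on UNIV \<times> UNIV"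
      by (intro summable_on_product summable_int_theta summable_on_cmult_right summable_power_abs) (use assms M in auto)
    fix x :: "int \<times> int"
    obtain u k where x: "x = (u, k)" by (cases x)
    have "norm (F x) = ((norm q ^ 2) powi u * norm q powi tri u) * norm (a k)"
      using assms by (simp add: x F_def norm_mult norm_powi power_int_add power_int_power mult.commute)
    also have "\<dots> \<le> ((norm q ^ 2) powi u * norm q powi tri u) * (?M * norm q ^ nat \<bar>k\<bar>)"
      unfolding a_def by (intro mult_left_mono appell_bound[OF assms]) auto
    finally show "norm (F x) \<le> (case x of (u, k) \<Rightarrow> ((norm q ^ 2) powi u * norm q powi tri u) * (?M * norm q ^ nat \<bar>k\<bar>))"
      by (simp add: x)
  qed
  \<comment> \<open>This substitution is injective but not onto (u and k must have equal parity),
    which suffices to transfer summability.\<close>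
  let ?g = "\<lambda>(N::int, k::int). (2 * N + k, k)"
  have "F summable_on (?g ` (UNIV \<times> UNIV))" by (rule summable_on_subset_banach[OF sF]) auto
  hence "(F \<circ> ?g) summable_on (UNIV \<times> UNIV)"
    by (subst (asm) summable_on_reindex) (auto simp: inj_on_def)
  hence sG: "(\<lambda>(N, k). q powi (tri (2 * N + k) + 2 * (2 * N + k)) * a k) summable_on UNIV \<times> UNIV"
    by (simp add: o_def F_def case_prod_unfold)
  have t2: "tri (2 * n) = 2 * (n * n) - n" for n using tri_add[of n n] two_tri[of n] by (simp add: algebra_simps)
  hence t2': "tri (n * 2) = 2 * (n * n) - n" for n by (simp add: mult.commute)
  have in1: "((\<lambda>k. q powi (tri (2 * N + k) + 2 * (2 * N + k)) * a k) has_sum q powi (3 * N) * zN w q N) UNIV" for N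
  proof -
    have "q powi (3 * N) * ((-1) powi k * q powi (2 * (N * N) + 2 * (N * k) + tri k + 3 * k) * mk w q k)
       = q powi (tri (2 * N + k) + 2 * (2 * N + k)) * a k" for k
    proof -
      have "q powi (3 * N) * q powi (2 * (N * N) + 2 * (N * k) + tri k + 3 * k) = q powi (tri (2 * N + k) + 2 * (2 * N + k) + k)"
        by (rule powi_eqI[OF assms(1)]) (simp add: tri_add t2 t2' algebra_simps)
      thus ?thesis using powi_add[OF assms(1), of "tri (2 * N + k) + 2 * (2 * N + k)" k] by (simp add: a_def mult_ac)
    qed
    thus ?thesis using has_sum_cmult_right[OF zN_has_sum[OF assms, of N], of "q powi (3 * N)"] by simp
  qed
  have in2: "((\<lambda>N. q powi (tri (2 * N + k) + 2 * (2 * N + k)) * a k) has_sum psi q / q * a k) UNIV" for k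
    by (intro has_sum_cmult_left psi_half_sum assms)
  define T where "T = infsum (\<lambda>(N, k). q powi (tri (2 * N + k) + 2 * (2 * N + k)) * a k) (UNIV \<times> UNIV)"
  have hT: "((\<lambda>(N, k). q powi (tri (2 * N + k) + 2 * (2 * N + k)) * a k) has_sum T) (UNIV \<times> UNIV)"
    unfolding T_def by (rule has_sum_infsum[OF sG])
  have 1: "((\<lambda>N. q powi (3 * N) * zN w q N) has_sum T) UNIV"
    by (rule has_sum_SigmaD[OF hT]) (use in1 in auto)
  have "((\<lambda>(k, N). q powi (tri (2 * N + k) + 2 * (2 * N + k)) * a k) has_sum T) (UNIV \<times> UNIV)"
    using hT by (subst (asm) has_sum_swap) (simp add: case_prod_unfold)
  hence 2: "((\<lambda>k. psi q / q * a k) has_sum T) UNIV"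
    by (rule has_sum_SigmaD) (use in2 in auto)
  moreover have "((\<lambda>k. psi q / q * a k) has_sum psi q / q * appell w q) UNIV"
    unfolding appell_def a_def by (intro has_sum_cmult_right has_sum_infsum appell_summable assms)
  ultimately have "T = psi q / q * appell w q" by (rule has_sum_unique)
  thus ?thesis using 1 by simp
qed

lemma hecke_has_sum:
  assumes "q \<noteq> 0" "norm q < 1"
  shows "((\<lambda>N. q powi (b * N) * hN q N) has_sum hecke q b) UNIV"
proof -
  have eq: "q powi (b * m) * hN q m = q powi (2 * m * m + b * m) * gs (q\<^sup>2) m" for m
    using powi_add[OF assms(1), of "2 * m * m" "b * m"] by (simp add: hN_def mult_ac)
  have "(\<lambda>m. q powi (2 * m * m + b * m) * gs (q\<^sup>2) m) summable_on UNIV"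
  proof (rule summable_on_norm_bound)
    show "(\<lambda>m::int. (\<bar>of_int m\<bar> + 1) * ((norm q powi (b + 2)) powi m * (norm q ^ 4) powi tri m)) summable_on UNIV"
      using assms by (intro summable_linear_theta) (auto simp: power_less_one_iff)
    fix m
    have e: "2 * m * m + b * m = (b + 2) * m + 4 * tri m" using two_tri[of m] by (simp add: algebra_simps)
    have "norm (q powi (2 * m * m + b * m) * gs (q\<^sup>2) m) = ((norm q powi (b + 2)) powi m * (norm q ^ 4) powi tri m) * norm (gs (q\<^sup>2) m)"
    proof -
      have nz: "norm q \<noteq> 0" using assms by simp
      have "norm q powi (2 * m * m + b * m) = norm q powi ((b + 2) * m) * norm q powi (4 * tri m)"
        using e powi_add[OF nz] by metis
      moreover have "(norm q powi (b + 2)) powi m = norm q powi ((b + 2) * m)" by (simp only: power_int_mult)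
      moreover have "(norm q ^ 4) powi tri m = norm q powi (4 * tri m)" by (simp add: power_int_power)
      ultimately show ?thesis by (simp only: norm_mult norm_powi)
    qed
    also have "\<dots> \<le> ((norm q powi (b + 2)) powi m * (norm q ^ 4) powi tri m) * (\<bar>of_int m\<bar> + 1)"
      by (intro mult_left_mono gs_bound norm_sq_less_one assms) auto
    finally show "norm (q powi (2 * m * m + b * m) * gs (q\<^sup>2) m) \<le> (\<bar>of_int m\<bar> + 1) * ((norm q powi (b + 2)) powi m * (norm q ^ 4) powi tri m)"
      by (simp only: mult_ac)
  qed
  thus ?thesis unfolding eq hecke_def by (rule has_sum_infsum)
qed

text \<open>The power q^6 collects q from the prefactor of the Hecke sum, q^2 from
  \<open>hecke_coefficients\<close> and q^3 from the index N - 1 of \<open>kap\<close>.\<close>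

theorem hecke_appell:
  assumes "q \<noteq> 0" "norm q < 1" "1 + w + w\<^sup>2 = 0"
  assumes K: "((\<lambda>N. q powi (3 * N) * kap w q N) has_sum K) UNIV"
  shows "euler (q ^ 15) * (q * hecke q 3) = psi q * appell w q + q ^ 6 * euler (q ^ 3) * K"
proof -
  have "((\<lambda>N. q powi (3 * (N - 1)) * kap w q (N - 1)) has_sum K) UNIV"
    using K has_sum_shift_int[of "\<lambda>N. q powi (3 * N) * kap w q N" "-1"] by simp
  hence "((\<lambda>N. q powi (3 * N) * zN w q N + (q ^ 5 * euler (q ^ 3)) * (q powi (3 * (N - 1)) * kap w q (N - 1))) has_sum
     psi q / q * appell w q + (q ^ 5 * euler (q ^ 3)) * K) UNIV"
    by (intro has_sum_add has_sum_cmult_right zN_sum assms)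
  moreover have "q powi (3 * N) * zN w q N + (q ^ 5 * euler (q ^ 3)) * (q powi (3 * (N - 1)) * kap w q (N - 1))
     = euler (q ^ 15) * (q powi (3 * N) * hN q N)" for N
  proof -
    have "q ^ 5 * q powi (3 * (N - 1)) = q powi (3 * N + 2)" by (rule powi_eqI_nat[OF assms(1)]) simp
    also have "\<dots> = q powi (3 * N) * q\<^sup>2" using powi_add[OF assms(1), of "3 * N" 2] by simp
    finally have e: "q ^ 5 * q powi (3 * (N - 1)) = q powi (3 * N) * q\<^sup>2" .
    have "(q ^ 5 * euler (q ^ 3)) * (q powi (3 * (N - 1)) * kap w q (N - 1)) = (q ^ 5 * q powi (3 * (N - 1))) * (euler (q ^ 3) * kap w q (N - 1))"
      by (simp only: mult_ac)
    also have "\<dots> = q powi (3 * N) * (q\<^sup>2 * euler (q ^ 3) * kap w q (N - 1))" unfolding e by (simp only: mult_ac)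
    finally have "q powi (3 * N) * zN w q N + (q ^ 5 * euler (q ^ 3)) * (q powi (3 * (N - 1)) * kap w q (N - 1))
      = q powi (3 * N) * (zN w q N + q\<^sup>2 * euler (q ^ 3) * kap w q (N - 1))" by (simp only: distrib_left)
    also have "\<dots> = q powi (3 * N) * (euler (q ^ 15) * hN q N)" unfolding hecke_coefficients[OF assms(1-3)] ..
    finally show ?thesis by (simp only: mult_ac)
  qed
  ultimately have "((\<lambda>N. euler (q ^ 15) * (q powi (3 * N) * hN q N)) has_sum psi q / q * appell w q + (q ^ 5 * euler (q ^ 3)) * K) UNIV"
    by simp
  moreover have "((\<lambda>N. euler (q ^ 15) * (q powi (3 * N) * hN q N)) has_sum euler (q ^ 15) * hecke q 3) UNIV"
    by (intro has_sum_cmult_right hecke_has_sum assms)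
  ultimately have "euler (q ^ 15) * hecke q 3 = psi q / q * appell w q + (q ^ 5 * euler (q ^ 3)) * K"
    using has_sum_unique by blast
  hence "q * (euler (q ^ 15) * hecke q 3) = q * (psi q / q * appell w q + (q ^ 5 * euler (q ^ 3)) * K)" by simp
  thus ?thesis using assms(1) by (simp add: algebra_simps eval_nat_numeral)
qed

subsection \<open>Kronecker's identity\<close>

text \<open>Locally uniform convergence of the partial products; continuity is used for the limit b
  -> 1 in \<open>kf_limit\<close>.\<close>

lemma isCont_qpoch_inf:
  assumes "norm p < 1"
  shows "isCont (\<lambda>x. qpoch_inf x p) y"
proof -
  define R where "R = norm y + 1"
  have "uniformly_convergent_on (cball 0 R) (\<lambda>N x. \<Sum>n<N. norm ((1 - p ^ n * x) - 1))"
  proof (rule Weierstrass_m_test')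
    show "summable (\<lambda>n. norm p ^ n * R)" using assms by (intro summable_mult2 summable_geometric) auto
    fix n and x :: complex assume "x \<in> cball 0 R"
    thus "norm (norm ((1 - p ^ n * x) - 1)) \<le> norm p ^ n * R"
      by (simp add: norm_mult norm_power mult_left_mono)
  qed
  hence "uniformly_convergent_on (cball 0 R) (\<lambda>N x. \<Prod>n<N. 1 - p ^ n * x)"
    by (intro Complex_Transcendental.uniformly_convergent_on_prod') (auto intro!: continuous_intros)
  then obtain l where l: "uniform_limit (cball 0 R) (\<lambda>N x. \<Prod>n<N. 1 - p ^ n * x) l sequentially"
    by (auto simp: uniformly_convergent_on_def)
  have "continuous_on (cball 0 R) l"
    by (rule uniform_limit_theorem[OF _ l]) (auto intro!: always_eventually continuous_intros)
  moreover have "l x = qpoch_inf x p" if "x \<in> cball 0 R" for x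
    using tendsto_uniform_limitI[OF l that] qpoch_LIMSEQ[OF assms, of x] LIMSEQ_unique
    unfolding qpoch_def by blast
  ultimately have "continuous_on (cball 0 R) (\<lambda>x. qpoch_inf x p)"
    using continuous_on_cong[of "cball 0 R" "cball 0 R" l "\<lambda>x. qpoch_inf x p"] by blast
  moreover have "y \<in> interior (cball 0 R)" by (simp add: R_def)
  ultimately show ?thesis by (rule continuous_on_interior)
qed

lemma norm_ratio_less:
  fixes x y :: complex
  assumes "norm x < norm y"
  shows "norm x / norm y < 1"
proof -
  have "norm y > 0" using assms norm_ge_zero[of x] by linarith
  thus ?thesis using assms by simp
qed

lemma jtheta_nonzero:
  assumes "norm p < norm z" "norm z < 1"
  shows "jtheta z p \<noteq> 0"
proof -
  have "norm p < 1" "norm (p / z) < 1" using assms norm_ratio_less[OF assms(1)] by (auto simp: norm_divide)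
  thus ?thesis using assms qpoch_inf_nonzero'[of p z] qpoch_inf_nonzero'[of p "p / z"] qpoch_inf_nonzero'[of p p]
    by (simp add: jtheta_def)
qed

section \<open>Cone sums as unconditional double sums\<close>

definition cone_term :: "(int \<Rightarrow> int \<Rightarrow> complex) \<Rightarrow> int \<times> int \<Rightarrow> complex" where
  "cone_term c = (\<lambda>(r, s). if r \<ge> 0 \<and> s \<ge> 0 then c r s else if r < 0 \<and> s < 0 then - c r s else 0)"

lemma cone_term_summable:
  assumes "(\<lambda>(a, b). c (int a) (int b)) summable_on UNIV"
    and "(\<lambda>(a, b). c (-1 - int a) (-1 - int b)) summable_on UNIV"
  shows "cone_term c summable_on UNIV"
proof -
  let ?A = "{(r, s). r \<ge> (0::int) \<and> s \<ge> (0::int)}" and ?B = "{(r, s). r < (0::int) \<and> s < (0::int)}"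
  have "cone_term c summable_on ?A \<longleftrightarrow> (\<lambda>(a, b). c (int a) (int b)) summable_on UNIV"
    by (rule summable_on_reindex_bij_witness[of _ "\<lambda>(a, b). (int a, int b)" "\<lambda>(r, s). (nat r, nat s)"])
       (auto simp: cone_term_def)
  hence 1: "cone_term c summable_on ?A" using assms by simp
  have "(\<lambda>x. - cone_term c x) summable_on ?B \<longleftrightarrow> (\<lambda>(a, b). c (-1 - int a) (-1 - int b)) summable_on UNIV"
    by (rule summable_on_reindex_bij_witness[of _ "\<lambda>(a, b). (-1 - int a, -1 - int b)" "\<lambda>(r, s). (nat (-1 - r), nat (-1 - s))"])
       (auto simp: cone_term_def)
  hence 2: "cone_term c summable_on ?B" using assms by (simp add: summable_on_uminus)
  have "cone_term c summable_on ?A \<union> ?B"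
    by (rule summable_on_Un_disjoint[OF 1 2]) auto
  also have "cone_term c summable_on ?A \<union> ?B \<longleftrightarrow> cone_term c summable_on UNIV"
    by (rule summable_on_cong_neutral) (auto simp: cone_term_def split: if_splits)
  finally show ?thesis .
qed

lemma csum_has_sum:
  assumes "(cone_term c has_sum T) UNIV"
  shows "(csum c has_sum T) UNIV"
proof -
  have "((\<lambda>(N, r). cone_term c (r, N - r)) has_sum T) (UNIV \<times> UNIV) \<longleftrightarrow> (cone_term c has_sum T) UNIV"
    by (rule has_sum_reindex_bij_witness[of _ "\<lambda>(r, s). (r + s, r)" "\<lambda>(N, r). (r, N - r)"]) auto
  hence "((\<lambda>(N, r). cone_term c (r, N - r)) has_sum T) (UNIV \<times> UNIV)" using assms by simp
  thus ?thesis
  proof (rule has_sum_SigmaD)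
    fix N :: int
    show "((\<lambda>r. case (N, r) of (N, r) \<Rightarrow> cone_term c (r, N - r)) has_sum csum c N) UNIV"
    proof (cases "N \<ge> 0")
      case True
      show ?thesis by (rule has_sum_finite_neutralI[of "{0..N}"])
        (use True in \<open>auto simp: cone_term_def csum_def intro!: sum.cong\<close>)
    next
      case False
      show ?thesis by (rule has_sum_finite_neutralI[of "{N+1..-1}"])
        (use False in \<open>auto simp: cone_term_def csum_def sum_negf[symmetric] intro!: sum.cong\<close>)
    qed
  qed
qed

lemma cone_term_swap:
  assumes "(cone_term c has_sum T) UNIV"
  shows "(cone_term (\<lambda>r s. c s r) has_sum T) UNIV"
proof -
  have "(cone_term c has_sum T) UNIV \<longleftrightarrow> (cone_term (\<lambda>r s. c s r) has_sum T) UNIV"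
    by (rule has_sum_reindex_bij_witness[of _ prod.swap prod.swap]) (auto simp: cone_term_def)
  thus ?thesis using assms by simp
qed

definition krc :: "complex \<Rightarrow> complex \<Rightarrow> complex \<Rightarrow> int \<Rightarrow> int \<Rightarrow> complex" where
  "krc a b p r s = a powi r * b powi s * p powi (r * s)"

lemma geometric_pair_summable:
  fixes x y :: real
  assumes "0 \<le> x" "x < 1" "0 \<le> y" "y < 1"
  shows "(\<lambda>(a::nat, b::nat). x ^ a * y ^ b) summable_on UNIV"
proof -
  have "(\<lambda>a. x ^ a) summable_on UNIV" "(\<lambda>b. y ^ b) summable_on UNIV"
    using assms by (auto intro!: summable_nonneg_imp_summable_on summable_geometric)
  from summable_on_product[OF this] show ?thesis using assms by simp
qed

lemma krc_summable:
  assumes "p \<noteq> 0" "norm p < norm a" "norm a < 1" "norm p < norm b" "norm b < 1"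
  shows "cone_term (krc a b p) summable_on UNIV"
proof (rule cone_term_summable)
  have p1: "norm p < 1" using assms by simp
  show "(\<lambda>(i, j). krc a b p (int i) (int j)) summable_on UNIV"
  proof (rule summable_on_norm_bound[OF geometric_pair_summable[of "norm a" "norm b"]], safe)
    fix i j :: nat
    have "norm (krc a b p (int i) (int j)) = norm a ^ i * norm b ^ j * norm p ^ (i * j)"
      by (simp add: krc_def norm_mult norm_powi norm_power flip: of_nat_mult)
    also have "\<dots> \<le> norm a ^ i * norm b ^ j * 1"
      using p1 by (intro mult_left_mono) (auto simp: power_le_one)
    finally show "norm (krc a b p (int i) (int j)) \<le> norm a ^ i * norm b ^ j" by simp
  qed (use assms in auto)
  have "(\<lambda>x. norm (p / (a * b)) * (case x of (i::nat, j::nat) \<Rightarrow> (norm p / norm a) ^ i * (norm p / norm b) ^ j)) summable_on UNIV"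
    using norm_ratio_less[OF assms(2)] norm_ratio_less[OF assms(4)]
    by (intro summable_on_cmult_right geometric_pair_summable) auto
  thus "(\<lambda>(i, j). krc a b p (-1 - int i) (-1 - int j)) summable_on UNIV"
  proof (rule summable_on_norm_bound, clarify)
    fix i j :: nat
    have nz: "a \<noteq> 0" "b \<noteq> 0" using assms by auto
    have e: "a powi (-1 - int i) = inverse (a ^ Suc i)" "b powi (-1 - int j) = inverse (b ^ Suc j)"
      using nz by (simp_all add: power_int_diff power_int_minus field_simps)
    have "(-1 - int i) * (-1 - int j) = int (Suc i * Suc j)" by (simp add: algebra_simps)
    hence f: "p powi ((-1 - int i) * (-1 - int j)) = p ^ (Suc i * Suc j)" by (simp only: power_int_of_nat)
    have "norm (krc a b p (-1 - int i) (-1 - int j)) = norm p ^ (Suc i * Suc j) / (norm a ^ Suc i * norm b ^ Suc j)"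
      unfolding krc_def e f by (simp add: norm_mult norm_power norm_inverse norm_divide field_simps)
    \<comment> \<open>The inequality (i + 1)(j + 1) >= 1 + i + j leaves a power of p that can be
      shared between the two geometric ratios p / a and p / b.\<close>
    also have "\<dots> \<le> norm p ^ (1 + i + j) / (norm a ^ Suc i * norm b ^ Suc j)"
      using p1 by (intro divide_right_mono power_decreasing) auto
    also have "\<dots> = norm (p / (a * b)) * ((norm p / norm a) ^ i * (norm p / norm b) ^ j)"
      using nz by (simp add: norm_divide norm_mult power_add power_divide)
    finally show "norm (krc a b p (-1 - int i) (-1 - int j)) \<le> norm (p / (a * b)) * ((norm p / norm a) ^ i * (norm p / norm b) ^ j)" .
  qed
qed

lemma has_sum_geometric_nonneg:
  assumes "norm (x :: complex) < 1"
  shows "((\<lambda>s::int. if s \<ge> 0 then x powi s else 0) has_sum 1 / (1 - x)) UNIV"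
proof -
  have "((\<lambda>n. x ^ n) has_sum 1 / (1 - x)) UNIV"
    using assms by (intro norm_summable_imp_has_sum) (auto simp: norm_power summable_geometric geometric_sums)
  also have "?this \<longleftrightarrow> ((\<lambda>s::int. x powi s) has_sum 1 / (1 - x)) {0..}"
    by (rule has_sum_reindex_bij_witness[of _ nat int]) auto
  also have "\<dots> \<longleftrightarrow> ((\<lambda>s::int. if s \<ge> 0 then x powi s else 0) has_sum 1 / (1 - x)) UNIV"
    by (rule has_sum_cong_neutral) auto
  finally show ?thesis .
qed

lemma has_sum_geometric_neg:
  assumes "norm (x :: complex) > 1"
  shows "((\<lambda>s::int. if s < 0 then - (x powi s) else 0) has_sum 1 / (1 - x)) UNIV"
proof -
  have x: "x \<noteq> 0" using assms by auto
  have "((\<lambda>s::int. (- inverse x) * (if s \<ge> 0 then (inverse x) powi s else 0)) has_sum (- inverse x) * (1 / (1 - inverse x))) UNIV"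
    using assms by (intro has_sum_cmult_right has_sum_geometric_nonneg) (auto simp: norm_inverse inverse_less_1_iff)
  also have "(- inverse x) * (1 / (1 - inverse x)) = 1 / (1 - x)"
  proof -
    have "inverse x * (1 / (1 - inverse x)) = 1 / (x - 1)" using x by (simp add: field_simps)
    thus ?thesis by (metis minus_diff_eq minus_divide_right mult_minus_left)
  qed
  also have "((\<lambda>s::int. (- inverse x) * (if s \<ge> 0 then (inverse x) powi s else 0)) has_sum 1 / (1 - x)) UNIV \<longleftrightarrow>
    ((\<lambda>s::int. if s < 0 then - (x powi s) else 0) has_sum 1 / (1 - x)) UNIV"
  proof (rule has_sum_reindex_bij_witness[of _ "\<lambda>s. -1 - s" "\<lambda>s. -1 - s"])
    fix s :: int
    have "x powi (-1 - s) = inverse x * (inverse x) powi s"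
      using x by (simp add: power_int_diff power_int_inverse field_simps power_int_minus)
    thus "(if -1 - s < 0 then - (x powi (-1 - s)) else 0) = (- inverse x) * (if s \<ge> 0 then (inverse x) powi s else 0)"
      by simp
  qed auto
  finally show ?thesis .
qed

text \<open>In row r the ratio b p^r has norm below 1 for r >= 0 and above 1 for r < 0. The sum over
  s >= 0 in the first case and minus the sum over s < 0 in the second are both 1 / (1 - b p^r); this
  is what the sign of the negative quadrant achieves.\<close>

lemma krc_rows:
  assumes "p \<noteq> 0" "norm p < norm a" "norm a < 1" "norm p < norm b" "norm b < 1"
    and T: "(cone_term (krc a b p) has_sum T) UNIV"
  shows "((\<lambda>r. a powi r / (1 - b * p powi r)) has_sum T) UNIV"
proof -
  have "(cone_term (krc a b p) has_sum T) (UNIV \<times> UNIV)" using T by simp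
  thus ?thesis
  proof (rule has_sum_SigmaD)
    fix r :: int
    have p1: "norm p < 1" using assms by simp
    have e: "krc a b p r s = a powi r * (b * p powi r) powi s" for s
      by (simp add: krc_def power_int_mult_distrib power_int_mult)
    show "((\<lambda>s. cone_term (krc a b p) (r, s)) has_sum a powi r / (1 - b * p powi r)) UNIV"
    proof (cases "r \<ge> 0")
      case True
      have "norm (b * p powi r) < 1"
      proof -
        have "norm p powi r \<le> 1" using True p1 by (intro power_int_le_one) auto
        hence "norm b * norm p powi r \<le> norm b" by (simp add: mult_left_le)
        thus ?thesis using assms by (simp add: norm_mult norm_powi)
      qed
      from has_sum_cmult_right[OF has_sum_geometric_nonneg[OF this], of "a powi r"]
      show ?thesis using True by (simp add: cone_term_def e if_distrib[of "(*) (a powi r)"] cong: if_cong)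
    next
      case False
      have "norm (b * p powi r) > 1"
      proof -
        have "norm p powi r \<ge> norm p powi (-1)" using False p1 assms by (intro power_int_decreasing) auto
        hence "norm b * norm p powi r \<ge> norm b * norm p powi (-1)" by (intro mult_left_mono) auto
        moreover have "norm b * norm p powi (-1) > 1" using assms by (simp add: power_int_minus field_simps)
        ultimately show ?thesis by (simp add: norm_mult norm_powi)
      qed
      from has_sum_cmult_right[OF has_sum_geometric_neg[OF this], of "a powi r"]
      show ?thesis using False by (simp add: cone_term_def e if_distrib[of "(*) (a powi r)"] cong: if_cong)
    qed
  qed
qed

section \<open>Coefficients of the theta series times the row series\<close>

definition tc :: "complex \<Rightarrow> int \<Rightarrow> complex" where
  "tc p n = (-1) powi n * p powi tri n"

lemma tc_jtheta:
  assumes "p \<noteq> 0" "norm p < 1" "z \<noteq> 0"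
  shows "((\<lambda>n. tc p n * z powi n) has_sum jtheta z p) UNIV"
proof -
  have "(- z) powi n = (-1) powi n * z powi n" for n using power_int_mult_distrib[of "-1" z n] by simp
  thus ?thesis using jacobi_triple_product[OF assms(3,1,2)] by (simp add: tc_def mult_ac)
qed

lemma tc_Suc:
  assumes "p \<noteq> 0"
  shows "tc p (n + 1) = - (p powi n * tc p n)"
proof -
  have "tri (n + 1) = tri n + n" using tri_add[of n 1] by simp
  thus ?thesis using assms by (simp add: tc_def power_int_add)
qed

lemma tc_norm_summable:
  assumes "p \<noteq> 0" "norm p < 1" "z \<noteq> 0"
  shows "(\<lambda>n. norm (tc p n * z powi n)) summable_on UNIV"
  using summable_int_theta[of "norm z" "norm p"] assms by (simp add: tc_def norm_mult norm_powi mult.commute)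

text \<open>The coefficient of a^N in the product of j(a; p) with the series of a^n / (1 - b
  p^n).\<close>

definition kf :: "complex \<Rightarrow> complex \<Rightarrow> int \<Rightarrow> complex" where
  "kf p b N = (\<Sum>\<^sub>\<infinity>n. tc p (N - n) / (1 - b * p powi n))"

lemma one_minus_bound:
  fixes p b :: complex
  assumes "p \<noteq> 0" "norm p < norm b" "norm b < 1" "n \<noteq> 0"
    and "d \<le> 1 - norm p" "d \<le> norm b / norm p - 1"
  shows "norm (1 - b * p powi n) \<ge> d"
proof (cases "n > 0")
  case True
  have "norm p powi n \<le> norm p powi 1" using True assms by (intro power_int_decreasing) auto
  hence "norm b * norm p powi n \<le> 1 * norm p" using assms by (intro mult_mono) auto
  moreover have "norm (1 - b * p powi n) \<ge> norm (1::complex) - norm (b * p powi n)" by (rule norm_triangle_ineq2)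
  ultimately show ?thesis using assms by (simp add: norm_mult norm_powi)
next
  case False
  have "norm p powi n \<ge> norm p powi (-1)" using False assms by (intro power_int_decreasing) auto
  hence "norm b * norm p powi n \<ge> norm b * norm p powi (-1)" by (intro mult_left_mono) auto
  moreover have "norm (b * p powi n - 1) \<ge> norm (b * p powi n) - norm (1::complex)" by (rule norm_triangle_ineq2)
  ultimately show ?thesis using assms by (simp add: norm_mult norm_powi power_int_minus norm_minus_commute divide_inverse)
qed

lemma tc_shift_summable:
  assumes "p \<noteq> 0" "norm p < 1"
  shows "(\<lambda>n. norm (tc p (N - n))) summable_on UNIV"
  using tc_norm_summable[OF assms, of 1] summable_reflect_int[of "\<lambda>n. norm (tc p n)" N] by simp

lemma kf_summable:
  assumes "p \<noteq> 0" "norm p < norm b" "norm b < 1"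
  shows "(\<lambda>n. tc p (N - n) / (1 - b * p powi n)) summable_on UNIV"
proof -
  define d where "d = min (1 - norm b) (min (1 - norm p) (norm b / norm p - 1))"
  have d: "d > 0" using assms by (simp add: d_def field_simps)
  have p1: "norm p < 1" using assms by simp
  have bd: "norm (1 - b * p powi n) \<ge> d" for n
  proof (cases "n = 0")
    case True
    thus ?thesis using norm_triangle_ineq2[of 1 b] by (simp add: d_def)
  next
    case False
    thus ?thesis using assms by (intro one_minus_bound) (auto simp: d_def)
  qed
  show ?thesis
  proof (rule summable_on_norm_bound)
    show "(\<lambda>n. inverse d * norm (tc p (N - n))) summable_on UNIV"
      by (intro summable_on_cmult_right tc_shift_summable assms p1)
    fix n
    have "norm (tc p (N - n)) / norm (1 - b * p powi n) \<le> norm (tc p (N - n)) / d"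
      using bd[of n] d by (intro divide_left_mono) (auto intro: mult_pos_pos less_le_trans)
    thus "norm (tc p (N - n) / (1 - b * p powi n)) \<le> inverse d * norm (tc p (N - n))"
      by (simp add: norm_divide field_simps)
  qed
qed

lemma one_minus_nonzero:
  fixes p b :: complex
  assumes "p \<noteq> 0" "norm p < norm b" "norm b < 1"
  shows "1 - b * p powi n \<noteq> 0"
proof (cases "n = 0")
  case True thus ?thesis using assms by auto
next
  case False
  define d where "d = min (1 - norm p) (norm b / norm p - 1)"
  have "d > 0" using assms by (simp add: d_def field_simps)
  moreover have "norm (1 - b * p powi n) \<ge> d" using assms False by (intro one_minus_bound) (auto simp: d_def)
  ultimately show ?thesis by auto
qed

text \<open>In \<open>kf p b (N + 1)\<close> plus b p^N times \<open>kf p b N\<close> the numerators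
  acquire the factor 1 - b p^n, which cancels the denominators. What remains is a theta series with
  value - j(p; p) = 0.\<close>

lemma kf_rec:
  assumes "p \<noteq> 0" "norm p < norm b" "norm b < 1"
  shows "kf p b (N + 1) = - (b * p powi N * kf p b N)"
proof -
  have p1: "norm p < 1" using assms by simp
  have "((\<lambda>n. tc p n * p powi n) has_sum jtheta p p) UNIV" by (rule tc_jtheta[OF assms(1) p1 assms(1)])
  moreover have "jtheta p p = 0"
    using assms(1) qpoch_inf_head[OF p1, of 1] by (simp add: jtheta_def)
  ultimately have "((\<lambda>n. tc p n * p powi n) has_sum 0) UNIV" by simp
  hence "((\<lambda>n. tc p (N - n) * p powi (N - n)) has_sum 0) UNIV"
    by (subst has_sum_reflect_int[of "\<lambda>n. tc p n * p powi n"])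
  from has_sum_cmult_right[OF this, of "-1"]
  have z: "((\<lambda>n. - (tc p (N - n) * p powi (N - n))) has_sum 0) UNIV" by simp
  have k: "((\<lambda>n. tc p (N - n) / (1 - b * p powi n)) has_sum kf p b N) UNIV"
    unfolding kf_def by (rule has_sum_infsum[OF kf_summable[OF assms]])
  have "((\<lambda>n. - (tc p (N - n) * p powi (N - n)) + (- (b * p powi N)) * (tc p (N - n) / (1 - b * p powi n))) has_sum
     0 + (- (b * p powi N)) * kf p b N) UNIV"
    by (intro has_sum_add has_sum_cmult_right z k)
  also have "(\<lambda>n. - (tc p (N - n) * p powi (N - n)) + (- (b * p powi N)) * (tc p (N - n) / (1 - b * p powi n)))
    = (\<lambda>n. tc p (N + 1 - n) / (1 - b * p powi n))"
  proof
    fix n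
    have nz: "1 - b * p powi n \<noteq> 0" by (rule one_minus_nonzero[OF assms])
    have e: "p powi (N - n) * p powi n = p powi N" by (rule powi_eqI[OF assms(1)]) simp
    have "tc p (N + 1 - n) = - (p powi (N - n) * tc p (N - n))" using tc_Suc[OF assms(1), of "N - n"] by (simp add: algebra_simps)
    moreover have "- (tc p (N - n) * p powi (N - n)) + (- (b * p powi N)) * (tc p (N - n) / (1 - b * p powi n))
      = - (p powi (N - n) * tc p (N - n)) / (1 - b * p powi n)"
      unfolding e[symmetric] using nz by (simp add: field_simps)
    ultimately show "- (tc p (N - n) * p powi (N - n)) + (- (b * p powi N)) * (tc p (N - n) / (1 - b * p powi n))
      = tc p (N + 1 - n) / (1 - b * p powi n)" by simp
  qed
  finally have "((\<lambda>n. tc p (N + 1 - n) / (1 - b * p powi n)) has_sum - (b * p powi N * kf p b N)) UNIV" by simp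
  thus ?thesis unfolding kf_def[of p b "N + 1"] by (rule infsumI)
qed

lemma kf_closed:
  assumes "p \<noteq> 0" "norm p < norm b" "norm b < 1"
  shows "kf p b N = tc p N * b powi N * kf p b 0"
proof (induction N rule: int_induct[where k = 0])
  case base show ?case by (simp add: tc_def)
next
  case (step1 i)
  have "b \<noteq> 0" using assms by auto
  thus ?case unfolding kf_rec[OF assms] step1 tc_Suc[OF assms(1)] by (simp add: power_int_add)
next
  case (step2 i)
  have b: "b \<noteq> 0" using assms by auto
  have k: "kf p b i = - (b * p powi (i - 1) * kf p b (i - 1))" using kf_rec[OF assms, of "i - 1"] by simp
  have "tc p i = - (p powi (i - 1) * tc p (i - 1))" using tc_Suc[OF assms(1), of "i - 1"] by simp
  moreover have "b powi i = b * b powi (i - 1)" using powi_add[OF b, of 1 "i - 1"] by simp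
  ultimately have e: "tc p i * b powi i = - ((b * p powi (i - 1)) * (tc p (i - 1) * b powi (i - 1)))" by (simp add: mult_ac)
  have "(b * p powi (i - 1)) * kf p b (i - 1) = - kf p b i" unfolding k by simp
  also have "kf p b i = tc p i * b powi i * kf p b 0" by (rule step2)
  also have "- \<dots> = (b * p powi (i - 1)) * (tc p (i - 1) * b powi (i - 1) * kf p b 0)"
    unfolding e by (simp only: mult_minus_left mult_minus_right minus_minus mult_ac)
  finally have "(b * p powi (i - 1)) * kf p b (i - 1) = (b * p powi (i - 1)) * (tc p (i - 1) * b powi (i - 1) * kf p b 0)" .
  moreover have "b * p powi (i - 1) \<noteq> 0" using b assms by simp
  ultimately show ?case using mult_left_cancel by blast
qed

text \<open>Collecting powers of a in the product of the two series gives the coefficients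
  \<open>kf p b N\<close>, and by \<open>kf_closed\<close> these are proportional to the
  coefficients of j(a b; p).\<close>

lemma kronecker_aux:
  assumes "p \<noteq> 0" "norm p < norm a" "norm a < 1" "norm p < norm b" "norm b < 1"
    and T: "(cone_term (krc a b p) has_sum T) UNIV"
  shows "jtheta a p * T = kf p b 0 * jtheta (a * b) p"
proof -
  have p1: "norm p < 1" and a: "a \<noteq> 0" and b: "b \<noteq> 0" using assms by auto
  let ?g = "\<lambda>n. a powi n / (1 - b * p powi n)"
  have g: "(?g has_sum T) UNIV" by (rule krc_rows[OF assms])
  hence "?g summable_on UNIV" by (rule has_sum_imp_summable)
  hence gn: "(\<lambda>n. norm (?g n)) summable_on UNIV" by (simp add: summable_on_iff_abs_summable_on_complex)
  have "(\<lambda>(m, n). norm (tc p m * a powi m) * norm (?g n)) summable_on UNIV \<times> UNIV"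
    by (intro summable_on_product tc_norm_summable gn assms(1) p1 a) auto
  hence s: "(\<lambda>(m, n). (tc p m * a powi m) * ?g n) summable_on UNIV \<times> UNIV"
    by (rule summable_on_norm_bound, clarify) (simp only: norm_mult[symmetric])
  have "((\<lambda>(m, n). (tc p m * a powi m) * ?g n) has_sum jtheta a p * T) (UNIV \<times> UNIV)"
  proof (rule has_sum_SigmaI[OF _ _ s])
    fix m
    show "((\<lambda>n. case (m, n) of (m, n) \<Rightarrow> (tc p m * a powi m) * ?g n) has_sum (tc p m * a powi m) * T) UNIV"
      using has_sum_cmult_right[OF g, of "tc p m * a powi m"] by simp
    show "((\<lambda>m. (tc p m * a powi m) * T) has_sum jtheta a p * T) UNIV"
      by (intro has_sum_cmult_left tc_jtheta assms(1) p1 a)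
  qed
  also have "?this \<longleftrightarrow> ((\<lambda>(N, n). a powi N * (tc p (N - n) / (1 - b * p powi n))) has_sum jtheta a p * T) (UNIV \<times> UNIV)"
  proof (rule has_sum_reindex_bij_witness[of _ "\<lambda>(N, n). (N - n, n)" "\<lambda>(m, n). (m + n, n)"])
    fix x :: "int \<times> int"
    obtain m n where x: "x = (m, n)" by (cases x)
    show "(case (case x of (m, n) \<Rightarrow> (m + n, n)) of (N, n) \<Rightarrow> a powi N * (tc p (N - n) / (1 - b * p powi n)))
      = (case x of (m, n) \<Rightarrow> (tc p m * a powi m) * ?g n)"
      using powi_add[OF a, of m n] by (simp add: x mult_ac)
  qed auto
  finally have "((\<lambda>N. a powi N * kf p b N) has_sum jtheta a p * T) UNIV"
  proof (rule has_sum_SigmaD)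
    fix N
    show "((\<lambda>n. case (N, n) of (N, n) \<Rightarrow> a powi N * (tc p (N - n) / (1 - b * p powi n))) has_sum a powi N * kf p b N) UNIV"
      unfolding kf_def using has_sum_cmult_right[OF has_sum_infsum[OF kf_summable[OF assms(1,4,5)]], of "a powi N" N] by simp
  qed
  moreover have "a powi N * kf p b N = kf p b 0 * (tc p N * (a * b) powi N)" for N
    using kf_closed[OF assms(1,4,5), of N] by (simp add: power_int_mult_distrib)
  moreover have "((\<lambda>N. kf p b 0 * (tc p N * (a * b) powi N)) has_sum kf p b 0 * jtheta (a * b) p) UNIV"
    using a b by (intro has_sum_cmult_right tc_jtheta assms(1) p1) auto
  ultimately show ?thesis using has_sum_unique by auto
qed

text \<open>By symmetry in \<open>a\<close> and \<open>b\<close>, the product \<open>kf p b 0 * jtheta b p\<close> does not depend on \<open>b\<close>; its value is found as \<open>b\<close> tends to 1.\<close>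

lemma kf_limit:
  assumes "p \<noteq> 0" "norm p < 1"
  shows "(\<lambda>k. kf p (of_real (1 - inverse (real (Suc k)))) 0 * jtheta (of_real (1 - inverse (real (Suc k)))) p) \<longlonglongrightarrow> euler p ^ 3"
proof -
  define a :: "nat \<Rightarrow> complex" where "a = (\<lambda>k. of_real (1 - inverse (real (Suc k))))"
  have a1: "a \<longlonglongrightarrow> 1"
  proof -
    have "(\<lambda>k. 1 - inverse (real (Suc k))) \<longlonglongrightarrow> 1 - 0" by (intro tendsto_intros LIMSEQ_inverse_real_of_nat)
    from tendsto_of_real[OF this, where 'a = complex] show ?thesis by (simp add: a_def)
  qed
  \<comment> \<open>Only the term n = 0 has a pole at b = 1; the other terms stay bounded and
    disappear after multiplication by 1 - b.\<close>
  define rest where "rest = (\<lambda>k. \<Sum>\<^sub>\<infinity>n\<in>UNIV - {0}. tc p (0 - n) / (1 - a k * p powi n))"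
  \<comment> \<open>A lower bound for the denominators with n different from 0, uniform over all k
    for which the norm of \<open>a k\<close> exceeds (1 + norm p) / 2.\<close>
  define d where "d = (1 - norm p) / 2"
  define M where "M = (\<Sum>\<^sub>\<infinity>n\<in>UNIV - {0}. norm (tc p (0 - n)))"
  have d: "d > 0" using assms by (simp add: d_def)
  have na: "norm (a k) = 1 - inverse (real (Suc k))" for k
  proof -
    have "inverse (real (Suc k)) \<le> 1" by (simp add: field_simps)
    thus ?thesis by (simp add: a_def del: of_real_diff)
  qed
  have "(\<lambda>k. norm (a k)) \<longlonglongrightarrow> 1" using tendsto_norm[OF a1] by simp
  hence ev: "eventually (\<lambda>k. norm (a k) > (1 + norm p) / 2) sequentially"
    using assms by (intro order_tendstoD(1)) auto
  have step: "norm ((1 - a k) * kf p (a k) 0 - 1) \<le> norm (1 - a k) * (M / d)" if k: "norm (a k) > (1 + norm p) / 2" for k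
  proof -
    have ak: "norm p < norm (a k)" "norm (a k) < 1" using k assms na[of k] by auto
    have bd: "norm (1 - a k * p powi n) \<ge> d" if "n \<noteq> 0" for n
    proof (rule one_minus_bound[OF assms(1) ak that])
      show "d \<le> 1 - norm p" using assms by (simp add: d_def)
      have "norm (a k) \<ge> norm p + d" using k by (simp add: d_def field_simps)
      also have "norm p + d \<ge> norm p + d * norm p" using d assms by (simp add: mult_left_le)
      finally have "norm (a k) \<ge> norm p + d * norm p" by simp
      thus "d \<le> norm (a k) / norm p - 1" using assms(1) by (simp add: field_simps)
    qed
    have "{0} \<union> (UNIV - {0}) = (UNIV :: int set)" by auto
    moreover have "(\<Sum>\<^sub>\<infinity>n\<in>{0} \<union> (UNIV - {0}). tc p (0 - n) / (1 - a k * p powi n))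
       = (\<Sum>\<^sub>\<infinity>n\<in>{0}. tc p (0 - n) / (1 - a k * p powi n)) + rest k"
      unfolding rest_def
      by (rule infsum_Un_disjoint) (auto intro!: summable_on_subset_banach[OF kf_summable[OF assms(1) ak, of 0], simplified])
    ultimately have "kf p (a k) 0 = 1 / (1 - a k) + rest k" by (simp add: kf_def tc_def)
    moreover have "1 - a k \<noteq> 0" using ak by auto
    ultimately have "(1 - a k) * kf p (a k) 0 - 1 = (1 - a k) * rest k" by (simp add: field_simps)
    moreover have "norm (rest k) \<le> M / d"
    proof -
      have s: "(\<lambda>n. norm (tc p (0 - n))) summable_on UNIV - {0}"
        by (rule summable_on_subset_banach[OF tc_shift_summable[OF assms]]) auto
      have "norm (rest k) \<le> (\<Sum>\<^sub>\<infinity>n\<in>UNIV - {0}. inverse d * norm (tc p (0 - n)))"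
        unfolding rest_def
      proof (rule infsum_norm_le)
        show "(\<lambda>n. inverse d * norm (tc p (0 - n))) summable_on UNIV - {0}"
          by (intro summable_on_cmult_right s)
        fix n :: int assume "n \<in> UNIV - {0}"
        hence "norm (1 - a k * p powi n) \<ge> d" using bd by auto
        hence "norm (tc p (0 - n)) / norm (1 - a k * p powi n) \<le> norm (tc p (0 - n)) / d"
          using d by (intro divide_left_mono) (auto intro: mult_pos_pos less_le_trans)
        thus "norm (tc p (0 - n) / (1 - a k * p powi n)) \<le> inverse d * norm (tc p (0 - n))"
          by (simp add: norm_divide field_simps)
      qed
      also have "\<dots> = inverse d * M" unfolding M_def by (rule infsum_cmult_right')
      finally show ?thesis by (simp add: field_simps)
    qed
    ultimately show ?thesis by (simp only: norm_mult) (rule mult_left_mono, auto)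
  qed
  have "(\<lambda>k. norm (1 - a k) * (M / d)) \<longlonglongrightarrow> norm (1 - 1 :: complex) * (M / d)"
    by (intro tendsto_intros a1)
  hence "(\<lambda>k. norm (1 - a k) * (M / d)) \<longlonglongrightarrow> 0" by simp
  hence "(\<lambda>k. (1 - a k) * kf p (a k) 0 - 1) \<longlonglongrightarrow> 0"
    by (rule Lim_null_comparison[rotated]) (use ev step in \<open>auto elim!: eventually_mono\<close>)
  hence l1: "(\<lambda>k. (1 - a k) * kf p (a k) 0) \<longlonglongrightarrow> 1" by (simp add: LIM_zero_iff)
  have l2: "(\<lambda>k. qpoch_inf (p * a k) p) \<longlonglongrightarrow> qpoch_inf (p * 1) p"
    by (rule isCont_tendsto_compose[OF isCont_qpoch_inf[OF assms(2)]]) (intro tendsto_intros a1)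
  have l3: "(\<lambda>k. qpoch_inf (p / a k) p) \<longlonglongrightarrow> qpoch_inf (p / 1) p"
    by (rule isCont_tendsto_compose[OF isCont_qpoch_inf[OF assms(2)]]) (intro tendsto_intros a1, simp)
  have L: "(\<lambda>k. (1 - a k) * kf p (a k) 0 * (qpoch_inf (p * a k) p * qpoch_inf (p / a k) p * euler p)) \<longlonglongrightarrow>
     1 * (qpoch_inf (p * 1) p * qpoch_inf (p / 1) p * euler p)"
    by (intro tendsto_intros l1 l2 l3)
  have E: "(1 - a k) * kf p (a k) 0 * (qpoch_inf (p * a k) p * qpoch_inf (p / a k) p * euler p) = kf p (a k) 0 * jtheta (a k) p" for k
    unfolding jtheta_def qpoch_inf_head[OF assms(2), of "a k"] by (simp only: mult_ac)
  have "(\<lambda>k. kf p (a k) 0 * jtheta (a k) p) \<longlonglongrightarrow> euler p ^ 3"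
    using L unfolding E by (simp only: mult_1_left mult_1_right div_by_1 power3_eq_cube)
  thus ?thesis unfolding a_def .
qed

theorem kronecker:
  assumes "p \<noteq> 0" "norm p < norm a" "norm a < 1" "norm p < norm b" "norm b < 1"
    and T: "(cone_term (krc a b p) has_sum T) UNIV"
  shows "jtheta a p * jtheta b p * T = euler p ^ 3 * jtheta (a * b) p"
proof -
  have p1: "norm p < 1" using assms by simp
  define x :: "nat \<Rightarrow> complex" where "x = (\<lambda>k. of_real (1 - inverse (real (Suc k))))"
  have nx: "norm (x k) = 1 - inverse (real (Suc k))" for k
  proof -
    have "inverse (real (Suc k)) \<le> 1" by (simp add: field_simps)
    thus ?thesis by (simp add: x_def del: of_real_diff)
  qed
  have "(\<lambda>k. 1 - inverse (real (Suc k))) \<longlonglongrightarrow> 1 - 0" by (intro tendsto_intros LIMSEQ_inverse_real_of_nat)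
  hence lx: "(\<lambda>k. norm (x k)) \<longlonglongrightarrow> 1" unfolding nx by simp
  have "norm p / norm b < 1" by (rule norm_ratio_less[OF assms(4)])
  \<comment> \<open>The first condition keeps \<open>x k * b\<close> inside the annulus where the
    theta function has no zero, so that j(x_k b; p) can be cancelled; the second is the hypothesis
    of \<open>kronecker_aux\<close> for \<open>x k\<close>.\<close>
  hence ev: "eventually (\<lambda>k. norm (x k) > norm p / norm b \<and> norm (x k) > norm p) sequentially"
    using order_tendstoD(1)[OF lx] p1 by (intro eventually_conj) auto
  have "kf p (x k) 0 * jtheta (x k) p = kf p b 0 * jtheta b p" if k: "norm (x k) > norm p / norm b \<and> norm (x k) > norm p" for k
  proof -
    have xk: "norm p < norm (x k)" "norm (x k) < 1" using k nx[of k] by auto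
    have "cone_term (krc (x k) b p) summable_on UNIV"
      by (rule krc_summable[OF assms(1) xk assms(4,5)])
    then obtain S where S: "(cone_term (krc (x k) b p) has_sum S) UNIV" by (auto simp: summable_on_def)
    have S': "(cone_term (krc b (x k) p) has_sum S) UNIV"
    proof -
      have "(\<lambda>r s. krc (x k) b p s r) = krc b (x k) p" by (simp add: fun_eq_iff krc_def mult_ac)
      thus ?thesis using cone_term_swap[OF S] by simp
    qed
    have e1: "jtheta (x k) p * S = kf p b 0 * jtheta (x k * b) p"
      by (rule kronecker_aux[OF assms(1) xk assms(4,5) S])
    have e2: "jtheta b p * S = kf p (x k) 0 * jtheta (x k * b) p"
      using kronecker_aux[OF assms(1,4,5) xk S'] by (simp add: mult.commute)
    have "norm b > 0" using assms(4) norm_ge_zero[of p] by linarith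
    hence "norm p < norm (x k * b)" using k by (simp add: norm_mult pos_divide_less_eq)
    moreover have "norm (x k * b) < 1"
    proof -
      have "norm (x k) * norm b \<le> 1 * norm b" using xk by (intro mult_right_mono) auto
      thus ?thesis using assms by (simp add: norm_mult)
    qed
    ultimately have nz: "jtheta (x k * b) p \<noteq> 0" by (rule jtheta_nonzero)
    have "kf p (x k) 0 * jtheta (x k) p * jtheta (x k * b) p = jtheta (x k) p * (jtheta b p * S)"
      unfolding e2 by (simp only: mult_ac)
    also have "\<dots> = jtheta b p * (jtheta (x k) p * S)" by (simp only: mult_ac)
    also have "\<dots> = kf p b 0 * jtheta b p * jtheta (x k * b) p" unfolding e1 by (simp only: mult_ac)
    finally show ?thesis using nz by simp
  qed
  hence "eventually (\<lambda>k. kf p (x k) 0 * jtheta (x k) p = kf p b 0 * jtheta b p) sequentially"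
    using ev by (auto elim!: eventually_mono)
  hence "(\<lambda>k. kf p (x k) 0 * jtheta (x k) p) \<longlonglongrightarrow> kf p b 0 * jtheta b p"
    by (rule tendsto_eventually)
  moreover have "(\<lambda>k. kf p (x k) 0 * jtheta (x k) p) \<longlonglongrightarrow> euler p ^ 3"
    unfolding x_def by (rule kf_limit[OF assms(1) p1])
  ultimately have c: "kf p b 0 * jtheta b p = euler p ^ 3" by (rule LIMSEQ_unique)
  have "jtheta a p * jtheta b p * T = (jtheta a p * T) * jtheta b p" by (simp only: mult_ac)
  also have "\<dots> = (kf p b 0 * jtheta b p) * jtheta (a * b) p"
    unfolding kronecker_aux[OF assms] by (simp only: mult_ac)
  finally show ?thesis unfolding c .
qed

text \<open>Adding 3 (r + s) to the exponent 5 (r + s) + 10 r s gives 8 (r + s) + 10 r s, and w^(r -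
  s) = w^(r + 2 s); hence the base q^10 and the arguments w q^8 and w^2 q^8. Their theta functions
  are two of the three in \<open>jtheta_cube\<close> at x = q^8. The product j(q^2; p) j(q^6; p)
  left over is evaluated by \<open>jtheta_5\<close> at q^2.\<close>

lemma kap_sum:
  assumes "q \<noteq> 0" "norm q < 1" "1 + w + w\<^sup>2 = 0"
  obtains K where "((\<lambda>N. q powi (3 * N) * kap w q N) has_sum K) UNIV"
    "q ^ 6 * jtheta (q ^ 6) (q ^ 30) * K = - (euler (q ^ 30) * (euler (q\<^sup>2) * euler (q ^ 10)))"
proof -
  note w = cube_root[OF assms(3)]
  define p where "p = q ^ 10"
  define a b where "a = w * q ^ 8" "b = w\<^sup>2 * q ^ 8"
  note d = this
  have nq: "norm q > 0" using assms by simp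
  have nw: "norm w = 1" by (rule w(4))
  have n8: "norm q ^ 10 < norm q ^ 8" "norm q ^ 8 < 1"
    using assms nq by (auto intro: power_strict_decreasing simp: power_less_one_iff)
  have p0: "p \<noteq> 0" using assms by (simp add: p_def)
  have na: "norm p < norm a" "norm a < 1" "norm p < norm b" "norm b < 1"
    using n8 nw by (simp_all add: d p_def norm_mult norm_power)
  have p1: "norm p < 1" using na by simp
  obtain K where K: "(cone_term (krc a b p) has_sum K) UNIV"
    using krc_summable[OF p0 na] by (auto simp: summable_on_def)
  have kr: "jtheta a p * jtheta b p * K = euler p ^ 3 * jtheta (a * b) p"
    by (rule kronecker[OF p0 na K])
  have "q powi (3 * N) * kap w q N = csum (krc a b p) N" for N
    unfolding kap_def csum_cmult[symmetric]
  proof (rule csum_cong)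
    fix r s assume N: "r + s = N"
    have "a powi r * b powi s = (w powi r * (w\<^sup>2) powi s) * (q ^ 8) powi (r + s)"
      using assms by (simp add: d power_int_mult_distrib power_int_add)
    also have "(q ^ 8) powi (r + s) = q powi (8 * N)" by (simp add: power_int_power N)
    also have "w powi r * (w\<^sup>2) powi s = w powi (r + 2 * s)"
      using w by (simp add: power_int_add power_int_mult)
    also have "\<dots> = w powi (r - s)" by (rule cube_root_powi[OF assms(3)]) simp
    finally have 1: "krc a b p r s = w powi (r - s) * (q powi (8 * N) * q powi (10 * (r * s)))"
      by (simp add: krc_def p_def power_int_power)
    have "q powi (8 * N) * q powi (10 * (r * s)) = q powi (8 * N + 10 * (r * s))" using powi_add[OF assms(1)] by simp
    also have "\<dots> = q powi (3 * N) * q powi (5 * (r + s) + 10 * (r * s))"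
      by (rule powi_eqI[OF assms(1), symmetric]) (simp add: N[symmetric])
    finally show "q powi (3 * N) * (w powi (r - s) * q powi (5 * (r + s) + 10 * (r * s))) = krc a b p r s"
      unfolding 1 by (simp only: mult_ac)
  qed
  hence h: "((\<lambda>N. q powi (3 * N) * kap w q N) has_sum K) UNIV" using csum_has_sum[OF K] by simp
  have ab: "a * b = p * q ^ 6" using w(1) by (simp add: d p_def eval_nat_numeral mult_ac)
  have e1: "jtheta (q ^ 6) p = - (q ^ 6) * jtheta (a * b) p"
    unfolding ab using jtheta_shift[OF p1, of "q ^ 6"] assms p0 by simp
  have cub: "jtheta (q ^ 8) p * jtheta a p * jtheta b p * euler (p ^ 3) = jtheta ((q ^ 8) ^ 3) (p ^ 3) * euler p ^ 3"
    unfolding d using assms by (intro jtheta_cube[OF p1 p0 _ assms(3)]) auto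
  have p3: "p ^ 3 = q ^ 30" "(q ^ 8) ^ 3 = q ^ 24" by (simp_all add: p_def flip: power_mult)
  have i1: "jtheta (q ^ 24) (q ^ 30) = jtheta (q ^ 6) (q ^ 30)"
  proof -
    have "q ^ 30 / q ^ 6 = q ^ 24" using assms by (simp add: field_simps flip: power_add)
    thus ?thesis using jtheta_inverse[of "q ^ 30" "q ^ 6"] assms by simp
  qed
  have i2: "jtheta (q ^ 8) p = jtheta (q\<^sup>2) p"
  proof -
    have "p / q\<^sup>2 = q ^ 8" using assms by (simp add: p_def field_simps flip: power_add)
    thus ?thesis using jtheta_inverse[of p "q\<^sup>2"] assms p0 by simp
  qed
  have five: "jtheta (q\<^sup>2) p * jtheta (q ^ 6) p = euler (q\<^sup>2) * euler p"
    using jtheta_5[of "q\<^sup>2"] assms norm_sq_less_one[OF assms(2)] by (simp add: p_def flip: power_mult)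
  have ez: "euler p \<noteq> 0" using qpoch_inf_nonzero'[OF p1 p1] .
  have "euler p ^ 3 * (jtheta (q ^ 6) (q ^ 30) * K) = jtheta (q ^ 8) p * euler (q ^ 30) * (jtheta a p * jtheta b p * K)"
    using cub unfolding p3 i1 by (simp add: mult_ac)
  also have "\<dots> = euler p ^ 3 * (jtheta (q ^ 8) p * euler (q ^ 30) * jtheta (a * b) p)"
    unfolding kr by (simp only: mult_ac)
  finally have "jtheta (q ^ 6) (q ^ 30) * K = jtheta (q ^ 8) p * euler (q ^ 30) * jtheta (a * b) p"
    using ez by simp
  hence "q ^ 6 * (jtheta (q ^ 6) (q ^ 30) * K) = - (euler (q ^ 30) * (jtheta (q\<^sup>2) p * jtheta (q ^ 6) p))"
    unfolding e1 i2 by simp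
  hence "q ^ 6 * jtheta (q ^ 6) (q ^ 30) * K = - (euler (q ^ 30) * (euler (q\<^sup>2) * euler (q ^ 10)))"
    unfolding five by (simp add: p_def mult_ac)
  thus ?thesis using that h by blast
qed

subsection \<open>Three-dissections\<close>

lemma int_mod_3_cases:
  obtains a i where "(n :: int) = 3 * a + i" "i = 0 \<or> i = 1 \<or> i = 2"
proof (rule that)
  show "n = 3 * (n div 3) + n mod 3" by simp
  show "n mod 3 = 0 \<or> n mod 3 = 1 \<or> n mod 3 = 2" by presburger
qed

text \<open>The character sum over q, w q, w^2 q that isolates exponents congruent to 1 modulo 3;
  the weights 1, w^2, w divide out the residue 1.\<close>

lemma dissect_term:
  assumes "1 + w + w\<^sup>2 = (0 :: complex)"
  shows "q powi e + w\<^sup>2 * (w * q) powi e + w * (w\<^sup>2 * q) powi e = (if 3 dvd (e - 1) then 3 * q powi e else 0)"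
proof -
  note w = cube_root[OF assms]
  have a: "w\<^sup>2 * (w * q) powi e = w powi (e - 1) * q powi e"
  proof -
    have "w\<^sup>2 * w powi e = w powi (e + 2)" using powi_eqI[OF w(2), of 2 e "e + 2"] by simp
    also have "\<dots> = w powi (e - 1)" by (rule cube_root_powi[OF assms]) simp
    finally show ?thesis by (simp add: power_int_mult_distrib flip: mult.assoc)
  qed
  have b: "w * (w\<^sup>2 * q) powi e = w powi (2 * (e - 1)) * q powi e"
  proof -
    have "(w\<^sup>2) powi e = w powi (2 * e)" by (simp add: power_int_mult)
    hence "w * (w\<^sup>2) powi e = w powi (2 * e + 1)" using powi_eqI[OF w(2), of 1 "2 * e" "2 * e + 1"] by simp
    also have "\<dots> = w powi (2 * (e - 1))" by (rule cube_root_powi[OF assms]) simp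
    finally show ?thesis by (simp add: power_int_mult_distrib flip: mult.assoc)
  qed
  have "q powi e + w\<^sup>2 * (w * q) powi e + w * (w\<^sup>2 * q) powi e = (1 + w powi (e - 1) + w powi (2 * (e - 1))) * q powi e"
    unfolding a b by (simp only: distrib_right mult_1_left)
  thus ?thesis unfolding root_filter[OF assms] by simp
qed

definition hc :: "complex \<Rightarrow> int \<Rightarrow> int \<Rightarrow> int \<Rightarrow> complex" where
  "hc q b r s = q powi (2 * ((r + s) * (r + s)) + b * (r + s) + 2 * (r * s))"

lemma hc_cone:
  assumes "q \<noteq> 0" "norm q < 1" "0 \<le> b" "b \<le> 3"
  shows "(cone_term (hc q b) has_sum hecke q b) UNIV"
proof -
  have bound: "norm (q powi e) \<le> norm q ^ i * norm q ^ j" if "e \<ge> int i + int j" for e i j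
  proof -
    have "norm q powi e \<le> norm q powi (int (i + j))" using that assms by (intro power_int_decreasing) auto
    thus ?thesis by (simp add: norm_powi power_add flip: of_nat_add)
  qed
  have "cone_term (hc q b) summable_on UNIV"
  proof (rule cone_term_summable)
    show "(\<lambda>(i, j). hc q b (int i) (int j)) summable_on UNIV"
    proof (rule summable_on_norm_bound[OF geometric_pair_summable[of "norm q" "norm q"]], safe)
      fix i j :: nat
      have "int i + int j \<le> (int i + int j) * (int i + int j)"
      proof -
        have "n \<le> n * n" if "n \<ge> 0" for n :: int using that by (cases "n = 0") (auto simp: mult_le_cancel_left1)
        thus ?thesis by simp
      qed
      moreover have "0 \<le> b * (int i + int j)" "0 \<le> int i * int j" using assms by simp_all
      moreover have "0 \<le> (int i + int j) * (int i + int j)" by simp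
      ultimately show "norm (hc q b (int i) (int j)) \<le> norm q ^ i * norm q ^ j"
        unfolding hc_def by (intro bound) linarith
    qed (use assms in auto)
    show "(\<lambda>(i, j). hc q b (-1 - int i) (-1 - int j)) summable_on UNIV"
    proof (rule summable_on_norm_bound[OF geometric_pair_summable[of "norm q" "norm q"]], safe)
      fix i j :: nat
      \<comment> \<open>With r + s = -n and n >= 2, the bound b <= 3 gives 2 n^2 - b n >= 4 n - 3 n
        = n, which exceeds i + j. This is where the upper bound on b enters.\<close>
      define n where "n = int i + int j + 2"
      have "2 * n \<le> n * n" by (intro mult_right_mono) (auto simp: n_def)
      moreover have "b * n \<le> 3 * n" using assms by (intro mult_right_mono) (auto simp: n_def)
      moreover have "0 \<le> (-1 - int i) * (-1 - int j)" by (intro mult_nonpos_nonpos) auto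
      moreover have "(-1 - int i + (-1 - int j)) * (-1 - int i + (-1 - int j)) = n * n" by (simp add: n_def algebra_simps)
      moreover have "b * (-1 - int i + (-1 - int j)) = - (b * n)" by (simp add: n_def algebra_simps)
      ultimately show "norm (hc q b (-1 - int i) (-1 - int j)) \<le> norm q ^ i * norm q ^ j"
        unfolding hc_def by (intro bound) (simp add: n_def)
    qed (use assms in auto)
  qed
  then obtain T where T: "(cone_term (hc q b) has_sum T) UNIV" by (auto simp: summable_on_def)
  have "csum (hc q b) N = q powi (b * N) * hN q N" for N
    unfolding hN_def gs_def csum_cmult[symmetric]
  proof (rule csum_cong)
    fix r s assume N: "r + s = N"
    have "(q\<^sup>2) powi (r * s) = q powi (2 * (r * s))" by (simp add: power_int_mult)
    moreover have "q powi (b * N) * (q powi (2 * (N * N)) * q powi (2 * (r * s))) = q powi (2 * (N * N) + b * N + 2 * (r * s))"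
      using powi_add[OF assms(1)] by simp
    ultimately show "hc q b r s = q powi (b * N) * (q powi (2 * (N * N)) * (q\<^sup>2) powi (r * s))"
      unfolding hc_def N by simp
  qed
  hence "csum (hc q b) = (\<lambda>N. q powi (b * N) * hN q N)" by (simp add: fun_eq_iff)
  hence "T = hecke q b" using csum_has_sum[OF T] hecke_has_sum[OF assms(1,2), of b] has_sum_unique by metis
  thus ?thesis using T by simp
qed

lemma cube_root_scaling:
  assumes "1 + w + w\<^sup>2 = (0 :: complex)" "q \<noteq> 0" "norm q < 1"
  shows "w * q \<noteq> 0" "norm (w * q) < 1" "w\<^sup>2 * q \<noteq> 0" "norm (w\<^sup>2 * q) < 1"
  using cube_root[OF assms(1)] assms by (auto simp: norm_mult norm_power)

text \<open>Modulo 3 the exponent of \<open>hc q 3\<close> is 2 (r^2 + s^2), and r^2 + s^2 is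
  anisotropic modulo 3, so the residue 0 forces both r and s to be multiples of 3. Replacing them by
  3 r and 3 s multiplies the quadratic part by 9 and turns the linear part 3 (r + s) into 9 (r + s),
  which is \<open>hecke\<close> at q^9 with b = 1.\<close>

lemma hecke_dissection:
  assumes "q \<noteq> 0" "norm q < 1" "1 + w + w\<^sup>2 = 0"
  shows "q * hecke q 3 + w\<^sup>2 * (w * q * hecke (w * q) 3) + w * (w\<^sup>2 * q * hecke (w\<^sup>2 * q) 3) = 3 * (q * hecke (q ^ 9) 1)"
proof -
  note w = cube_root[OF assms(3)]
  note sc = cube_root_scaling[OF assms(3,1,2)]
  let ?e = "\<lambda>r s. 2 * ((r + s) * (r + s)) + 3 * (r + s) + 2 * (r * s)"
  have cs: "x * cone_term (hc x 3) (r, s) = cone_term (\<lambda>r s. x powi (?e r s + 1)) (r, s)" if "x \<noteq> 0" for x r s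
    using that by (simp add: cone_term_def hc_def power_int_add)
  have "((\<lambda>z. q * cone_term (hc q 3) z + w\<^sup>2 * (w * q * cone_term (hc (w * q) 3) z) + w * (w\<^sup>2 * q * cone_term (hc (w\<^sup>2 * q) 3) z)) has_sum
     q * hecke q 3 + w\<^sup>2 * (w * q * hecke (w * q) 3) + w * (w\<^sup>2 * q * hecke (w\<^sup>2 * q) 3)) UNIV"
    by (intro has_sum_add has_sum_cmult_right hc_cone assms sc) auto
  also have "(\<lambda>z. q * cone_term (hc q 3) z + w\<^sup>2 * (w * q * cone_term (hc (w * q) 3) z) + w * (w\<^sup>2 * q * cone_term (hc (w\<^sup>2 * q) 3) z))
     = cone_term (\<lambda>r s. if 3 dvd r \<and> 3 dvd s then 3 * q powi (?e r s + 1) else 0)"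
  proof
    fix z :: "int \<times> int"
    obtain r s where z: "z = (r, s)" by (cases z)
    have iff: "3 dvd (?e r s + 1 - 1) \<longleftrightarrow> 3 dvd r \<and> 3 dvd s"
    proof -
      obtain a i where r: "r = 3 * a + i" "i = 0 \<or> i = 1 \<or> i = 2"
      by (rule int_mod_3_cases[of r])
      obtain b j where s: "s = 3 * b + j" "j = 0 \<or> j = 1 \<or> j = 2"
      by (rule int_mod_3_cases[of s])
      define X where "X = 6 * ((a + b) * (a + b)) + 4 * (a + b) * (i + j) + 3 * (a + b) + 6 * (a * b) + 2 * (a * j) + 2 * (i * b)"
      have "?e r s + 1 - 1 = 3 * X + (2 * ((i + j) * (i + j)) + 3 * (i + j) + 2 * (i * j))"
        unfolding r s X_def by (simp add: algebra_simps)
      moreover have "3 dvd r \<longleftrightarrow> i = 0" "3 dvd s \<longleftrightarrow> j = 0" using r(2) s(2) unfolding r(1) s(1) by presburger+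
      moreover have "3 dvd (3 * X + (2 * ((i + j) * (i + j)) + 3 * (i + j) + 2 * (i * j))) \<longleftrightarrow> i = 0 \<and> j = 0"
        using r(2) s(2) by (elim disjE) (simp_all, presburger+)
      ultimately show ?thesis by simp
    qed
    show "q * cone_term (hc q 3) z + w\<^sup>2 * (w * q * cone_term (hc (w * q) 3) z) + w * (w\<^sup>2 * q * cone_term (hc (w\<^sup>2 * q) 3) z)
      = cone_term (\<lambda>r s. if 3 dvd r \<and> 3 dvd s then 3 * q powi (?e r s + 1) else 0) z"
      unfolding z cs[OF assms(1)] cs[OF sc(1)] cs[OF sc(3)]
      using dissect_term[OF assms(3), of q "?e r s + 1"] unfolding iff
      by (auto simp: cone_term_def algebra_simps)
  qed
  finally have 1: "(cone_term (\<lambda>r s. if 3 dvd r \<and> 3 dvd s then 3 * q powi (?e r s + 1) else 0) has_sum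
     q * hecke q 3 + w\<^sup>2 * (w * q * hecke (w * q) 3) + w * (w\<^sup>2 * q * hecke (w\<^sup>2 * q) 3)) UNIV" .
  have q9: "q ^ 9 \<noteq> 0" "norm (q ^ 9) < 1" using assms by (auto simp: norm_power power_less_one_iff)
  have "((\<lambda>z. 3 * q * cone_term (hc (q ^ 9) 1) z) has_sum 3 * q * hecke (q ^ 9) 1) UNIV"
    by (intro has_sum_cmult_right hc_cone q9) auto
  also have "?this \<longleftrightarrow> (cone_term (\<lambda>r s. if 3 dvd r \<and> 3 dvd s then 3 * q powi (?e r s + 1) else 0) has_sum 3 * q * hecke (q ^ 9) 1) {(r, s). 3 dvd r \<and> 3 dvd s}"
  proof (rule has_sum_reindex_bij_witness[of _ "\<lambda>(r, s). (r div 3, s div 3)" "\<lambda>(r, s). (3 * r, 3 * s)"])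
    fix z :: "int \<times> int"
    obtain r s where z: "z = (r, s)" by (cases z)
    have "q * (q ^ 9) powi (2 * ((r + s) * (r + s)) + 1 * (r + s) + 2 * (r * s)) = q powi (?e (3 * r) (3 * s) + 1)"
    proof -
      have "?e (3 * r) (3 * s) + 1 = 1 + 9 * (2 * ((r + s) * (r + s)) + 1 * (r + s) + 2 * (r * s))" by (simp add: algebra_simps)
      thus ?thesis using powi_add[OF assms(1), of 1 "9 * (2 * ((r + s) * (r + s)) + 1 * (r + s) + 2 * (r * s))"]
        by (simp only: power_int_power) simp
    qed
    thus "cone_term (\<lambda>r s. if 3 dvd r \<and> 3 dvd s then 3 * q powi (?e r s + 1) else 0) (case z of (r, s) \<Rightarrow> (3 * r, 3 * s)) = 3 * q * cone_term (hc (q ^ 9) 1) z"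
      by (simp add: z cone_term_def hc_def)
  qed auto
  also have "\<dots> \<longleftrightarrow> (cone_term (\<lambda>r s. if 3 dvd r \<and> 3 dvd s then 3 * q powi (?e r s + 1) else 0) has_sum 3 * q * hecke (q ^ 9) 1) UNIV"
    by (rule has_sum_cong_neutral) (auto simp: cone_term_def split: if_splits)
  finally show ?thesis using has_sum_unique[OF 1] by (simp only: mult.assoc)
qed

text \<open>The residues of r and k modulo 3 show that an exponent congruent to 1 occurs only when r
  + k is congruent to 2, and there the coefficient \<open>Gw\<close> is zero.\<close>

lemma tm_dissection:
  assumes "1 + w + w\<^sup>2 = 0" "q \<noteq> 0"
  shows "q powi k * tm w q r k + w\<^sup>2 * ((w * q) powi k * tm w (w * q) r k) + w * ((w\<^sup>2 * q) powi k * tm w (w\<^sup>2 * q) r k) = 0"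
proof -
  note w = cube_root[OF assms(1)]
  let ?E = "k + (5 * tri r + 5 * ((r - 1) * k))"
  have t: "x powi k * tm w x r k = (-1) powi r * Gw w (r + k) * x powi ?E" if "x \<noteq> 0" for x
    using powi_add[OF that, of k "5 * tri r + 5 * ((r - 1) * k)"] by (simp add: tm_def mult_ac)
  have G: "Gw w (r + k) = 0" if E: "3 dvd (?E - 1)"
  proof (rule Gw_values(2)[OF assms(1)])
    obtain a i where r: "r = 3 * a + i" "i = 0 \<or> i = 1 \<or> i = 2"
    by (rule int_mod_3_cases[of r])
    obtain b j where k: "k = 3 * b + j" "j = 0 \<or> j = 1 \<or> j = 2"
    by (rule int_mod_3_cases[of k])
    have "tri (3 * a) = 3 * (3 * tri a + a)" using tri_mult[of 3 a] by (simp add: tri_def)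
    hence tr: "tri r = 3 * (3 * tri a + a) + tri i + 3 * a * i" unfolding r(1) by (simp add: tri_add)
    define X where "X = b + 5 * (3 * tri a + a) + 5 * (a * i) + 5 * (a * k) + 5 * ((i - 1) * b)"
    have "?E - 1 = 3 * X + (j + 5 * tri i + 5 * ((i - 1) * j) - 1)"
      unfolding tr X_def unfolding r(1) k(1) by (simp add: algebra_simps)
    hence "3 dvd (3 * X + (j + 5 * tri i + 5 * ((i - 1) * j) - 1))" using E by (simp only:)
    hence "3 dvd (i + j - 2)"
      using r(2) k(2) by (elim disjE) (simp_all, presburger+)
    thus "3 dvd (r + k - 2)" unfolding r(1) k(1) by presburger
  qed
  have "q powi k * tm w q r k + w\<^sup>2 * ((w * q) powi k * tm w (w * q) r k) + w * ((w\<^sup>2 * q) powi k * tm w (w\<^sup>2 * q) r k)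
    = (-1) powi r * Gw w (r + k) * (q powi ?E + w\<^sup>2 * (w * q) powi ?E + w * (w\<^sup>2 * q) powi ?E)"
    using w assms(2) by (subst (1 2 3) t) (auto simp: algebra_simps)
  thus ?thesis unfolding dissect_term[OF assms(1)] using G by simp
qed

lemma appell_dissection:
  assumes "q \<noteq> 0" "norm q < 1" "1 + w + w\<^sup>2 = 0"
  shows "appell w q + w\<^sup>2 * appell w (w * q) + w * appell w (w\<^sup>2 * q) = 0"
proof -
  note sc = cube_root_scaling[OF assms(3,1,2)]
  have inner: "q powi k * infsum (\<lambda>r. tm w q r k) A + w\<^sup>2 * ((w * q) powi k * infsum (\<lambda>r. tm w (w * q) r k) A)
      + w * ((w\<^sup>2 * q) powi k * infsum (\<lambda>r. tm w (w\<^sup>2 * q) r k) A) = 0"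
    if A: "\<And>r. r \<in> A \<Longrightarrow> (r - 1) * k \<ge> 0" for k A
  proof -
    have s: "((\<lambda>r. tm w x r k) has_sum infsum (\<lambda>r. tm w x r k) A) A" if "x \<noteq> 0" "norm x < 1" for x
      by (intro has_sum_infsum tm_summable[OF that assms(3)] A)
    have h: "((\<lambda>r. q powi k * tm w q r k + w\<^sup>2 * ((w * q) powi k * tm w (w * q) r k) + w * ((w\<^sup>2 * q) powi k * tm w (w\<^sup>2 * q) r k)) has_sum
      q powi k * infsum (\<lambda>r. tm w q r k) A + w\<^sup>2 * ((w * q) powi k * infsum (\<lambda>r. tm w (w * q) r k) A)
      + w * ((w\<^sup>2 * q) powi k * infsum (\<lambda>r. tm w (w\<^sup>2 * q) r k) A)) A"
      by (intro has_sum_add has_sum_cmult_right s assms sc)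
    thus ?thesis by (intro has_sum_unique[OF h has_sum_0] tm_dissection assms)
  qed
  have ap: "((\<lambda>k. (-1) powi k * x powi k * mk w x k) has_sum appell w x) UNIV" if "x \<noteq> 0" "norm x < 1" for x
    unfolding appell_def by (rule has_sum_infsum[OF appell_summable[OF that assms(3)]])
  have h: "((\<lambda>k. (-1) powi k * q powi k * mk w q k + w\<^sup>2 * ((-1) powi k * (w * q) powi k * mk w (w * q) k)
     + w * ((-1) powi k * (w\<^sup>2 * q) powi k * mk w (w\<^sup>2 * q) k)) has_sum
     appell w q + w\<^sup>2 * appell w (w * q) + w * appell w (w\<^sup>2 * q)) UNIV"
    by (rule has_sum_add[OF has_sum_add[OF ap[OF assms(1,2)] has_sum_cmult_right[OF ap[OF sc(1,2)]]] has_sum_cmult_right[OF ap[OF sc(3,4)]]])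
  have z: "(-1) powi k * q powi k * mk w q k + w\<^sup>2 * ((-1) powi k * (w * q) powi k * mk w (w * q) k)
     + w * ((-1) powi k * (w\<^sup>2 * q) powi k * mk w (w\<^sup>2 * q) k) = 0" for k
  proof -
    have "q powi k * mk w q k + w\<^sup>2 * ((w * q) powi k * mk w (w * q) k) + w * ((w\<^sup>2 * q) powi k * mk w (w\<^sup>2 * q) k) = 0"
    proof (cases "k \<ge> 0")
      case True
      thus ?thesis using inner[of "{1..}" k] by (simp add: mk_def)
    next
      case False
      have "q powi k * infsum (\<lambda>r. tm w q r k) {..0} + w\<^sup>2 * ((w * q) powi k * infsum (\<lambda>r. tm w (w * q) r k) {..0})
        + w * ((w\<^sup>2 * q) powi k * infsum (\<lambda>r. tm w (w\<^sup>2 * q) r k) {..0}) = 0"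
        by (rule inner) (use False in \<open>auto intro: mult_nonpos_nonpos\<close>)
      hence "- (q powi k * infsum (\<lambda>r. tm w q r k) {..0} + w\<^sup>2 * ((w * q) powi k * infsum (\<lambda>r. tm w (w * q) r k) {..0})
        + w * ((w\<^sup>2 * q) powi k * infsum (\<lambda>r. tm w (w\<^sup>2 * q) r k) {..0})) = 0" by simp
      thus ?thesis using False by (simp add: mk_def algebra_simps)
    qed
    hence "(-1) powi k * (q powi k * mk w q k + w\<^sup>2 * ((w * q) powi k * mk w (w * q) k) + w * ((w\<^sup>2 * q) powi k * mk w (w\<^sup>2 * q) k)) = 0"
      by simp
    thus ?thesis by (simp only: distrib_left mult_ac)
  qed
  show ?thesis by (rule has_sum_unique[OF h has_sum_0]) (rule z)
qed

text \<open>The exponent 2 n^2 + n is divisible by 3 unless n = -1 - 3 c, when it equals 1 + 9 (2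
  c^2 + c). So psi splits into a part unchanged by q -> w q and the part q psi(q^9), which is
  multiplied by w.\<close>

lemma psi_dissection:
  assumes "q \<noteq> 0" "norm q < 1" "1 + w + w\<^sup>2 = 0"
  shows "psi (w * q) = psi q - q * psi (q ^ 9) + w * (q * psi (q ^ 9))"
proof -
  note w = cube_root[OF assms(3)]
  note sc = cube_root_scaling[OF assms(3,1,2)]
  have q9: "q ^ 9 \<noteq> 0" "norm (q ^ 9) < 1" using assms by (auto simp: norm_power power_less_one_iff)
  let ?e = "\<lambda>n. 2 * (n * n) + n"
  have "((\<lambda>n. (w * q) powi ?e n + (-1) * q powi ?e n) has_sum psi (w * q) + (-1) * psi q) UNIV"
    by (intro has_sum_add has_sum_cmult_right psi_has_sum sc assms)
  also have "(\<lambda>n. (w * q) powi ?e n + (-1) * q powi ?e n) = (\<lambda>n. if 3 dvd (n + 1) then (w - 1) * q powi ?e n else 0)"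
  proof
    fix n :: int
    obtain a i where n: "n = 3 * a + i" "i = 0 \<or> i = 1 \<or> i = 2"
    by (rule int_mod_3_cases[of n])
    have e: "?e n = 3 * (6 * (a * a) + 4 * (a * i) + a) + (2 * (i * i) + i)" unfolding n(1) by (simp add: algebra_simps)
    have d: "(w * q) powi ?e n = w powi ?e n * q powi ?e n" by (simp add: power_int_mult_distrib)
    show "(w * q) powi ?e n + (-1) * q powi ?e n = (if 3 dvd (n + 1) then (w - 1) * q powi ?e n else 0)"
    proof (cases "i = 2")
      case True
      have "w powi ?e n = w powi 1" unfolding e by (rule cube_root_powi[OF assms(3)]) (simp add: True)
      moreover have "3 dvd (n + 1)" unfolding n(1) True by presburger
      ultimately show ?thesis unfolding d by (simp add: algebra_simps)
    next
      case False
      have "w powi ?e n = w powi 0" unfolding e using False n(2) by (intro cube_root_powi[OF assms(3)]) auto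
      moreover have "\<not> 3 dvd (n + 1)" using False n(2) unfolding n(1) by presburger
      ultimately show ?thesis unfolding d by simp
    qed
  qed
  finally have 1: "((\<lambda>n. if 3 dvd (n + 1) then (w - 1) * q powi ?e n else 0) has_sum psi (w * q) - psi q) UNIV" by simp
  have "((\<lambda>n. (w - 1) * q * (q ^ 9) powi ?e n) has_sum (w - 1) * q * psi (q ^ 9)) UNIV"
    by (intro has_sum_cmult_right psi_has_sum q9)
  also have "?this \<longleftrightarrow> ((\<lambda>n. if 3 dvd (n + 1) then (w - 1) * q powi ?e n else 0) has_sum (w - 1) * q * psi (q ^ 9)) {n. 3 dvd (n + 1)}"
  proof (rule has_sum_reindex_bij_witness[of _ "\<lambda>n. - ((n + 1) div 3)" "\<lambda>c. -1 - 3 * c"])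
    fix c :: int
    have "?e (-1 - 3 * c) = 1 + 9 * ?e c" by (simp add: algebra_simps)
    hence "q powi ?e (-1 - 3 * c) = q * (q ^ 9) powi ?e c"
      using powi_add[OF assms(1), of 1 "9 * ?e c"] by (simp only:) (simp add: power_int_power)
    moreover have "3 dvd (-1 - 3 * c + 1)" by presburger
    ultimately show "(if 3 dvd (-1 - 3 * c + 1) then (w - 1) * q powi ?e (-1 - 3 * c) else 0) = (w - 1) * q * (q ^ 9) powi ?e c"
      by simp
  qed auto
  also have "\<dots> \<longleftrightarrow> ((\<lambda>n. if 3 dvd (n + 1) then (w - 1) * q powi ?e n else 0) has_sum (w - 1) * q * psi (q ^ 9)) UNIV"
    by (rule has_sum_cong_neutral) auto
  finally have "psi (w * q) - psi q = (w - 1) * q * psi (q ^ 9)" using 1 has_sum_unique by blast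
  thus ?thesis by (simp add: algebra_simps)
qed

section \<open>Dissection of a product of two theta series\<close>

lemma has_sum_mult_complex:
  fixes f :: "'a \<Rightarrow> complex" and g :: "'b \<Rightarrow> complex"
  assumes "(f has_sum F) UNIV" "(g has_sum G) UNIV"
  shows "((\<lambda>(x, y). f x * g y) has_sum F * G) UNIV"
proof -
  have "f summable_on UNIV" "g summable_on UNIV" using assms has_sum_imp_summable by blast+
  hence "(\<lambda>x. norm (f x)) summable_on UNIV" "(\<lambda>x. norm (g x)) summable_on UNIV"
    by (simp_all add: summable_on_iff_abs_summable_on_complex)
  from summable_on_product[OF this] have "(\<lambda>(x, y). norm (f x) * norm (g y)) summable_on UNIV \<times> UNIV" by simp
  hence s: "(\<lambda>(x, y). f x * g y) summable_on UNIV \<times> UNIV"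
    by (rule summable_on_norm_bound) (auto simp: norm_mult)
  have "((\<lambda>(x, y). f x * g y) has_sum F * G) (UNIV \<times> UNIV)"
  proof (rule has_sum_SigmaI[OF _ _ s])
    fix x
    show "((\<lambda>y. case (x, y) of (x, y) \<Rightarrow> f x * g y) has_sum f x * G) UNIV"
      using has_sum_cmult_right[OF assms(2), of "f x"] by simp
    show "((\<lambda>x. f x * G) has_sum F * G) UNIV" by (rule has_sum_cmult_left[OF assms(1)])
  qed
  thus ?thesis by simp
qed

lemma theta_power_has_sum:
  assumes "q \<noteq> 0" "norm q < 1" "b > 0"
  shows "((\<lambda>n. (-1) powi n * q powi (int a * n + int b * tri n)) has_sum jtheta (q ^ a) (q ^ b)) UNIV"
proof -
  have "norm (q ^ b) < 1" using assms by (simp add: norm_power power_less_one_iff)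
  hence "((\<lambda>n. tc (q ^ b) n * (q ^ a) powi n) has_sum jtheta (q ^ a) (q ^ b)) UNIV"
    using assms by (intro tc_jtheta) auto
  moreover have "tc (q ^ b) n * (q ^ a) powi n = (-1) powi n * q powi (int a * n + int b * tri n)" for n
    using powi_add[OF assms(1), of "int a * n" "int b * tri n"] by (simp add: tc_def power_int_power mult_ac)
  ultimately show ?thesis by simp
qed

lemma euler_has_sum:
  assumes "q \<noteq> 0" "norm q < 1" "a > 0"
  shows "((\<lambda>n. (-1) powi n * q powi (int a * n + int (3 * a) * tri n)) has_sum euler (q ^ a)) UNIV"
proof -
  have "norm (q ^ a) < 1" using assms by (simp add: norm_power power_less_one_iff)
  hence "jtheta (q ^ a) (q ^ (3 * a)) = euler (q ^ a)"
    using jtheta_3[of "q ^ a"] assms by (simp add: mult.commute flip: power_mult)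
  thus ?thesis using theta_power_has_sum[OF assms(1,2), of "3 * a" a] assms(3) by simp
qed

text \<open>The exponent is congruent to n + m modulo 3, so the condition is n + m = 1 - 3 b for an
  integer b. With x = m + b / 2 the exponent becomes 1 + 9 (2 x^2 - x) + 15 b + 45
  \<open>tri b\<close>, which separates the variables again. The sign (-1)^(n + m) equals - (-1)^b,
  hence the minus sign.\<close>

lemma theta_product_dissection:
  assumes "q \<noteq> 0" "norm q < 1" "1 + w + w\<^sup>2 = 0"
  defines "Z \<equiv> \<lambda>q. jtheta q (q ^ 6) * euler (q ^ 10)"
  shows "Z q + w\<^sup>2 * Z (w * q) + w * Z (w\<^sup>2 * q) = - (3 * (q * psi (q ^ 9) * euler (q ^ 15)))"
proof -
  note w = cube_root[OF assms(3)]
  note sc = cube_root_scaling[OF assms(3,1,2)]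
  let ?e = "\<lambda>n m. (n + 6 * tri n) + (10 * m + 30 * tri m)"
  have hZ: "((\<lambda>(n, m). (-1) powi (n + m) * x powi ?e n m) has_sum Z x) UNIV" if "x \<noteq> 0" "norm x < 1" for x
  proof -
    have 1: "((\<lambda>n. (-1) powi n * x powi (n + 6 * tri n)) has_sum jtheta x (x ^ 6)) UNIV"
      using theta_power_has_sum[OF that, of 6 1] by simp
    have 2: "((\<lambda>m. (-1) powi m * x powi (10 * m + 30 * tri m)) has_sum euler (x ^ 10)) UNIV"
      using euler_has_sum[OF that, of 10] by simp
    have "(\<lambda>(n, m). ((-1) powi n * x powi (n + 6 * tri n)) * ((-1) powi m * x powi (10 * m + 30 * tri m))) = (\<lambda>(n, m). (-1) powi (n + m) * x powi ?e n m)"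
      using powi_add[OF that(1)] powi_add[of "-1 :: complex"] by (simp add: fun_eq_iff)
    thus ?thesis using has_sum_mult_complex[OF 1 2] by (simp add: Z_def)
  qed
  have "((\<lambda>z. (case z of (n, m) \<Rightarrow> (-1) powi (n + m) * q powi ?e n m) + w\<^sup>2 * (case z of (n, m) \<Rightarrow> (-1) powi (n + m) * (w * q) powi ?e n m)
     + w * (case z of (n, m) \<Rightarrow> (-1) powi (n + m) * (w\<^sup>2 * q) powi ?e n m)) has_sum Z q + w\<^sup>2 * Z (w * q) + w * Z (w\<^sup>2 * q)) UNIV"
    by (intro has_sum_add has_sum_cmult_right hZ assms sc)
  also have "(\<lambda>z. (case z of (n, m) \<Rightarrow> (-1) powi (n + m) * q powi ?e n m) + w\<^sup>2 * (case z of (n, m) \<Rightarrow> (-1) powi (n + m) * (w * q) powi ?e n m)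
     + w * (case z of (n, m) \<Rightarrow> (-1) powi (n + m) * (w\<^sup>2 * q) powi ?e n m))
    = (\<lambda>(n, m). if 3 dvd (n + m - 1) then 3 * ((-1) powi (n + m) * q powi ?e n m) else 0)"
  proof
    fix z :: "int \<times> int"
    obtain n m where z: "z = (n, m)" by (cases z)
    have iff: "3 dvd (?e n m - 1) \<longleftrightarrow> 3 dvd (n + m - 1)" by presburger
    show "(case z of (n, m) \<Rightarrow> (-1) powi (n + m) * q powi ?e n m) + w\<^sup>2 * (case z of (n, m) \<Rightarrow> (-1) powi (n + m) * (w * q) powi ?e n m)
     + w * (case z of (n, m) \<Rightarrow> (-1) powi (n + m) * (w\<^sup>2 * q) powi ?e n m)
     = (case z of (n, m) \<Rightarrow> if 3 dvd (n + m - 1) then 3 * ((-1) powi (n + m) * q powi ?e n m) else 0)"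
    proof -
      have "(-1) powi (n + m) * q powi ?e n m + w\<^sup>2 * ((-1) powi (n + m) * (w * q) powi ?e n m) + w * ((-1) powi (n + m) * (w\<^sup>2 * q) powi ?e n m)
        = (-1) powi (n + m) * (q powi ?e n m + w\<^sup>2 * (w * q) powi ?e n m + w * (w\<^sup>2 * q) powi ?e n m)"
        by (simp only: distrib_left mult_ac)
      thus ?thesis unfolding z dissect_term[OF assms(3)] iff by simp
    qed
  qed
  finally have 1: "((\<lambda>(n, m). if 3 dvd (n + m - 1) then 3 * ((-1) powi (n + m) * q powi ?e n m) else 0) has_sum Z q + w\<^sup>2 * Z (w * q) + w * Z (w\<^sup>2 * q)) UNIV" .
  have q9: "q ^ 9 \<noteq> 0" "norm (q ^ 9) < 1" using assms by (auto simp: norm_power power_less_one_iff)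
  have "((\<lambda>z. (- 3 * q) * (case z of (a, b) \<Rightarrow> (q ^ 9) powi (2 * (a * a) + a) * ((-1) powi b * q powi (15 * b + 45 * tri b)))) has_sum (- 3 * q) * (psi (q ^ 9) * euler (q ^ 15))) UNIV"
    using euler_has_sum[OF assms(1,2), of 15]
    by (intro has_sum_cmult_right has_sum_mult_complex psi_has_sum q9) simp
  also have "?this \<longleftrightarrow> ((\<lambda>(n, m). if 3 dvd (n + m - 1) then 3 * ((-1) powi (n + m) * q powi ?e n m) else 0) has_sum (- 3 * q) * (psi (q ^ 9) * euler (q ^ 15))) {(n, m). 3 dvd (n + m - 1)}"
  \<comment> \<open>The value x = m + b / 2 is an integer for even b and a half-integer for odd b.
    Taking x = -a in the first case and x = a + 1/2 in the second gives 2 x^2 - x = 2 a^2 + a in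
    both, which explains the distinction by parity.\<close>
  proof (rule has_sum_reindex_bij_witness[of _
      "\<lambda>(n, m). let k = (n + m - 1) div 3 in (if even k then k div 2 - m else m - (k + 1) div 2, - k)"
      "\<lambda>(a, b). let m = (if even b then - (b div 2) - a else a + (1 - b) div 2) in (1 - m - 3 * b, m)"])
    fix z :: "int \<times> int"
    obtain a b where z: "z = (a, b)" by (cases z)
    define m where "m = (if even b then - (b div 2) - a else a + (1 - b) div 2)"
    define n where "n = 1 - m - 3 * b"
    have nm: "3 dvd (n + m - 1)" by (simp add: n_def)
    have k: "(n + m - 1) div 3 = - b" by (simp add: n_def)
    show "(case (case z of (a, b) \<Rightarrow> let m = (if even b then - (b div 2) - a else a + (1 - b) div 2) in (1 - m - 3 * b, m)) of
      (n, m) \<Rightarrow> let k = (n + m - 1) div 3 in (if even k then k div 2 - m else m - (k + 1) div 2, - k)) = z"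
    proof -
      have "(if even (- b) then (- b) div 2 - m else m - (- b + 1) div 2) = a"
      proof (cases "even b")
        case True
        then obtain c where c: "b = 2 * c" by blast
        show ?thesis by (simp add: m_def c)
      next
        case False
        then obtain c where c: "b = 2 * c + 1" by (rule oddE)
        have "(1 - b) div 2 = - c" "(- b + 1) div 2 = - c" unfolding c by simp_all
        thus ?thesis using False by (simp add: m_def)
      qed
      thus ?thesis unfolding z prod.case Let_def m_def[symmetric] n_def[symmetric] k by simp
    qed
    show "(case z of (a, b) \<Rightarrow> let m = (if even b then - (b div 2) - a else a + (1 - b) div 2) in (1 - m - 3 * b, m)) \<in> {(n, m). 3 dvd (n + m - 1)}"
      by (simp add: z Let_def)
    have ex: "?e n m = 1 + (9 * (2 * (a * a) + a) + (15 * b + 45 * tri b))"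
    proof -
      have "2 * ?e n m = 2 * (1 + (9 * (2 * (a * a) + a) + (15 * b + 45 * tri b)))"
      proof (cases "even b")
        case True
        then obtain c where c: "b = 2 * c" by blast
        have m: "m = - c - a" by (simp add: m_def c)
        show ?thesis using two_tri[of n] two_tri[of m] two_tri[of b] unfolding n_def m c by (simp add: algebra_simps)
      next
        case False
        then obtain c where c: "b = 2 * c + 1" by (rule oddE)
        have m: "m = a - c" by (simp add: m_def c)
        show ?thesis using two_tri[of n] two_tri[of m] two_tri[of b] unfolding n_def m c by (simp add: algebra_simps)
      qed
      thus ?thesis by simp
    qed
    have sg: "(-1) powi (n + m) = - ((-1) powi b :: complex)"
    proof -
      have "n + m = 1 - 3 * b" by (simp add: n_def)
      hence "(-1) powi (n + m) = - ((-1) powi (3 * b) :: complex)" using minus_one_powi_one_minus[of "3 * b"] by simp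
      moreover have "(-1) powi (3 * b) = ((-1) powi b :: complex)" by (cases "even b") auto
      ultimately show ?thesis by simp
    qed
    have "q powi ?e n m = q * ((q ^ 9) powi (2 * (a * a) + a) * q powi (15 * b + 45 * tri b))"
      unfolding ex using powi_add[OF assms(1), of 1 "9 * (2 * (a * a) + a) + (15 * b + 45 * tri b)"]
        powi_add[OF assms(1), of "9 * (2 * (a * a) + a)" "15 * b + 45 * tri b"] by (simp add: power_int_power)
    hence "3 * ((-1) powi (n + m) * q powi ?e n m) = (- 3 * q) * ((q ^ 9) powi (2 * (a * a) + a) * ((-1) powi b * q powi (15 * b + 45 * tri b)))"
      unfolding sg by simp
    thus "(case (case z of (a, b) \<Rightarrow> let m = (if even b then - (b div 2) - a else a + (1 - b) div 2) in (1 - m - 3 * b, m)) of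
       (n, m) \<Rightarrow> if 3 dvd (n + m - 1) then 3 * ((-1) powi (n + m) * q powi ?e n m) else 0)
      = (- 3 * q) * (case z of (a, b) \<Rightarrow> (q ^ 9) powi (2 * (a * a) + a) * ((-1) powi b * q powi (15 * b + 45 * tri b)))"
      using nm unfolding z by (simp only: prod.case Let_def m_def[symmetric] n_def[symmetric] if_True)
  next
    fix z :: "int \<times> int" assume "z \<in> {(n, m). 3 dvd (n + m - 1)}"
    then obtain n m where z: "z = (n, m)" "3 dvd (n + m - 1)" by (cases z) auto
    then obtain k where k: "n + m - 1 = 3 * k" by (elim dvdE)
    hence k': "(n + m - 1) div 3 = k" by simp
    show "(case (case z of (n, m) \<Rightarrow> let k = (n + m - 1) div 3 in (if even k then k div 2 - m else m - (k + 1) div 2, - k)) of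
      (a, b) \<Rightarrow> let m = (if even b then - (b div 2) - a else a + (1 - b) div 2) in (1 - m - 3 * b, m)) = z"
    proof (cases "even k")
      case True
      then obtain c where c: "k = 2 * c" by blast
      have n: "n = 1 - m + 3 * (2 * c)" using k c by simp
      have "- (2 * c) div 2 = - c" by simp
      thus ?thesis using True unfolding z(1) prod.case k' c by (simp add: Let_def n)
    next
      case False
      then obtain c where c: "k = 2 * c + 1" by (rule oddE)
      have n: "n = 1 - m + 3 * (2 * c + 1)" using k c by simp
      have "(2 * c + 1 + 1) div 2 = c + 1" "(1 - - (2 * c + 1)) div 2 = c + 1" by simp_all
      thus ?thesis using False unfolding z(1) prod.case k' c by (simp add: Let_def n)
    qed
  qed auto
  also have "\<dots> \<longleftrightarrow> ((\<lambda>(n, m). if 3 dvd (n + m - 1) then 3 * ((-1) powi (n + m) * q powi ?e n m) else 0) has_sum (- 3 * q) * (psi (q ^ 9) * euler (q ^ 15))) UNIV"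
    by (rule has_sum_cong_neutral) auto
  finally have "Z q + w\<^sup>2 * Z (w * q) + w * Z (w\<^sup>2 * q) = (- 3 * q) * (psi (q ^ 9) * euler (q ^ 15))"
    using 1 has_sum_unique by blast
  thus ?thesis by simp
qed

text \<open>The product (q; q^2) splits modulo 6 into the two nontrivial factors of j(q; q^6) and
  (q^3; q^6); the latter is the quotient of \<open>euler (q ^ 6)\<close> by
  \<open>psi (q ^ 3)\<close>, by \<open>psi_product\<close> at q^3.\<close>

lemma theta_psi:
  assumes "q \<noteq> 0" "norm q < 1"
  shows "jtheta q (q ^ 6) * psi q = euler (q\<^sup>2) * psi (q ^ 3)"
proof -
  have n3: "norm (q ^ 3) < 1" "q ^ 3 \<noteq> 0" using assms by (auto simp: norm_power power_less_one_iff)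
  have prod3: "(\<Prod>i<3. f i) = f 0 * f (Suc 0) * f (Suc (Suc 0))" for f :: "nat \<Rightarrow> complex" by (simp add: numeral_3_eq_3)
  have e: "(q\<^sup>2) ^ 3 = q ^ 6" "(q ^ 3)\<^sup>2 = q ^ 6" by (simp_all flip: power_mult)
  have "q * q\<^sup>2 = q ^ 3" "q * (q\<^sup>2)\<^sup>2 = q ^ 5" by (simp_all add: eval_nat_numeral)
  hence "qpoch_inf q (q\<^sup>2) = qpoch_inf q (q ^ 6) * qpoch_inf (q ^ 3) (q ^ 6) * qpoch_inf (q ^ 5) (q ^ 6)"
    using qpoch_inf_split[OF norm_sq_less_one[OF assms(2)], of 3 q] unfolding prod3 e
    by (simp add: numeral_2_eq_2[symmetric])
  moreover have "q ^ 6 / q = q ^ 5" using assms by (simp add: eval_nat_numeral)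
  ultimately have j: "jtheta q (q ^ 6) * qpoch_inf (q ^ 3) (q ^ 6) = qpoch_inf q (q\<^sup>2) * euler (q ^ 6)"
    by (simp add: jtheta_def mult_ac)
  have p3: "psi (q ^ 3) * qpoch_inf (q ^ 3) (q ^ 6) = euler (q ^ 6)" using psi_product[OF n3(2,1)] unfolding e .
  have p1: "psi q * qpoch_inf q (q\<^sup>2) = euler (q\<^sup>2)" by (rule psi_product[OF assms])
  have nz: "qpoch_inf (q ^ 3) (q ^ 6) \<noteq> 0" using qpoch_inf_odd_nonzero(1)[OF n3(1)] unfolding e .
  have "jtheta q (q ^ 6) * psi q * qpoch_inf (q ^ 3) (q ^ 6) = (jtheta q (q ^ 6) * qpoch_inf (q ^ 3) (q ^ 6)) * psi q"
    by (simp only: mult_ac)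
  also have "\<dots> = (psi q * qpoch_inf q (q\<^sup>2)) * euler (q ^ 6)" unfolding j by (simp only: mult_ac)
  also have "\<dots> = euler (q\<^sup>2) * psi (q ^ 3) * qpoch_inf (q ^ 3) (q ^ 6)" unfolding p1 p3[symmetric] by (simp only: mult_ac)
  finally show ?thesis using nz by simp
qed

subsection \<open>The identity\<close>

text \<open>Multiplication by \<open>T\<close> and \<open>psi (q ^ 3)\<close> clears the denominator
  from \<open>kap_sum\<close> and, through \<open>theta_psi\<close>, removes \<open>psi q\<close>.
  All factors besides \<open>mock_chi q\<close>, \<open>appell w q\<close> and the last theta
  product are then functions of q^3, invariant under q -> w q.\<close>

lemma chi_appell:
  assumes "q \<noteq> 0" "norm q < 1" "1 + w + w\<^sup>2 = 0"
  defines "T \<equiv> jtheta (q ^ 6) (q ^ 30)"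
  shows "euler (q ^ 15) * T * psi (q ^ 3) * mock_chi q
    = T * psi (q ^ 3) * appell w q - euler (q ^ 3) * euler (q ^ 30) * (jtheta q (q ^ 6) * euler (q ^ 10))"
proof -
  obtain K where K: "((\<lambda>N. q powi (3 * N) * kap w q N) has_sum K) UNIV"
      "q ^ 6 * T * K = - (euler (q ^ 30) * (euler (q\<^sup>2) * euler (q ^ 10)))"
    using kap_sum[OF assms(1-3)] unfolding T_def by blast
  have "euler (q ^ 15) * (q * hecke q 3) = psi q * appell w q + q ^ 6 * euler (q ^ 3) * K"
    by (rule hecke_appell[OF assms(1-3) K(1)])
  hence 1: "euler (q ^ 15) * (psi q * mock_chi q) = psi q * appell w q + q ^ 6 * euler (q ^ 3) * K"
    unfolding mock_chi_hecke[OF assms(1,2)] .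
  have "psi q * (euler (q ^ 15) * T * psi (q ^ 3) * mock_chi q) = T * psi (q ^ 3) * (euler (q ^ 15) * (psi q * mock_chi q))"
    by (simp only: mult_ac)
  also have "\<dots> = psi q * (T * psi (q ^ 3) * appell w q) + euler (q ^ 3) * psi (q ^ 3) * (q ^ 6 * T * K)"
    unfolding 1 by (simp add: algebra_simps)
  also have "\<dots> = psi q * (T * psi (q ^ 3) * appell w q) - euler (q ^ 3) * euler (q ^ 30) * euler (q ^ 10) * (euler (q\<^sup>2) * psi (q ^ 3))"
    unfolding K(2) by (simp add: algebra_simps)
  also have "\<dots> = psi q * (T * psi (q ^ 3) * appell w q - euler (q ^ 3) * euler (q ^ 30) * (jtheta q (q ^ 6) * euler (q ^ 10)))"
    unfolding theta_psi[OF assms(1,2), symmetric] by (simp add: algebra_simps)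
  finally show ?thesis using psi_nonzero[OF assms(1,2)] by simp
qed

text \<open>The first sum comes from dissecting \<open>chi_appell\<close>, where the Appell part
  drops out. The second comes from \<open>hecke_dissection\<close>: after the three values of psi
  are expressed through psi(q) - B and B, the relation is linear in the two sums, with nonzero
  coefficient B at the second.\<close>

lemma chi_sums:
  assumes "q \<noteq> 0" "norm q < 1" "1 + w + w\<^sup>2 = 0"
  defines "R \<equiv> jtheta (q ^ 18) (q ^ 30) * euler (q ^ 3) / (psi (q ^ 3) * euler (q ^ 6))"
    and "B \<equiv> q * psi (q ^ 9)"
  shows "mock_chi q + w\<^sup>2 * mock_chi (w * q) + w * mock_chi (w\<^sup>2 * q) = 3 * B * R"
    and "mock_chi q + mock_chi (w * q) + mock_chi (w\<^sup>2 * q) = 3 * mock_X (q ^ 9) - 3 * (psi q - B) * R"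
proof -
  note w = cube_root[OF assms(3)]
  note sc = cube_root_scaling[OF assms(3,1,2)]
  have w23: "(w\<^sup>2) ^ 3 = 1" using w(1) by (metis power_mult mult.commute power_one)
  have scale: "(v * q) ^ (3 * k) = q ^ (3 * k)" if "v ^ 3 = 1" for v k
    using that by (simp add: power_mult power_mult_distrib)
  have sc3: "(v * q) ^ 3 = q ^ 3" "(v * q) ^ 6 = q ^ 6" "(v * q) ^ 9 = q ^ 9" "(v * q) ^ 15 = q ^ 15" "(v * q) ^ 30 = q ^ 30" if "v ^ 3 = 1" for v
    using scale[OF that, of 1] scale[OF that, of 2] scale[OF that, of 3] scale[OF that, of 5] scale[OF that, of 10] by simp_all
  have less: "norm (q ^ k) < 1" if "k > 0" for k
    using assms that by (simp add: norm_power power_less_one_iff)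
  define T where "T = jtheta (q ^ 6) (q ^ 30)"
  define Z where "Z = (\<lambda>q. jtheta q (q ^ 6) * euler (q ^ 10))"
  define D where "D = T * psi (q ^ 3)"
  define E where "E = euler (q ^ 3) * euler (q ^ 30)"
  have nz: "euler (q ^ k) \<noteq> 0" if "k > 0" for k
    using qpoch_inf_nonzero' less[OF that] by blast
  have T0: "T \<noteq> 0" unfolding T_def
  proof (rule jtheta_nonzero)
    have "norm q ^ 30 < norm q ^ 6" using assms by (intro power_strict_decreasing) auto
    thus "norm (q ^ 30) < norm (q ^ 6)" by (simp add: norm_power)
  qed (use less in auto)
  have p3: "psi (q ^ 3) \<noteq> 0" "psi (q ^ 9) \<noteq> 0" using psi_nonzero[of "q ^ 3"] psi_nonzero[of "q ^ 9"] assms(1) less[of 3] less[of 9] by simp_all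
  have chi: "euler (q ^ 15) * D * mock_chi (v * q) = D * appell w (v * q) - E * Z (v * q)"
    if "v ^ 3 = 1" "v * q \<noteq> 0" "norm (v * q) < 1" for v
    using chi_appell[OF that(2,3) assms(3)] unfolding sc3[OF that(1)] D_def E_def Z_def T_def by (simp only: mult_ac)
  have c0: "euler (q ^ 15) * D * mock_chi q = D * appell w q - E * Z q"
    using chi[of 1] assms by simp
  note c1 = chi[OF w(1) sc(1,2)] and c2 = chi[OF w23 sc(3,4)]
  let ?S = "mock_chi q + w\<^sup>2 * mock_chi (w * q) + w * mock_chi (w\<^sup>2 * q)"
  have "euler (q ^ 15) * D * ?S = euler (q ^ 15) * D * mock_chi q + w\<^sup>2 * (euler (q ^ 15) * D * mock_chi (w * q)) + w * (euler (q ^ 15) * D * mock_chi (w\<^sup>2 * q))"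
    by (simp add: algebra_simps)
  also have "\<dots> = D * (appell w q + w\<^sup>2 * appell w (w * q) + w * appell w (w\<^sup>2 * q)) - E * (Z q + w\<^sup>2 * Z (w * q) + w * Z (w\<^sup>2 * q))"
    unfolding c0 c1 c2 by (simp add: algebra_simps)
  also have "\<dots> = E * (3 * (q * psi (q ^ 9) * euler (q ^ 15)))"
    using appell_dissection[OF assms(1-3)] theta_product_dissection[OF assms(1-3)] unfolding Z_def by simp
  finally have "euler (q ^ 15) * (D * ?S) = euler (q ^ 15) * (3 * B * E)"
    by (simp only: B_def mult_ac)
  hence DS: "D * ?S = 3 * B * E" using nz[of 15] by simp
  \<comment> \<open>The two theta functions of base q^30 are complementary by
    \<open>jtheta_5\<close> at q^6. This turns 1 / T into a multiple of j(q^18; q^30), the origin of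
    that factor in the final formula.\<close>
  have "T * jtheta (q ^ 18) (q ^ 30) = euler (q ^ 6) * euler (q ^ 30)"
    using jtheta_5[of "q ^ 6"] assms(1) less[of 6] by (simp add: T_def flip: power_mult)
  hence "D * (3 * B * R) = 3 * B * E"
    using nz[of 6] p3 by (simp add: D_def E_def R_def field_simps)
  hence "D * ?S = D * (3 * B * R)" unfolding DS by (rule sym)
  moreover have "D \<noteq> 0" using T0 p3 by (simp add: D_def)
  ultimately show S: "?S = 3 * B * R" by simp
  have pw: "psi (w * q) = (psi q - B) + w * B"
    using psi_dissection[OF assms(1-3)] by (simp add: B_def)
  have w4: "(w\<^sup>2)\<^sup>2 = w" using w(1) by (simp add: eval_nat_numeral)
  have pw2: "psi (w\<^sup>2 * q) = (psi q - B) + w\<^sup>2 * B"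
    using psi_dissection[OF assms(1,2), of "w\<^sup>2"] assms(3) by (simp only: w4 B_def add_ac)
  let ?U = "mock_chi q + mock_chi (w * q) + mock_chi (w\<^sup>2 * q)"
  have "3 * (q * hecke (q ^ 9) 1) = psi q * mock_chi q + w\<^sup>2 * (psi (w * q) * mock_chi (w * q)) + w * (psi (w\<^sup>2 * q) * mock_chi (w\<^sup>2 * q))"
    unfolding mock_chi_hecke[OF assms(1,2)] mock_chi_hecke[OF sc(1,2)] mock_chi_hecke[OF sc(3,4)]
    using hecke_dissection[OF assms(1-3)] by simp
  also have "\<dots> = (psi q - B) * ?S + B * (mock_chi q + w ^ 3 * mock_chi (w * q) + w ^ 3 * mock_chi (w\<^sup>2 * q))"
    unfolding pw pw2 by (simp add: algebra_simps power2_eq_square power3_eq_cube)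
  also have "\<dots> = (psi q - B) * (3 * B * R) + B * ?U" unfolding S w(1) by simp
  finally have "B * ?U = B * (3 * mock_X (q ^ 9) - 3 * (psi q - B) * R)"
    using mock_X_hecke[of "q ^ 9"] assms(1) less[of 9] by (simp add: B_def algebra_simps)
  moreover have "B \<noteq> 0" using p3 assms by (simp add: B_def)
  ultimately show "?U = 3 * mock_X (q ^ 9) - 3 * (psi q - B) * R" by simp
qed

theorem mainTheorem3:
  fixes q \<omega> :: complex
  assumes "0 < norm q" and "norm q < 1"
    and "primitive_unity_root 3 \<omega>"
  shows "mock_X (q ^ 9)
           - (\<omega> * mock_chi (\<omega> * q) - \<omega>\<^sup>2 * mock_chi (\<omega>\<^sup>2 * q)) / (\<omega> - \<omega>\<^sup>2)
         = theta_Jbar q 1 4 / theta_Jbar q 3 12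
           * (theta_J q 18 30 * eta_J q 3 / eta_J q 6)"
proof -
  have q: "q \<noteq> 0" "norm q < 1" using assms by auto
  have w1: "\<omega> ^ 3 = 1" "\<omega> \<noteq> 1"
    using assms(3) by (auto simp: primitive_unity_root_def dest: spec[of _ "1 :: nat"])
  have "(\<omega> - 1) * (1 + \<omega> + \<omega>\<^sup>2) = \<omega> ^ 3 - 1" by (simp add: algebra_simps eval_nat_numeral)
  hence w: "1 + \<omega> + \<omega>\<^sup>2 = 0" using w1 by simp
  have "\<omega> \<noteq> 0" using w by auto
  hence d: "\<omega> - \<omega>\<^sup>2 \<noteq> 0" using w1 by (auto simp: power2_eq_square)
  define R where "R = jtheta (q ^ 18) (q ^ 30) * euler (q ^ 3) / (psi (q ^ 3) * euler (q ^ 6))"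
  define B where "B = q * psi (q ^ 9)"
  let ?c0 = "mock_chi q" and ?c1 = "mock_chi (\<omega> * q)" and ?c2 = "mock_chi (\<omega>\<^sup>2 * q)"
  note cs = chi_sums[OF q w, folded R_def, folded B_def]
  \<comment> \<open>Subtracting the two sums of \<open>chi_sums\<close> removes \<chi>(q) and leaves
    the coefficients 1 - \<omega>^2 and 1 - \<omega>, which \<omega> - \<omega>^2 turns into 3
    \<omega> and -3 \<omega>^2. On the right the terms with B cancel, so only psi(q) R remains
    beside X(q^9).\<close>
  have "3 * (\<omega> * ?c1 - \<omega>\<^sup>2 * ?c2) = (\<omega> - \<omega>\<^sup>2) * ((?c0 + ?c1 + ?c2) - (?c0 + \<omega>\<^sup>2 * ?c1 + \<omega> * ?c2))"
  proof -
    have 1: "(\<omega> - \<omega>\<^sup>2) * (1 - \<omega>\<^sup>2) = 3 * \<omega>" and 2: "(\<omega> - \<omega>\<^sup>2) * (1 - \<omega>) = - (3 * \<omega>\<^sup>2)"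
      using w by algebra+
    have "(\<omega> - \<omega>\<^sup>2) * ((?c0 + ?c1 + ?c2) - (?c0 + \<omega>\<^sup>2 * ?c1 + \<omega> * ?c2))
      = ((\<omega> - \<omega>\<^sup>2) * (1 - \<omega>\<^sup>2)) * ?c1 + ((\<omega> - \<omega>\<^sup>2) * (1 - \<omega>)) * ?c2" by (simp add: algebra_simps)
    thus ?thesis unfolding 1 2 by simp
  qed
  hence "3 * (\<omega> * ?c1 - \<omega>\<^sup>2 * ?c2) = 3 * ((\<omega> - \<omega>\<^sup>2) * (mock_X (q ^ 9) - psi q * R))"
    unfolding cs by (simp add: algebra_simps)
  hence "\<omega> * ?c1 - \<omega>\<^sup>2 * ?c2 = (\<omega> - \<omega>\<^sup>2) * (mock_X (q ^ 9) - psi q * R)"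
    by (simp only: mult_cancel_left) simp
  hence "(\<omega> * ?c1 - \<omega>\<^sup>2 * ?c2) / (\<omega> - \<omega>\<^sup>2) = mock_X (q ^ 9) - psi q * R"
    using d by simp
  moreover have "theta_Jbar q 1 4 = psi q" by (simp add: theta_Jbar_def psi_def)
  moreover have "theta_Jbar q 3 12 = psi (q ^ 3)" by (simp add: theta_Jbar_def psi_def flip: power_mult)
  moreover have "theta_J q 18 30 = jtheta (q ^ 18) (q ^ 30)" by (simp add: theta_J_def)
  moreover have "eta_J q 3 = euler (q ^ 3)"
    using jtheta_3[of "q ^ 3"] q by (simp add: eta_J_def theta_J_def norm_power power_less_one_iff flip: power_mult)
  moreover have "eta_J q 6 = euler (q ^ 6)"
    using jtheta_3[of "q ^ 6"] q by (simp add: eta_J_def theta_J_def norm_power power_less_one_iff flip: power_mult)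
  ultimately show ?thesis by (simp add: R_def)
qed

end
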